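(* Suppose that $\sigma$ satisfies the following: $\sigma(t,x,u)$ is symmetric and there are constants $L_\sigma,C_\sigma>0$ with $|\sigma(t,x,u)-\sigma(t,x',u')|\le L_\sigma(|x-x'|+|u-u'|)$ and $\frac1{C_\sigma}|z|^2\le|\sigma(t,x,u)z|^2\le C_\sigma|z|^2$ for all $t\in[0,T]$, $x,x'\in\mathbb R^d$, $u,u'\in\mathbb R^n$, $z\in\mathbb R^d$. Suppose that $f$ satisfies at least one of the conditions (AB1), (AB2) spelled out in the context. Suppose further that $g$ is bounded. Then for any decoupling solution $u$ of the terminal value problem $$\partial_t u^i+\mathrm{tr}(a(t,x,u)D^2u^i)+f^i(t,x,u,Du)=0\ \text{ in }(0,T)\times\mathbb R^d,\qquad u^i(T,x)=g^i(x),\qquad i=1,\dots,n,$$ with $a=\frac12\sigma\sigma^T$, we have $$\|u\|_{L^\infty}\le C,$$ for a constant $C$ depending only on $\|g\|_{L^\infty}$, $C_\sigma$, and either $\{a_1,\dots,a_Q\}$ and $M$ (if (AB1) is assumed) or $M$ (if (AB2) is assumed).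
   Context: $n,d\in\mathbb N$ and $T\in(0,\infty)$ are fixed; constants may always depend on $n,d,T$. $B$ is a $d$-dimensional Brownian motion on a probability space, with augmented filtration. The data are functions $\sigma:[0,T]\times\mathbb R^d\times\mathbb R^n\to\mathbb R^{d\times d}$, $f=(f^i)_{i=1}^n:[0,T]\times\mathbb R^d\times\mathbb R^n\times(\mathbb R^d)^n\to\mathbb R^n$, $g=(g^i)_{i=1}^n:\mathbb R^d\to\mathbb R^n$. $|\cdot|$ is the Euclidean norm. $Du=(Du^i)_{i=1}^n\in(\mathbb R^d)^n$ is the spatial gradient. For $p\in(\mathbb R^d)^n$ and $Q\in\mathbb R^{d\times d}$, $Qp\in(\mathbb R^d)^n$ has $i$-th element $Qp^i$; for a process $Z$ in $(\mathbb R^d)^n$, $Z\,dB$ has $i$-th component $Z^i\cdot dB$. Condition (AB1): $f^i(t,x,u,p)=p^i\cdot b_0(t,x,u,p)+b^i(t,x,u,p)$, where $b_0$ ($\mathbb R^d$-valued) and $b=(b^i)_{i=1}^n$ satisfy, for all $(t,x,u,p)$ and $q=1,\dots,Q$: 1) $|b_0(t,x,u,p)|\le M(1+\kappa(|u|+|p|))$; 2) $a_q^Tb(t,x,u,p)\le M+\frac12|a_q^Tp|^2$, for some constant $M>0$, increasing function $\kappa:\mathbb R_+\to\mathbb R_+$, and set $\{a_1,\dots,a_Q\}$ of vectors positively spanning $\mathbb R^n$ (every vector of $\mathbb R^n$ is a nonnegative linear combination of them). Here $a_q^Tp=\sum_i a_q^ip^i\in\mathbb R^d$. Condition (AB2):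 $f^i(t,x,u,p)=p^i\cdot b_0(t,x,u,p)+b^i(t,x,u,p)$, where for all $(t,x,u,p)$: 1) $|b_0(t,x,u,p)|\le M(1+\kappa(|u|+|p|))$; 2) $|b^i(t,x,u,p)|\le M(1+|u|+|p|)$, for some $M>0$ and some increasing $\kappa:\mathbb R_+\to\mathbb R_+$. Decoupling solution: a bounded and continuous $u:[0,T]\times\mathbb R^d\to\mathbb R^n$ such that $Du$ is bounded and continuous on $[0,T)\times\mathbb R^d$; for each $(t,x)\in[0,T]\times\mathbb R^d$ the SDE $X_{t'}=x+\int_t^{t'}\sigma(s,X_s,u(s,X_s))\,dB_s$, $t'\in[t,T]$, has a unique (strong) solution $X=X^{t,x}$; and with $Y^{t,x}=u(\cdot,X^{t,x})$, $Z^{t,x}=\sigma(\cdot,X^{t,x},Y^{t,x})Du(\cdot,X^{t,x})$ one has, for $t'\in[t,T]$, $$Y^{t,x}_{t'}=g(X^{t,x}_T)+\int_{t'}^Tf\big(s,X^{t,x}_s,Y^{t,x}_s,\sigma^{-1}(s,X^{t,x}_s,Y^{t,x}_s)Z^{t,x}_s\big)ds-\int_{t'}^TZ^{t,x}_s\,dB_s.$$ *)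

theory Defs
  imports "HOL-Probability.Probability" "HOL-Probability.Essential_Supremum"
begin

text \<open>
  Elements p of (R^d)^n have type \<open>real^'d^'n\<close>, with \<open>p $ i\<close> the i-th element; their norm is the
  Euclidean (Frobenius) norm, and likewise for d x d matrices.
\<close>

section \<open>The L-infinity norm\<close>

definition Linf_norm :: "'a::euclidean_space set \<Rightarrow> ('a \<Rightarrow> 'b::real_normed_vector) \<Rightarrow> ereal"
  where "Linf_norm S h = esssup (lebesgue_on S) (\<lambda>z. ereal (norm (h z)))"


section \<open>Brownian motion and its augmented filtration\<close>

definition natural_filtration :: "'w measure \<Rightarrow> (real \<Rightarrow> 'w \<Rightarrow> real^'d) \<Rightarrow> real \<Rightarrow> 'w measure"
  where "natural_filtration P B s =
    sigma (space P) (\<Union>r\<in>{0..s}. {B r -` A \<inter> space P | A. A \<in> sets borel})"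

text \<open>
  \<open>P\<close> need not be complete, so the null sets are those of its completion. Like the natural
  filtration, the augmented one consists of sigma-algebras only: the measure carried by the type
  is irrelevant.
\<close>

definition augmented_filtration :: "'w measure \<Rightarrow> (real \<Rightarrow> 'w \<Rightarrow> real^'d) \<Rightarrow> real \<Rightarrow> 'w measure"
  where "augmented_filtration P B s =
    sigma (space P) (sets (natural_filtration P B s) \<union> null_sets (completion P))"

text \<open>
  Standard d-dimensional Brownian motion on the time interval [0,T]. The density is that of the
  normal distribution with mean 0 and covariance (t - s) I.
\<close>

definition brownian_motion :: "'w measure \<Rightarrow> real \<Rightarrow> (real \<Rightarrow> 'w \<Rightarrow> real^'d) \<Rightarrow> bool"
  where "brownian_motion P T B \<longleftrightarrow>
    prob_space P \<and>
    (\<forall>t\<in>{0..T}. B t \<in> borel_measurable P) \<and>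
    (AE \<omega> in P. B 0 \<omega> = 0) \<and>
    (AE \<omega> in P. continuous_on {0..T} (\<lambda>t. B t \<omega>)) \<and>
    (\<forall>s t. 0 \<le> s \<and> s < t \<and> t \<le> T \<longrightarrow>
      distributed P lborel (\<lambda>\<omega>. B t \<omega> - B s \<omega>)
        (\<lambda>x. ennreal (\<Prod>j\<in>UNIV. normal_density 0 (sqrt (t - s)) (x $ j))) \<and>
      prob_space.indep_set P (sets (natural_filtration P B s))
        (sets (vimage_algebra (space P) (\<lambda>\<omega>. B t \<omega> - B s \<omega>) borel)))"


section \<open>The Ito integral\<close>

definition adapted_on :: "(real \<Rightarrow> 'w measure) \<Rightarrow> real \<Rightarrow> real \<Rightarrow>
    (real \<Rightarrow> 'w \<Rightarrow> 'c::topological_space) \<Rightarrow> bool"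
  where "adapted_on F a b X \<longleftrightarrow> (\<forall>s\<in>{a..b}. X s \<in> borel_measurable (F s))"

text \<open>
  The right endpoint is left out on purpose: it does not matter for integrals over [a,b], and the
  integrand Z below involves the gradient Du, which need not exist at the terminal time.
\<close>

definition progressive_on :: "(real \<Rightarrow> 'w measure) \<Rightarrow> real \<Rightarrow> real \<Rightarrow>
    (real \<Rightarrow> 'w \<Rightarrow> 'c::topological_space) \<Rightarrow> bool"
  where "progressive_on F a b H \<longleftrightarrow>
    (\<forall>s\<in>{a..<b}. (\<lambda>(r, \<omega>). H r \<omega>) \<in> borel_measurable (restrict_space borel {a..s} \<Otimes>\<^sub>M F s))"

definition tendsto_zero_in_prob :: "'w measure \<Rightarrow> (nat \<Rightarrow> 'w \<Rightarrow> ennreal) \<Rightarrow> bool"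
  where "tendsto_zero_in_prob P V \<longleftrightarrow>
    (\<forall>m. V m \<in> borel_measurable P) \<and>
    (\<forall>\<epsilon>>0::real. (\<lambda>m. measure P {\<omega> \<in> space P. V m \<omega> > ennreal \<epsilon>}) \<longlonglongrightarrow> 0)"

text \<open>
  A simple process on [a,b] is the sum over i < k of the indicator of the interval from \<open>\<tau> i\<close>
  (excluded) to \<open>\<tau> (Suc i)\<close> (included) times the bounded random matrix \<open>\<xi> i\<close>, measurable at
  time \<open>\<tau> i\<close>.
\<close>

definition simple_process :: "(real \<Rightarrow> 'w measure) \<Rightarrow> real \<Rightarrow> real \<Rightarrow>
    nat \<Rightarrow> (nat \<Rightarrow> real) \<Rightarrow> (nat \<Rightarrow> 'w \<Rightarrow> real^'d^'m) \<Rightarrow> bool"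
  where "simple_process F a b k \<tau> \<xi> \<longleftrightarrow>
    \<tau> 0 = a \<and> \<tau> k = b \<and>
    (\<forall>i<k. \<tau> i \<le> \<tau> (Suc i) \<and> \<xi> i \<in> borel_measurable (F (\<tau> i)) \<and>
      bounded (\<xi> i ` space (F (\<tau> i))))"

definition simple_value :: "nat \<Rightarrow> (nat \<Rightarrow> real) \<Rightarrow> (nat \<Rightarrow> 'w \<Rightarrow> real^'d^'m) \<Rightarrow>
    real \<Rightarrow> 'w \<Rightarrow> real^'d^'m"
  where "simple_value k \<tau> \<xi> s \<omega> = (\<Sum>i<k. indicat_real {\<tau> i<..\<tau> (Suc i)} s *\<^sub>R \<xi> i \<omega>)"

definition simple_integral :: "(real \<Rightarrow> 'w \<Rightarrow> real^'d) \<Rightarrow>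
    nat \<Rightarrow> (nat \<Rightarrow> real) \<Rightarrow> (nat \<Rightarrow> 'w \<Rightarrow> real^'d^'m) \<Rightarrow> real \<Rightarrow> 'w \<Rightarrow> real^'m"
  where "simple_integral B k \<tau> \<xi> s \<omega> =
    (\<Sum>i<k. \<xi> i \<omega> *v (B (min (\<tau> (Suc i)) s) \<omega> - B (min (\<tau> i) s) \<omega>))"

text \<open>
  \<open>ito_integral P B a b H I\<close>: the integrand H is progressively measurable with respect to the
  augmented filtration and almost surely square integrable over [a,b], and I is (a version of) the
  process of the integrals of H dB from a to s, for s in [a,b]. As usual, I is the limit, uniformly
  in s in probability, of integrals of simple processes that approximate H in the space-time
  L2 sense in probability. The integrand is matrix valued and acts on dB by matrix-vector
  multiplication; in particular the i-th component of the integral has integrand \<open>H $ i\<close>, paired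
  with dB by the inner product.
\<close>

definition ito_integral :: "'w measure \<Rightarrow> (real \<Rightarrow> 'w \<Rightarrow> real^'d) \<Rightarrow> real \<Rightarrow> real \<Rightarrow>
    (real \<Rightarrow> 'w \<Rightarrow> real^'d^'m) \<Rightarrow> (real \<Rightarrow> 'w \<Rightarrow> real^'m) \<Rightarrow> bool"
  where "ito_integral P B a b H I \<longleftrightarrow>
    progressive_on (augmented_filtration P B) a b H \<and>
    (AE \<omega> in P. (\<integral>\<^sup>+s\<in>{a..b}. ennreal ((norm (H s \<omega>))\<^sup>2) \<partial>lborel) < \<infinity>) \<and>
    adapted_on (augmented_filtration P B) a b I \<and>
    (AE \<omega> in P. continuous_on {a..b} (\<lambda>s. I s \<omega>)) \<and>
    (\<exists>k \<tau> \<xi>.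
      (\<forall>m. simple_process (augmented_filtration P B) a b (k m) (\<tau> m) (\<xi> m)) \<and>
      tendsto_zero_in_prob (completion P) (\<lambda>m \<omega>.
        \<integral>\<^sup>+s\<in>{a..b}. ennreal ((norm (simple_value (k m) (\<tau> m) (\<xi> m) s \<omega> - H s \<omega>))\<^sup>2) \<partial>lborel) \<and>
      tendsto_zero_in_prob (completion P) (\<lambda>m \<omega>.
        SUP s\<in>{a..b}. ennreal (norm (simple_integral B (k m) (\<tau> m) (\<xi> m) s \<omega> - I s \<omega>))))"


section \<open>Decoupling solutions\<close>

text \<open>Qp is the element of (R^d)^n whose i-th element is the matrix-vector product of Q and p^i.\<close>

definition mat_act :: "real^'d^'d \<Rightarrow> real^'d^'n \<Rightarrow> real^'d^'n"
  where "mat_act Q p = (\<chi> i. Q *v (p $ i))"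

definition sde_solution :: "'w measure \<Rightarrow> (real \<Rightarrow> 'w \<Rightarrow> real^'d) \<Rightarrow> real \<Rightarrow>
    (real \<Rightarrow> real^'d \<Rightarrow> real^'n \<Rightarrow> real^'d^'d) \<Rightarrow> (real \<Rightarrow> real^'d \<Rightarrow> real^'n) \<Rightarrow>
    real \<Rightarrow> real^'d \<Rightarrow> (real \<Rightarrow> 'w \<Rightarrow> real^'d) \<Rightarrow> bool"
  where "sde_solution P B T \<sigma> u t x X \<longleftrightarrow>
    adapted_on (augmented_filtration P B) t T X \<and>
    (AE \<omega> in P. continuous_on {t..T} (\<lambda>s. X s \<omega>)) \<and>
    (\<exists>I. ito_integral P B t T (\<lambda>s \<omega>. \<sigma> s (X s \<omega>) (u s (X s \<omega>))) I \<and>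
      (AE \<omega> in P. \<forall>t'\<in>{t..T}. X t' \<omega> = x + I t' \<omega>))"

text \<open>
  The integral ds is a pathwise Lebesgue integral, whose existence is part of the equation. The
  integral of Z dB from t' to T is written as the difference of two values of the integral process
  started at t.
\<close>

definition bsde_holds :: "'w measure \<Rightarrow> (real \<Rightarrow> 'w \<Rightarrow> real^'d) \<Rightarrow> real \<Rightarrow>
    (real \<Rightarrow> real^'d \<Rightarrow> real^'n \<Rightarrow> real^'d^'d) \<Rightarrow>
    (real \<Rightarrow> real^'d \<Rightarrow> real^'n \<Rightarrow> real^'d^'n \<Rightarrow> real^'n) \<Rightarrow> (real^'d \<Rightarrow> real^'n) \<Rightarrow> real \<Rightarrow>
    (real \<Rightarrow> 'w \<Rightarrow> real^'d) \<Rightarrow> (real \<Rightarrow> 'w \<Rightarrow> real^'n) \<Rightarrow> (real \<Rightarrow> 'w \<Rightarrow> real^'d^'n) \<Rightarrow> bool"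
  where "bsde_holds P B T \<sigma> f g t X Y Z \<longleftrightarrow>
    (let drv = (\<lambda>\<omega> s. f s (X s \<omega>) (Y s \<omega>) (mat_act (matrix_inv (\<sigma> s (X s \<omega>) (Y s \<omega>))) (Z s \<omega>)))
     in \<exists>I. ito_integral P B t T Z I \<and>
       (AE \<omega> in P. drv \<omega> absolutely_integrable_on {t..T} \<and>
         (\<forall>t'\<in>{t..T}. Y t' \<omega> = g (X T \<omega>) + integral {t'..T} (drv \<omega>) - (I T \<omega> - I t' \<omega>))))"

text \<open>
  Row i of \<open>jacobian (u s) (at x)\<close> is the spatial gradient of the i-th component of u.
\<close>

definition decoupling_solution :: "'w measure \<Rightarrow> (real \<Rightarrow> 'w \<Rightarrow> real^'d) \<Rightarrow> real \<Rightarrow>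
    (real \<Rightarrow> real^'d \<Rightarrow> real^'n \<Rightarrow> real^'d^'d) \<Rightarrow>
    (real \<Rightarrow> real^'d \<Rightarrow> real^'n \<Rightarrow> real^'d^'n \<Rightarrow> real^'n) \<Rightarrow> (real^'d \<Rightarrow> real^'n) \<Rightarrow>
    (real \<Rightarrow> real^'d \<Rightarrow> real^'n) \<Rightarrow> bool"
  where "decoupling_solution P B T \<sigma> f g u \<longleftrightarrow>
    bounded ((\<lambda>(t, x). u t x) ` ({0..T} \<times> UNIV)) \<and>
    continuous_on ({0..T} \<times> UNIV) (\<lambda>(t, x). u t x) \<and>
    (\<forall>t\<in>{0..<T}. \<forall>x. u t differentiable (at x)) \<and>
    bounded ((\<lambda>(t, x). jacobian (u t) (at x)) ` ({0..<T} \<times> UNIV)) \<and>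
    continuous_on ({0..<T} \<times> UNIV) (\<lambda>(t, x). jacobian (u t) (at x)) \<and>
    (\<forall>t\<in>{0..T}. \<forall>x. \<exists>X.
      sde_solution P B T \<sigma> u t x X \<and>
      (\<forall>X'. sde_solution P B T \<sigma> u t x X' \<longrightarrow> (AE \<omega> in P. \<forall>s\<in>{t..T}. X' s \<omega> = X s \<omega>)) \<and>
      (let Y = (\<lambda>s \<omega>. u s (X s \<omega>));
           Z = (\<lambda>s \<omega>. mat_act (\<sigma> s (X s \<omega>) (Y s \<omega>)) (jacobian (u s) (at (X s \<omega>))))
       in bsde_holds P B T \<sigma> f g t X Y Z))"


section \<open>Conditions on the data\<close>

definition sigma_condition :: "real \<Rightarrow> (real \<Rightarrow> real^'d \<Rightarrow> real^'n \<Rightarrow> real^'d^'d) \<Rightarrow>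
    real \<Rightarrow> real \<Rightarrow> bool"
  where "sigma_condition T \<sigma> L\<^sub>\<sigma> C\<^sub>\<sigma> \<longleftrightarrow>
    L\<^sub>\<sigma> > 0 \<and> C\<^sub>\<sigma> > 0 \<and>
    (\<forall>t\<in>{0..T}. \<forall>x u. transpose (\<sigma> t x u) = \<sigma> t x u) \<and>
    (\<forall>t\<in>{0..T}. \<forall>x x' u u'.
      norm (\<sigma> t x u - \<sigma> t x' u') \<le> L\<^sub>\<sigma> * (norm (x - x') + norm (u - u'))) \<and>
    (\<forall>t\<in>{0..T}. \<forall>x u z.
      1 / C\<^sub>\<sigma> * (norm z)\<^sup>2 \<le> (norm (\<sigma> t x u *v z))\<^sup>2 \<and>
      (norm (\<sigma> t x u *v z))\<^sup>2 \<le> C\<^sub>\<sigma> * (norm z)\<^sup>2)"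

definition positively_spans :: "(real^'n) set \<Rightarrow> bool"
  where "positively_spans A \<longleftrightarrow>
    finite A \<and> (\<forall>v. \<exists>c. (\<forall>a\<in>A. c a \<ge> 0) \<and> v = (\<Sum>a\<in>A. c a *\<^sub>R a))"

definition increasing_nonneg :: "(real \<Rightarrow> real) \<Rightarrow> bool"
  where "increasing_nonneg \<kappa> \<longleftrightarrow> mono_on {0..} \<kappa> \<and> (\<forall>r\<ge>0. \<kappa> r \<ge> 0)"

definition f_decomposition :: "real \<Rightarrow>
    (real \<Rightarrow> real^'d \<Rightarrow> real^'n \<Rightarrow> real^'d^'n \<Rightarrow> real^'n) \<Rightarrow>
    (real \<Rightarrow> real^'d \<Rightarrow> real^'n \<Rightarrow> real^'d^'n \<Rightarrow> real^'d) \<Rightarrow>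
    (real \<Rightarrow> real^'d \<Rightarrow> real^'n \<Rightarrow> real^'d^'n \<Rightarrow> real^'n) \<Rightarrow> bool"
  where "f_decomposition T f b\<^sub>0 b \<longleftrightarrow>
    (\<forall>t\<in>{0..T}. \<forall>x u p i. f t x u p $ i = (p $ i) \<bullet> b\<^sub>0 t x u p + b t x u p $ i)"

text \<open>
  In the second bound of the first condition, \<open>a v* p\<close> is the vector of R^d that is the sum over i
  of \<open>a $ i\<close> times \<open>p $ i\<close>.
\<close>

definition AB1 :: "real \<Rightarrow> (real \<Rightarrow> real^'d \<Rightarrow> real^'n \<Rightarrow> real^'d^'n \<Rightarrow> real^'n) \<Rightarrow>
    (real^'n) set \<Rightarrow> real \<Rightarrow> bool"
  where "AB1 T f A M \<longleftrightarrow> M > 0 \<and> positively_spans A \<and>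
    (\<exists>\<kappa> b\<^sub>0 b. increasing_nonneg \<kappa> \<and> f_decomposition T f b\<^sub>0 b \<and>
      (\<forall>t\<in>{0..T}. \<forall>x u p.
        norm (b\<^sub>0 t x u p) \<le> M * (1 + \<kappa> (norm u + norm p)) \<and>
        (\<forall>a\<in>A. a \<bullet> b t x u p \<le> M + 1/2 * (norm (a v* p))\<^sup>2)))"

definition AB2 :: "real \<Rightarrow> (real \<Rightarrow> real^'d \<Rightarrow> real^'n \<Rightarrow> real^'d^'n \<Rightarrow> real^'n) \<Rightarrow>
    real \<Rightarrow> bool"
  where "AB2 T f M \<longleftrightarrow> M > 0 \<and>
    (\<exists>\<kappa> b\<^sub>0 b. increasing_nonneg \<kappa> \<and> f_decomposition T f b\<^sub>0 b \<and>
      (\<forall>t\<in>{0..T}. \<forall>x u p.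
        norm (b\<^sub>0 t x u p) \<le> M * (1 + \<kappa> (norm u + norm p)) \<and>
        (\<forall>i. \<bar>b t x u p $ i\<bar> \<le> M * (1 + norm u + norm p))))"

end

theory Submission
  imports Defs
begin

text \<open>
  The bound is a maximum principle, carried out on the stochastic representation of the
  solution. It is applied to a scalar function \<open>\<Psi>\<close> built from u: under the first condition
  \<open>\<Psi> = a \<bullet> u + (M + 1) t\<close> for each vector a of the positively spanning set, under the second
  \<open>\<Psi> = exp (\<gamma> t) (|u|\<^sup>2 + 1)\<close> with \<open>\<gamma>\<close> depending only on n, M and \<open>C\<^sub>\<sigma>\<close>. The claim is that \<open>\<Psi>\<close> is
  bounded by its supremum at the terminal time, where \<open>u = g\<close>.

  Subtracting \<open>\<epsilon> sqrt (1 + |x|\<^sup>2)\<close> makes the supremum a maximum, attained at some (t, x). If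
  \<open>t < T\<close>, two things hold there (\<open>maximum_principle_penalized\<close>, \<open>derivative_at_paraboloid_contact\<close>).
  The spatial gradient of \<open>\<Psi>\<close> has norm at most \<open>\<epsilon>\<close>. And for every later time s and every y,
  \<open>\<Psi> s y\<close> is at most \<open>\<Psi> t x + \<epsilon> (w \<bullet> (y - x) + |y - x|\<^sup>2 / 2)\<close> for a fixed vector w. Inserting the
  diffusion X started at (t, x), which is centred with second moment of order \<open>s - t\<close>, shows that the
  expectation of \<open>\<Psi>\<close> along X grows at most at rate \<open>O(\<epsilon>)\<close>.

  The backward equation shows the opposite over a short time h. The drift of \<open>a \<bullet> u(s, X s)\<close> is minus
  \<open>a \<bullet> f\<close>, where a is the fixed vector \<open>u(t, x)\<close> in the second case, and the part of f containing \<open>b\<^sub>0\<close> enters only through \<open>(a v* Du) \<bullet> b\<^sub>0\<close>. Along the given solution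
  \<open>b\<^sub>0\<close> is bounded by some constant, and \<open>a v* Du\<close> is of order \<open>\<epsilon>\<close> near (t, x) by continuity; so this
  part is small, which is why the final bound is independent of \<open>\<kappa>\<close> (\<open>drift_estimate\<close>). Under the
  first condition what remains of \<open>a \<bullet> f\<close> is at most \<open>M + O(\<epsilon>)\<close>, because the quadratic term is small too, and
  the drift \<open>M + 1\<close> of \<open>\<Psi>\<close> wins. Under the second condition a term of order \<open>|u| |Du|\<close> remains, in which Du need not
  be small; it is absorbed by the quadratic variation, since \<open>E |u(s, X s) - u(t, x)|\<^sup>2\<close> is at least
  about \<open>h |Du(t, x)|\<^sup>2 / (2 C\<^sub>\<sigma>)\<close> (\<open>energy_estimate\<close>). Either way \<open>t < T\<close> is impossible for small \<open>\<epsilon>\<close>.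

  The facts used about stochastic integrals are that they start at 0, have mean zero, and satisfy the
  Ito isometry when the integrand is bounded (\<open>ito_start\<close>, \<open>ito_mean\<close>, \<open>ito_isometry\<close>). They are derived from the
  definition of the integral as a limit in probability. The approximating simple processes are first
  stopped once their energy exceeds a fixed level, which changes them only with vanishing
  probability and turns the convergence in probability into convergence in mean square.
\<close>

section \<open>Gaussian increments and the augmented filtration\<close>

text \<open>
  Lebesgue measure on \<open>real^'d\<close> is an image of a product measure indexed by basis vectors; this transports
  the product rule for integrals to coordinates.
\<close>

lemma
  fixes h :: "'d::finite \<Rightarrow> real \<Rightarrow> real"
  assumes h: "\<And>j. integrable lborel (h j)"
  shows integrable_prod_cart: "integrable lborel (\<lambda>x::real^'d. \<Prod>j\<in>UNIV. h j (x $ j))"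
    and integral_prod_cart: "integral\<^sup>L lborel (\<lambda>x::real^'d. \<Prod>j\<in>UNIV. h j (x $ j)) = (\<Prod>j\<in>UNIV. \<integral>r. h j r \<partial>lborel)"
proof -
  interpret product_sigma_finite "\<lambda>_. lborel" ..
  \<comment> \<open>the index of a standard basis vector, to pass between Basis and coordinates\<close>
  define ix :: "real^'d \<Rightarrow> 'd" where "ix b = (THE j. b = axis j 1)" for b
  have ix: "ix (axis j 1) = j" for j
    unfolding ix_def by (auto simp: axis_eq_axis)
  have Basis_eq: "Basis = range (\<lambda>j. axis j (1::real))"
    by (auto simp: Basis_vec_def)
  have inj: "inj (\<lambda>j::'d. axis j (1::real))"
    by (auto simp: inj_def axis_eq_axis)
  have coord: "(\<Sum>b\<in>Basis. f b *\<^sub>R b) $ j = f (axis j 1)" for f :: "real^'d \<Rightarrow> real" and j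
  proof -
    have "(\<Sum>b\<in>Basis. f b *\<^sub>R b) $ j = (\<Sum>b\<in>Basis. f b *\<^sub>R b) \<bullet> axis j 1"
      by (simp add: inner_axis)
    also have "\<dots> = f (axis j 1)"
      by (rule inner_sum_left_Basis) (auto simp: axis_in_Basis_iff)
    finally show ?thesis .
  qed
  have prod_eq: "(\<Prod>j\<in>UNIV. h j ((\<Sum>b\<in>Basis. f b *\<^sub>R b) $ j)) = (\<Prod>b\<in>Basis. h (ix b) (f b))"
    for f :: "real^'d \<Rightarrow> real"
    by (simp only: coord) (simp only: Basis_eq prod.reindex[OF inj] o_def ix)
  have hm: "h j \<in> borel_measurable borel" for j
    using borel_measurable_integrable[OF h] by simp
  have [measurable]: "(\<lambda>x::real^'d. \<Prod>j\<in>UNIV. h j (x $ j)) \<in> borel_measurable borel"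
    by (intro borel_measurable_prod measurable_compose[OF _ hm] borel_measurable_continuous_onI continuous_intros)
  show "integrable lborel (\<lambda>x::real^'d. \<Prod>j\<in>UNIV. h j (x $ j))"
    by (subst lborel_eq, subst integrable_distr_eq)
      (simp_all only: prod_eq, simp_all, intro product_integrable_prod h, simp)
  have "integral\<^sup>L lborel (\<lambda>x::real^'d. \<Prod>j\<in>UNIV. h j (x $ j)) = (\<Prod>b\<in>Basis. \<integral>r. h (ix b) r \<partial>lborel)"
    by (subst lborel_eq, subst integral_distr)
      (simp_all only: prod_eq, simp_all, intro product_integral_prod h, simp)
  also have "\<dots> = (\<Prod>j\<in>UNIV. \<integral>r. h j r \<partial>lborel)"
    unfolding Basis_eq by (subst prod.reindex[OF inj]) (simp add: ix)
  finally show "integral\<^sup>L lborel (\<lambda>x::real^'d. \<Prod>j\<in>UNIV. h j (x $ j)) = (\<Prod>j\<in>UNIV. \<integral>r. h j r \<partial>lborel)" .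
qed

text \<open>
  Adapted processes are measurable with respect to sigma-algebras containing the null sets of the
  completion, so all expectations are taken in the completed probability space.
\<close>

locale brownian =
  fixes P :: "'w measure" and T :: real and B :: "real \<Rightarrow> 'w \<Rightarrow> real^'d"
  assumes bm: "brownian_motion P T B"
begin

abbreviation "M \<equiv> completion P"
abbreviation "F \<equiv> augmented_filtration P B"

sublocale P: prob_space P
  using bm by (simp add: brownian_motion_def)

sublocale prob_space M
  by (rule prob_spaceI) (simp add: P.emeasure_space_1)

lemma B_measurable: "0 \<le> t \<Longrightarrow> t \<le> T \<Longrightarrow> B t \<in> borel_measurable P"
  using bm by (auto simp: brownian_motion_def)

lemma increment_distributed:
  assumes "0 \<le> s" "s < t" "t \<le> T"
  shows "distributed P lborel (\<lambda>\<omega>. B t \<omega> - B s \<omega>)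
        (\<lambda>x. ennreal (\<Prod>j\<in>UNIV. normal_density 0 (sqrt (t - s)) (x $ j)))"
  using bm assms by (auto simp: brownian_motion_def)

lemma
  assumes "0 \<le> s" "s \<le> t" "t \<le> T"
  shows increment_integrable: "integrable M (\<lambda>\<omega>. (B t \<omega> - B s \<omega>) $ j)"
    and increment_mean: "expectation (\<lambda>\<omega>. (B t \<omega> - B s \<omega>) $ j) = 0"
    and increment_prod_integrable: "integrable M (\<lambda>\<omega>. (B t \<omega> - B s \<omega>) $ j * (B t \<omega> - B s \<omega>) $ k)"
    and increment_cov: "expectation (\<lambda>\<omega>. (B t \<omega> - B s \<omega>) $ j * (B t \<omega> - B s \<omega>) $ k) = (if j = k then t - s else 0)"
proof -
  have "integrable M (\<lambda>\<omega>. (B t \<omega> - B s \<omega>) $ j) \<and> expectation (\<lambda>\<omega>. (B t \<omega> - B s \<omega>) $ j) = 0 \<and>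
    integrable M (\<lambda>\<omega>. (B t \<omega> - B s \<omega>) $ j * (B t \<omega> - B s \<omega>) $ k) \<and>
    expectation (\<lambda>\<omega>. (B t \<omega> - B s \<omega>) $ j * (B t \<omega> - B s \<omega>) $ k) = (if j = k then t - s else 0)"
  proof (cases "s = t")
    case False
    then have st: "s < t" using assms by simp
    define c where "c = sqrt (t - s)"
    have c: "0 < c" "c\<^sup>2 = t - s" using st by (auto simp: c_def)
    note D = increment_distributed[OF assms(1) st assms(3), folded c_def]
    have Bm: "(\<lambda>\<omega>. B t \<omega> - B s \<omega>) \<in> borel_measurable P"
      using B_measurable[of t] B_measurable[of s] assms by simp
    have Bm': "(\<lambda>\<omega>. (B t \<omega> - B s \<omega>) $ i) \<in> borel_measurable P" for i
      by (rule measurable_compose[OF Bm]) (intro borel_measurable_continuous_onI continuous_intros)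
    have ndn: "0 \<le> (\<Prod>j\<in>UNIV. normal_density 0 c (x $ j))" for x :: "real^'d"
      by (intro prod_nonneg) auto
    have m1: "integrable lborel (\<lambda>x. normal_density 0 c x * x ^ n)" for n
      using integrable_normal_moment[OF c(1), of 0 n] by simp
    have m2: "(\<integral>x. normal_density 0 c x * x \<partial>lborel) = 0"
      using integral_normal_moment_odd[OF c(1), of 0 0] by simp
    have m3: "(\<integral>x. normal_density 0 c x * x ^ 2 \<partial>lborel) = t - s"
      using integral_normal_moment_even[OF c(1), of 0 1] c by (simp add: fact_numeral)
    have m0: "(\<integral>x. normal_density 0 c x \<partial>lborel) = 1"
      using integral_normal_density[OF c(1)] by simp
    have gen: "integrable P (\<lambda>\<omega>. \<Prod>l\<in>UNIV. ((B t \<omega> - B s \<omega>) $ l) ^ e l) \<and>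
       (\<integral>\<omega>. (\<Prod>l\<in>UNIV. ((B t \<omega> - B s \<omega>) $ l) ^ e l) \<partial>P)
         = (\<Prod>l\<in>UNIV. \<integral>x. normal_density 0 c x * x ^ e l \<partial>lborel)" for e :: "'d \<Rightarrow> nat"
    proof -
      have gm: "(\<lambda>x::real^'d. \<Prod>l\<in>UNIV. (x $ l) ^ e l) \<in> borel_measurable lborel"
        by (intro borel_measurable_prod borel_measurable_power)
          (auto intro!: borel_measurable_continuous_onI continuous_intros)
      show ?thesis
        using distributed_integrable[OF D gm ndn] distributed_integral[OF D gm ndn]
          integrable_prod_cart[of "\<lambda>l x. normal_density 0 c x * x ^ e l", OF m1]
          integral_prod_cart[of "\<lambda>l x. normal_density 0 c x * x ^ e l", OF m1]
        by (simp add: prod.distrib[symmetric])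
    qed
    have p1: "(\<Prod>l\<in>UNIV. (x $ l) ^ (if l = j then 1 else 0)) = x $ j" for x :: "real^'d" and j
    proof -
      have "(\<Prod>l\<in>UNIV. (x $ l) ^ (if l = j then 1 else 0)) = (\<Prod>l\<in>UNIV. if l = j then x $ l else 1)" for j
        by (intro prod.cong) auto
      then show ?thesis by (simp add: prod.delta)
    qed
    have p2: "(\<Prod>l\<in>UNIV. (x $ l) ^ ((if l = j then 1 else 0) + (if l = k then 1 else 0))) = x $ j * x $ k" for x :: "real^'d"
      unfolding power_add prod.distrib p1 ..
    have z1: "(\<Prod>l\<in>UNIV. \<integral>x. normal_density 0 c x * x ^ (if l = j then 1 else 0) \<partial>lborel) = 0"
      by (rule prod_zero[OF finite]) (auto intro!: bexI[of _ j] simp: m2)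
    have z2: "(\<Prod>l\<in>UNIV. \<integral>x. normal_density 0 c x * x ^ ((if l = j then 1 else 0) + (if l = k then 1 else 0)) \<partial>lborel)
       = (if j = k then t - s else 0)"
    proof (cases "j = k")
      case True
      have "(\<Prod>l\<in>UNIV. \<integral>x. normal_density 0 c x * x ^ ((if l = k then 1 else 0) + (if l = k then 1 else 0)) \<partial>lborel)
         = (\<Prod>l\<in>UNIV. if l = k then t - s else 1)"
        by (intro prod.cong refl) (simp add: m3[unfolded power2_eq_square] m0 mult.assoc power2_eq_square)
      then show ?thesis using True by (simp add: prod.delta)
    next
      case False
      show ?thesis unfolding if_not_P[OF False]
        by (rule prod_zero[OF finite]) (use False in \<open>auto intro!: bexI[of _ j] simp: m2\<close>)
    qed
    show ?thesis
      using gen[of "\<lambda>l. if l = j then 1 else 0"] gen[of "\<lambda>l. (if l = j then 1 else 0) + (if l = k then 1 else 0)"]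
      unfolding p1 p2 z1 z2
      by (simp only: integrable_completion integral_completion borel_measurable_times Bm' simp_thms)
  qed simp
  then show "integrable M (\<lambda>\<omega>. (B t \<omega> - B s \<omega>) $ j)"
    "expectation (\<lambda>\<omega>. (B t \<omega> - B s \<omega>) $ j) = 0"
    "integrable M (\<lambda>\<omega>. (B t \<omega> - B s \<omega>) $ j * (B t \<omega> - B s \<omega>) $ k)"
    "expectation (\<lambda>\<omega>. (B t \<omega> - B s \<omega>) $ j * (B t \<omega> - B s \<omega>) $ k) = (if j = k then t - s else 0)"
    by auto
qed

lemma space_natural: "space (natural_filtration P B s) = space P"
  unfolding natural_filtration_def by (rule space_measure_of) auto

lemma sets_natural: "sets (natural_filtration P B s) =
    sigma_sets (space P) (\<Union>r\<in>{0..s}. {B r -` A \<inter> space P | A. A \<in> sets borel})"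
  unfolding natural_filtration_def by (rule sets_measure_of) auto

lemma natural_subset: "s \<le> T \<Longrightarrow> sets (natural_filtration P B s) \<subseteq> sets P"
  unfolding sets_natural
  by (intro sets.sigma_sets_subset) (auto intro!: measurable_sets[OF B_measurable])

lemma augmented_gen: "sets (natural_filtration P B s) \<union> null_sets M \<subseteq> Pow (space P)"
  using sets.sets_into_space[of _ "natural_filtration P B s"] sets.sets_into_space[of _ M]
  by (auto simp: space_natural)

lemma space_augmented [simp]: "space (F s) = space P"
  unfolding augmented_filtration_def by (rule space_measure_of[OF augmented_gen])

lemma sets_augmented: "sets (F s) = sigma_sets (space P) (sets (natural_filtration P B s) \<union> null_sets M)"
  unfolding augmented_filtration_def by (rule sets_measure_of[OF augmented_gen])

lemma augmented_subset: "s \<le> T \<Longrightarrow> sets (F s) \<subseteq> sets M"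
  unfolding sets_augmented using sets.sigma_sets_subset[of "sets (natural_filtration P B s) \<union> null_sets M" M] natural_subset[of s]
  by auto

lemma augmented_mono: "r \<le> s \<Longrightarrow> sets (F r) \<subseteq> sets (F s)"
proof -
  assume "r \<le> s"
  then have "sets (natural_filtration P B r) \<subseteq> sets (natural_filtration P B s)"
    unfolding sets_natural by (intro sigma_sets_mono' UN_mono) auto
  then show ?thesis
    unfolding sets_augmented by (intro sigma_sets_mono') auto
qed

lemma measurable_augmented_mono:
  "f \<in> borel_measurable (F r) \<Longrightarrow> r \<le> s \<Longrightarrow> f \<in> borel_measurable (F s)"
  using augmented_mono[of r s] by (auto simp: measurable_def)

lemma measurable_augmented_M:
  "f \<in> borel_measurable (F r) \<Longrightarrow> r \<le> T \<Longrightarrow> f \<in> borel_measurable M"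
  using augmented_subset[of r] by (auto simp: measurable_def)

lemma B_measurable_augmented:
  assumes "0 \<le> r" "r \<le> s"
  shows "B r \<in> borel_measurable (F s)"
proof (rule measurableI)
  fix A :: "(real^'d) set" assume "A \<in> sets borel"
  then show "B r -` A \<inter> space (F s) \<in> sets (F s)"
    unfolding sets_augmented sets_natural using assms
    by (intro sigma_sets.Basic UnI1 UN_I[of r]) auto
qed simp

text \<open>
  The reason why augmentation does not destroy independence: modulo null sets, the augmented
  sigma-algebra contains no more events than the natural one.
\<close>

lemma augmented_approx:
  assumes "A \<in> sets (F s)" "s \<le> T"
  shows "\<exists>A'\<in>sets (natural_filtration P B s). sym_diff A A' \<in> null_sets M"
  using assms(1) unfolding sets_augmented
proof (induction rule: sigma_sets.induct)
  case (Basic a)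
  then show ?case by (auto intro: bexI[of _ "{}"] bexI[of _ a])
next
  case Empty
  then show ?case by (auto intro: bexI[of _ "{}"])
next
  case (Compl a)
  from Compl.IH obtain A' where A': "A' \<in> sets (natural_filtration P B s)" "sym_diff a A' \<in> null_sets M" by (elim bexE) (rule that)
  have "a \<subseteq> space P" by (rule sigma_sets_into_sp[OF augmented_gen Compl.hyps])
  moreover have "A' \<subseteq> space P" using sets.sets_into_space[OF A'(1)] by (simp only: space_natural)
  ultimately have eq: "sym_diff (space P - a) (space P - A') = sym_diff a A'" by auto
  have "space P - A' \<in> sets (natural_filtration P B s)"
    using sets.compl_sets[OF A'(1)] by (simp only: space_natural)
  then show ?case by (rule bexI[rotated]) (use A'(2) in \<open>simp only: eq\<close>)
next
  case (Union a)
  from Union.IH have "\<forall>i. \<exists>A'. A' \<in> sets (natural_filtration P B s) \<and> sym_diff (a i) A' \<in> null_sets M"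
    unfolding Bex_def by (rule allI)
  from choice[OF this] obtain A' where
    *: "\<forall>i. A' i \<in> sets (natural_filtration P B s) \<and> sym_diff (a i) (A' i) \<in> null_sets M" ..
  have A': "\<And>i. A' i \<in> sets (natural_filtration P B s)" "\<And>i. sym_diff (a i) (A' i) \<in> null_sets M"
    using *[rule_format] by (simp_all only: simp_thms)
  have "(\<Union>i. sym_diff (a i) (A' i)) \<in> null_sets M" using A'(2) by (rule null_sets_UN)
  moreover have "sym_diff (\<Union>i. a i) (\<Union>i. A' i) \<subseteq> (\<Union>i. sym_diff (a i) (A' i))" by auto
  ultimately have "sym_diff (\<Union>i. a i) (\<Union>i. A' i) \<in> null_sets M"
    by (rule null_sets_completion_subset[rotated])
  then show ?case by (rule bexI) (rule sets.countable_UN, use A'(1) in blast)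
qed

lemma increment_indep_augmented:
  assumes "0 \<le> s" "s < t" "t \<le> T"
  shows "indep_set (sets (F s)) (sets (vimage_algebra (space P) (\<lambda>\<omega>. B t \<omega> - B s \<omega>) borel))"
proof (rule indep_setI)
  let ?V = "sets (vimage_algebra (space P) (\<lambda>\<omega>. B t \<omega> - B s \<omega>) borel)"
  have ind: "P.indep_set (sets (natural_filtration P B s)) ?V"
    using bm assms by (auto simp: brownian_motion_def)
  have VP: "?V \<subseteq> sets P" using ind by (rule P.indep_setD_ev2)
  then show "?V \<subseteq> events" by auto
  show "sets (F s) \<subseteq> events" using augmented_subset[of s] assms by auto
  fix a b assume a: "a \<in> sets (F s)" and b: "b \<in> ?V"
  obtain a' where a': "a' \<in> sets (natural_filtration P B s)" "sym_diff a a' \<in> null_sets M"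
    using augmented_approx[OF a] assms by auto
  have a'P: "a' \<in> sets P" using a'(1) natural_subset[of s] assms by auto
  have aM: "a \<in> events" using a augmented_subset[of s] assms by auto
  have ae: "AE \<omega> in M. \<omega> \<in> a \<longleftrightarrow> \<omega> \<in> a'"
    using AE_not_in[OF a'(2)] by eventually_elim auto
  have a'M: "a' \<in> events" and bM: "b \<in> events" using a'P VP b by auto
  have ae': "AE \<omega> in M. \<omega> \<in> a \<inter> b \<longleftrightarrow> \<omega> \<in> a' \<inter> b"
    using ae by eventually_elim blast
  have "prob a = prob a'"
    by (rule finite_measure_eq_AE[OF ae aM a'M])
  moreover have "prob (a \<inter> b) = prob (a' \<inter> b)"
    by (rule finite_measure_eq_AE[OF ae' sets.Int[OF aM bM] sets.Int[OF a'M bM]])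
  moreover have bP: "b \<in> sets P" using VP b by (rule subsetD)
  have "prob (a' \<inter> b) = prob a' * prob b"
    unfolding measure_completion[OF sets.Int[OF a'P bP]] measure_completion[OF a'P] measure_completion[OF bP]
    by (rule P.indep_setD[OF ind a'(1) b])
  ultimately show "prob (a \<inter> b) = prob a * prob b" by (simp only:)
qed

lemma
  fixes w :: "'w \<Rightarrow> real" and \<phi> :: "real^'d \<Rightarrow> real"
  assumes st: "0 \<le> s" "s < t" "t \<le> T"
    and w: "w \<in> borel_measurable (F s)" "integrable M w"
    and \<phi>: "\<phi> \<in> borel_measurable borel" "integrable M (\<lambda>\<omega>. \<phi> (B t \<omega> - B s \<omega>))"
  shows integrable_mult_increment: "integrable M (\<lambda>\<omega>. w \<omega> * \<phi> (B t \<omega> - B s \<omega>))"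
    and expectation_mult_increment:
      "expectation (\<lambda>\<omega>. w \<omega> * \<phi> (B t \<omega> - B s \<omega>)) = expectation w * expectation (\<lambda>\<omega>. \<phi> (B t \<omega> - B s \<omega>))"
proof -
  let ?D = "\<lambda>\<omega>. B t \<omega> - B s \<omega>"
  have iv: "indep_var borel w borel (\<lambda>\<omega>. \<phi> (?D \<omega>))"
    unfolding indep_var_eq
  proof (intro conjI)
    show "w \<in> borel_measurable M" "(\<lambda>\<omega>. \<phi> (?D \<omega>)) \<in> borel_measurable M"
      using w(2) \<phi>(2) by auto
    show "indep_set (sigma_sets (space M) {w -` A \<inter> space M |A. A \<in> sets borel})
     (sigma_sets (space M) {(\<lambda>\<omega>. \<phi> (?D \<omega>)) -` A \<inter> space M |A. A \<in> sets borel})"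
      unfolding indep_set_def
    proof (rule indep_sets_mono_sets[OF increment_indep_augmented[OF st, unfolded indep_set_def]], goal_cases)
      case (1 i)
      have A1: "sigma_sets (space M) {w -` A \<inter> space M |A. A \<in> sets borel} \<subseteq> sets (F s)"
        using sets.sigma_sets_subset[of "{w -` A \<inter> space M |A. A \<in> sets borel}" "F s"] measurable_sets[OF w(1)]
        by auto
      have A2: "sigma_sets (space M) {(\<lambda>\<omega>. \<phi> (?D \<omega>)) -` A \<inter> space M |A. A \<in> sets borel}
          \<subseteq> sets (vimage_algebra (space P) ?D borel)"
      proof -
        have in_V: "(\<lambda>\<omega>. \<phi> (?D \<omega>)) -` A \<inter> space P \<in> sets (vimage_algebra (space P) ?D borel)"
          if "A \<in> sets borel" for A
        proof -
          have eq: "(\<lambda>\<omega>. \<phi> (?D \<omega>)) -` A \<inter> space P = ?D -` (\<phi> -` A) \<inter> space P"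
            by (simp only: vimage_comp[symmetric] comp_def vimage_def) simp
          have "\<phi> -` A \<in> sets borel" using measurable_sets[OF \<phi>(1) that] by simp
          from in_vimage_algebra[OF this] show ?thesis unfolding eq .
        qed
        have "{(\<lambda>\<omega>. \<phi> (?D \<omega>)) -` A \<inter> space M |A. A \<in> sets borel}
            \<subseteq> sets (vimage_algebra (space P) ?D borel)"
          unfolding space_completion by (clarify, rule in_V)
        from sets.sigma_sets_subset[OF this] show ?thesis
          unfolding space_completion space_vimage_algebra .
      qed
      show ?case by (cases i) (simp_all only: bool.case A1 A2)
    qed
  qed
  show "integrable M (\<lambda>\<omega>. w \<omega> * \<phi> (?D \<omega>))"
    by (rule indep_var_integrable[OF iv w(2) \<phi>(2)])
  show "expectation (\<lambda>\<omega>. w \<omega> * \<phi> (?D \<omega>)) = expectation w * expectation (\<lambda>\<omega>. \<phi> (?D \<omega>))"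
    by (rule indep_var_lebesgue_integral[OF iv w(2) \<phi>(2)])
qed

end

section \<open>Elementary stochastic integrals\<close>

context brownian
begin

lemma increment_measurable:
  assumes "0 \<le> r" "r \<le> t" "t \<le> s"
  shows "(\<lambda>\<omega>. (B t \<omega> - B r \<omega>) $ j) \<in> borel_measurable (F s)"
proof -
  have "(\<lambda>\<omega>. B t \<omega> - B r \<omega>) \<in> borel_measurable (F s)"
    using B_measurable_augmented[of t s] B_measurable_augmented[of r s] assms by simp
  then show ?thesis
    by (rule measurable_compose) (intro borel_measurable_continuous_onI continuous_intros)
qed

lemma
  fixes w :: "'w \<Rightarrow> real"
  assumes rt: "0 \<le> r" "r \<le> t" "t \<le> T" and w: "w \<in> borel_measurable (F r)" "integrable M w"
  shows integrable_times_increment: "integrable M (\<lambda>\<omega>. w \<omega> * (B t \<omega> - B r \<omega>) $ k)"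
    and expectation_times_increment: "expectation (\<lambda>\<omega>. w \<omega> * (B t \<omega> - B r \<omega>) $ k) = 0"
    and integrable_times_increment2:
      "integrable M (\<lambda>\<omega>. w \<omega> * ((B t \<omega> - B r \<omega>) $ j * (B t \<omega> - B r \<omega>) $ k))"
    and expectation_times_increment2:
      "expectation (\<lambda>\<omega>. w \<omega> * ((B t \<omega> - B r \<omega>) $ j * (B t \<omega> - B r \<omega>) $ k))
        = expectation w * (if j = k then t - r else 0)"
proof -
  have c1: "(\<lambda>x::real^'d. x $ k) \<in> borel_measurable borel"
    and c2: "(\<lambda>x::real^'d. x $ j * x $ k) \<in> borel_measurable borel"
    by (intro borel_measurable_continuous_onI continuous_intros)+
  note i1 = increment_integrable[OF rt, of k] and i2 = increment_prod_integrable[OF rt, of j k]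
  have "integrable M (\<lambda>\<omega>. w \<omega> * (B t \<omega> - B r \<omega>) $ k) \<and> expectation (\<lambda>\<omega>. w \<omega> * (B t \<omega> - B r \<omega>) $ k) = 0 \<and>
   integrable M (\<lambda>\<omega>. w \<omega> * ((B t \<omega> - B r \<omega>) $ j * (B t \<omega> - B r \<omega>) $ k)) \<and>
   expectation (\<lambda>\<omega>. w \<omega> * ((B t \<omega> - B r \<omega>) $ j * (B t \<omega> - B r \<omega>) $ k))
        = expectation w * (if j = k then t - r else 0)"
  proof (cases "r = t")
    case False
    then have "r < t" using rt by simp
    show ?thesis
      using integrable_mult_increment[OF rt(1) \<open>r < t\<close> rt(3) w c1 i1]
        expectation_mult_increment[OF rt(1) \<open>r < t\<close> rt(3) w c1 i1]
        integrable_mult_increment[OF rt(1) \<open>r < t\<close> rt(3) w c2 i2]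
        expectation_mult_increment[OF rt(1) \<open>r < t\<close> rt(3) w c2 i2]
        increment_mean[OF rt, of k] increment_cov[OF rt, of j k]
      by simp
  qed simp
  then show "integrable M (\<lambda>\<omega>. w \<omega> * (B t \<omega> - B r \<omega>) $ k)"
    "expectation (\<lambda>\<omega>. w \<omega> * (B t \<omega> - B r \<omega>) $ k) = 0"
    "integrable M (\<lambda>\<omega>. w \<omega> * ((B t \<omega> - B r \<omega>) $ j * (B t \<omega> - B r \<omega>) $ k))"
    "expectation (\<lambda>\<omega>. w \<omega> * ((B t \<omega> - B r \<omega>) $ j * (B t \<omega> - B r \<omega>) $ k))
        = expectation w * (if j = k then t - r else 0)"
    by blast+
qed

lemma integrable_mult_bounded:
  fixes z w :: "'w \<Rightarrow> real"
  assumes "integrable M w" "z \<in> borel_measurable M" "bounded (z ` space P)"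
  shows "integrable M (\<lambda>\<omega>. z \<omega> * w \<omega>)"
proof -
  obtain C where C: "\<And>\<omega>. \<omega> \<in> space P \<Longrightarrow> \<bar>z \<omega>\<bar> \<le> C"
    using assms(3) by (auto simp: bounded_iff)
  show ?thesis
  proof (rule Bochner_Integration.integrable_bound)
    show "integrable M (\<lambda>\<omega>. C * w \<omega>)" using assms(1) by simp
    show "(\<lambda>\<omega>. z \<omega> * w \<omega>) \<in> borel_measurable M" using assms by simp
    show "AE \<omega> in M. norm (z \<omega> * w \<omega>) \<le> norm (C * w \<omega>)"
    proof (rule AE_I2)
      fix \<omega> assume "\<omega> \<in> space M"
      then have "\<bar>z \<omega>\<bar> \<le> C" using C by simp
      then have "\<bar>z \<omega>\<bar> * \<bar>w \<omega>\<bar> \<le> \<bar>C\<bar> * \<bar>w \<omega>\<bar>" by (intro mult_right_mono) auto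
      then show "norm (z \<omega> * w \<omega>) \<le> norm (C * w \<omega>)" by (simp add: abs_mult)
    qed
  qed
qed

lemma integrable_bounded_M:
  fixes z :: "'w \<Rightarrow> 'x::{banach, second_countable_topology}"
  assumes "z \<in> borel_measurable M" "bounded (z ` space P)"
  shows "integrable M z"
proof -
  obtain C where C: "\<And>\<omega>. \<omega> \<in> space P \<Longrightarrow> norm (z \<omega>) \<le> C"
    using assms(2) by (auto simp: bounded_iff)
  show ?thesis
    by (rule integrable_const_bound[of _ C]) (use C assms(1) in auto)
qed

lemma bounded_mult_image:
  fixes z w :: "'w \<Rightarrow> real"
  assumes "bounded (z ` S)" "bounded (w ` S)"
  shows "bounded ((\<lambda>\<omega>. z \<omega> * w \<omega>) ` S)"
proof -
  obtain a b where "\<And>\<omega>. \<omega> \<in> S \<Longrightarrow> \<bar>z \<omega>\<bar> \<le> a" "\<And>\<omega>. \<omega> \<in> S \<Longrightarrow> \<bar>w \<omega>\<bar> \<le> b"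
    using assms by (auto simp: bounded_iff)
  then have "\<bar>z \<omega> * w \<omega>\<bar> \<le> a * b" if "\<omega> \<in> S" for \<omega>
    unfolding abs_mult using that by (intro mult_mono) (auto intro: order_trans[OF abs_ge_zero])
  then show ?thesis by (auto simp: bounded_iff)
qed

text \<open>
  The covariance of two weighted increments over arbitrary time intervals, each weight being
  known at the left end of its interval. Cutting both intervals at the ends of their overlap leaves
  only products in which one increment lies after everything else and hence averages out, apart from the product
  of the two increments over the overlap itself.
\<close>

lemma product_increments_ordered:
  fixes z z' :: "'w \<Rightarrow> real"
  assumes rt: "0 \<le> r" "r \<le> t" "t \<le> T" and rt': "r \<le> r'" "r' \<le> t'" "t' \<le> T"
    and z: "z \<in> borel_measurable (F r)" "bounded (z ` space P)"
    and z': "z' \<in> borel_measurable (F r')" "bounded (z' ` space P)"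
  shows "integrable M (\<lambda>\<omega>. (z \<omega> * (B t \<omega> - B r \<omega>) $ j) * (z' \<omega> * (B t' \<omega> - B r' \<omega>) $ k)) \<and>
    expectation (\<lambda>\<omega>. (z \<omega> * (B t \<omega> - B r \<omega>) $ j) * (z' \<omega> * (B t' \<omega> - B r' \<omega>) $ k))
      = (if j = k then max 0 (min t t' - max r r') else 0) * expectation (\<lambda>\<omega>. z \<omega> * z' \<omega>)"
proof -
  have r': "0 \<le> r'" "r' \<le> T" "r \<le> T" "0 \<le> t'" using rt rt' by auto
  note zM = measurable_augmented_M[OF z(1) r'(3)] and z'M = measurable_augmented_M[OF z'(1) r'(2)]
  define y where "y = (\<lambda>\<omega>. z \<omega> * z' \<omega>)"
  have y: "y \<in> borel_measurable (F r')" "bounded (y ` space P)"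
    using measurable_augmented_mono[OF z(1) rt'(1)] z' bounded_mult_image[OF z(2) z'(2)] by (auto simp: y_def)
  note yM = measurable_augmented_M[OF y(1) r'(2)]
  define D where "D = (\<lambda>r t j \<omega>. (B t \<omega> - B r \<omega>) $ j)"
  have D_split: "D r t j \<omega> = D r s j \<omega> + D s t j \<omega>" for r s t j \<omega>
    by (simp add: D_def)
  \<comment> \<open>an increment before c, times y, is known at time c\<close>
  have orth: "integrable M (\<lambda>\<omega>. (y \<omega> * D p q i \<omega>) * D c e l \<omega>) \<and> expectation (\<lambda>\<omega>. (y \<omega> * D p q i \<omega>) * D c e l \<omega>) = 0"
    if h: "0 \<le> p" "p \<le> q" "q \<le> c" "r' \<le> c" "c \<le> e" "e \<le> T" for p q c e i l
  proof -
    have h': "q \<le> T" "0 \<le> c" "p \<le> T" using h r' by auto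
    have m: "(\<lambda>\<omega>. y \<omega> * D p q i \<omega>) \<in> borel_measurable (F c)"
      using measurable_augmented_mono[OF y(1) h(4)] increment_measurable[OF h(1-3), of i]
      by (simp add: D_def)
    have ii: "integrable M (\<lambda>\<omega>. y \<omega> * D p q i \<omega>)"
      unfolding D_def by (rule integrable_mult_bounded[OF increment_integrable[OF h(1,2) h'(1)] yM y(2)])
    show ?thesis
      using integrable_times_increment[OF h'(2) h(5,6) m ii, of l] expectation_times_increment[OF h'(2) h(5,6) m ii, of l]
      by (simp add: D_def)
  qed
  have "integrable M (\<lambda>\<omega>. y \<omega> * (D r t j \<omega> * D r' t' k \<omega>)) \<and>
    expectation (\<lambda>\<omega>. y \<omega> * (D r t j \<omega> * D r' t' k \<omega>))
      = (if j = k then max 0 (min t t' - max r r') else 0) * expectation y"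
  proof (cases "t \<le> r'")
    case True
    then show ?thesis using orth[of r t r' t' j k] rt rt' r' by (simp add: mult.assoc)
  next
    case False
    define c where "c = min t t'"
    have c: "r' \<le> c" "c \<le> t" "c \<le> t'" "c \<le> T" "c = t \<or> c = t'" using False rt rt' by (auto simp: c_def min_def)
    \<comment> \<open>one of the two intervals ends at c\<close>
    have zero: "D c t j \<omega> * D c t' k \<omega> = 0" for \<omega> using c(5) by (auto simp: D_def)
    have expand: "y \<omega> * (D r t j \<omega> * D r' t' k \<omega>) =
       y \<omega> * D r r' j \<omega> * D r' t' k \<omega> + y \<omega> * (D r' c j \<omega> * D r' c k \<omega>)
       + y \<omega> * D r' c j \<omega> * D c t' k \<omega> + y \<omega> * D r' c k \<omega> * D c t j \<omega>" for \<omega>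
    proof -
      have e: "D r t j \<omega> = D r r' j \<omega> + (D r' c j \<omega> + D c t j \<omega>)" "D r' t' k \<omega> = D r' c k \<omega> + D c t' k \<omega>"
        by (simp_all add: D_def)
      show ?thesis unfolding e(1) using zero[of \<omega>] unfolding e(2) by algebra
    qed
    have o1: "integrable M (\<lambda>\<omega>. y \<omega> * D r r' j \<omega> * D r' t' k \<omega>)" "expectation (\<lambda>\<omega>. y \<omega> * D r r' j \<omega> * D r' t' k \<omega>) = 0"
      using orth[of r r' r' t' j k] rt rt' by auto
    have o2: "integrable M (\<lambda>\<omega>. y \<omega> * D r' c j \<omega> * D c t' k \<omega>)" "expectation (\<lambda>\<omega>. y \<omega> * D r' c j \<omega> * D c t' k \<omega>) = 0"
      using orth[of r' c c t' j k] r' rt' c by auto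
    have o3: "integrable M (\<lambda>\<omega>. y \<omega> * D r' c k \<omega> * D c t j \<omega>)" "expectation (\<lambda>\<omega>. y \<omega> * D r' c k \<omega> * D c t j \<omega>) = 0"
      using orth[of r' c c t k j] r' rt c by auto
    have yI: "integrable M y" by (rule integrable_bounded_M[OF yM y(2)])
    have o4: "integrable M (\<lambda>\<omega>. y \<omega> * (D r' c j \<omega> * D r' c k \<omega>))"
      "expectation (\<lambda>\<omega>. y \<omega> * (D r' c j \<omega> * D r' c k \<omega>)) = expectation y * (if j = k then c - r' else 0)"
      unfolding D_def
      by (rule integrable_times_increment2[OF r'(1) c(1,4) y(1) yI] expectation_times_increment2[OF r'(1) c(1,4) y(1) yI])+
    have "max 0 (min t t' - max r r') = c - r'" using c rt' by (auto simp: c_def)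
    then show ?thesis unfolding expand
      using o1 o2 o3 o4 by (simp add: mult.commute)
  qed
  moreover have "(z \<omega> * (B t \<omega> - B r \<omega>) $ j) * (z' \<omega> * (B t' \<omega> - B r' \<omega>) $ k) = y \<omega> * (D r t j \<omega> * D r' t' k \<omega>)" for \<omega>
    by (simp add: y_def D_def)
  ultimately show ?thesis by (simp only: y_def)
qed

lemma
  fixes z z' :: "'w \<Rightarrow> real"
  assumes rt: "0 \<le> r" "r \<le> t" "t \<le> T" and rt': "0 \<le> r'" "r' \<le> t'" "t' \<le> T"
    and z: "z \<in> borel_measurable (F r)" "bounded (z ` space P)"
    and z': "z' \<in> borel_measurable (F r')" "bounded (z' ` space P)"
  shows integrable_product_increments:
      "integrable M (\<lambda>\<omega>. (z \<omega> * (B t \<omega> - B r \<omega>) $ j) * (z' \<omega> * (B t' \<omega> - B r' \<omega>) $ k))"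
    and expectation_product_increments:
      "expectation (\<lambda>\<omega>. (z \<omega> * (B t \<omega> - B r \<omega>) $ j) * (z' \<omega> * (B t' \<omega> - B r' \<omega>) $ k))
        = (if j = k then max 0 (min t t' - max r r') else 0) * expectation (\<lambda>\<omega>. z \<omega> * z' \<omega>)"
proof -
  have "integrable M (\<lambda>\<omega>. (z \<omega> * (B t \<omega> - B r \<omega>) $ j) * (z' \<omega> * (B t' \<omega> - B r' \<omega>) $ k)) \<and>
    expectation (\<lambda>\<omega>. (z \<omega> * (B t \<omega> - B r \<omega>) $ j) * (z' \<omega> * (B t' \<omega> - B r' \<omega>) $ k))
        = (if j = k then max 0 (min t t' - max r r') else 0) * expectation (\<lambda>\<omega>. z \<omega> * z' \<omega>)"
  proof (cases "r \<le> r'")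
    case True
    then show ?thesis by (rule product_increments_ordered[OF rt _ rt'(2,3) z z'])
  next
    case False
    then have "r' \<le> r" by simp
    have c: "(z \<omega> * (B t \<omega> - B r \<omega>) $ j) * (z' \<omega> * (B t' \<omega> - B r' \<omega>) $ k)
      = (z' \<omega> * (B t' \<omega> - B r' \<omega>) $ k) * (z \<omega> * (B t \<omega> - B r \<omega>) $ j)"
      "z \<omega> * z' \<omega> = z' \<omega> * z \<omega>" for \<omega>
      by (rule mult.commute)+
    show ?thesis unfolding c min.commute[of t t'] max.commute[of r r'] eq_commute[of j k]
      by (rule product_increments_ordered[OF rt' \<open>r' \<le> r\<close> rt(2,3) z' z])
  qed
  then show "integrable M (\<lambda>\<omega>. (z \<omega> * (B t \<omega> - B r \<omega>) $ j) * (z' \<omega> * (B t' \<omega> - B r' \<omega>) $ k))"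
    "expectation (\<lambda>\<omega>. (z \<omega> * (B t \<omega> - B r \<omega>) $ j) * (z' \<omega> * (B t' \<omega> - B r' \<omega>) $ k))
        = (if j = k then max 0 (min t t' - max r r') else 0) * expectation (\<lambda>\<omega>. z \<omega> * z' \<omega>)"
    by (rule conjunct1, rule conjunct2)
qed

text \<open>
  Finite sums of weighted increments, with an arbitrary finite index set and intervals that may
  overlap. In this generality the difference of two such integrals is again of the same kind,
  even when they are built on different partitions, so the isometry for differences needs no
  common refinement.
\<close>

definition elementary :: "'i set \<Rightarrow> ('i \<Rightarrow> real) \<Rightarrow> ('i \<Rightarrow> real) \<Rightarrow> ('i \<Rightarrow> 'w \<Rightarrow> real^'d^'m) \<Rightarrow> bool"
  where "elementary N r t \<zeta> \<longleftrightarrow> finite N \<and> (\<forall>i\<in>N. 0 \<le> r i \<and> r i \<le> t i \<and> t i \<le> T \<and>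
    \<zeta> i \<in> borel_measurable (F (r i)) \<and> bounded (\<zeta> i ` space P))"

definition elem_integral :: "'i set \<Rightarrow> ('i \<Rightarrow> real) \<Rightarrow> ('i \<Rightarrow> real) \<Rightarrow> ('i \<Rightarrow> 'w \<Rightarrow> real^'d^'m) \<Rightarrow> 'w \<Rightarrow> real^'m"
  where "elem_integral N r t \<zeta> \<omega> = (\<Sum>i\<in>N. \<zeta> i \<omega> *v (B (t i) \<omega> - B (r i) \<omega>))"

definition elem_value :: "'i set \<Rightarrow> ('i \<Rightarrow> real) \<Rightarrow> ('i \<Rightarrow> real) \<Rightarrow> ('i \<Rightarrow> 'w \<Rightarrow> real^'d^'m) \<Rightarrow> real \<Rightarrow> 'w \<Rightarrow> real^'d^'m"
  where "elem_value N r t \<zeta> v \<omega> = (\<Sum>i\<in>N. indicat_real {r i<..t i} v *\<^sub>R \<zeta> i \<omega>)"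

lemma entry_measurable:
  fixes \<zeta> :: "'w \<Rightarrow> real^'d^'m"
  assumes "\<zeta> \<in> borel_measurable N"
  shows "(\<lambda>\<omega>. \<zeta> \<omega> $ i $ j) \<in> borel_measurable N"
  by (rule measurable_compose[OF assms]) (intro borel_measurable_continuous_onI continuous_intros)

lemma entry_bounded:
  fixes \<zeta> :: "'w \<Rightarrow> real^'d^'m"
  assumes "bounded (\<zeta> ` S)"
  shows "bounded ((\<lambda>\<omega>. \<zeta> \<omega> $ i $ j) ` S)"
proof -
  obtain C where C: "\<And>\<omega>. \<omega> \<in> S \<Longrightarrow> norm (\<zeta> \<omega>) \<le> C" using assms by (auto simp: bounded_iff)
  have "\<bar>\<zeta> \<omega> $ i $ j\<bar> \<le> C" if "\<omega> \<in> S" for \<omega>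
    using C[OF that] Finite_Cartesian_Product.norm_nth_le[of "\<zeta> \<omega>" i]
      Finite_Cartesian_Product.norm_nth_le[of "\<zeta> \<omega> $ i" j] by simp
  then show ?thesis by (auto simp: bounded_iff)
qed

lemma inner_mult_increments:
  fixes X Y :: "real^'d^'m" and x y :: "real^'d"
  shows "(X *v x) \<bullet> (Y *v y) = (\<Sum>i\<in>UNIV. \<Sum>j\<in>UNIV. \<Sum>k\<in>UNIV. (X $ i $ j * x $ j) * (Y $ i $ k * y $ k))"
  by (simp add: inner_vec_def matrix_vector_mult_def sum_product)

lemma
  assumes E: "elementary N r t \<zeta>"
  shows elem_integral_measurable: "elem_integral N r t \<zeta> \<in> borel_measurable M"
    and elem_integral_integrable: "integrable M (\<lambda>\<omega>. elem_integral N r t \<zeta> \<omega> $ i)"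
    and elem_integral_mean: "expectation (\<lambda>\<omega>. elem_integral N r t \<zeta> \<omega> $ i) = 0"
    and elem_integral_sq_integrable: "integrable M (\<lambda>\<omega>. (norm (elem_integral N r t \<zeta> \<omega>))\<^sup>2)"
    and elem_integral_sq: "expectation (\<lambda>\<omega>. (norm (elem_integral N r t \<zeta> \<omega>))\<^sup>2) =
      expectation (\<lambda>\<omega>. \<Sum>i\<in>N. \<Sum>j\<in>N. max 0 (min (t i) (t j) - max (r i) (r j)) * (\<zeta> i \<omega> \<bullet> \<zeta> j \<omega>))"
    and elem_sq_integrable: "integrable M (\<lambda>\<omega>. \<Sum>i\<in>N. \<Sum>j\<in>N. max 0 (min (t i) (t j) - max (r i) (r j)) * (\<zeta> i \<omega> \<bullet> \<zeta> j \<omega>))"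
proof -
  have fin: "finite N"
    and h: "\<And>i. i \<in> N \<Longrightarrow> 0 \<le> r i" "\<And>i. i \<in> N \<Longrightarrow> r i \<le> t i" "\<And>i. i \<in> N \<Longrightarrow> t i \<le> T"
      "\<And>i. i \<in> N \<Longrightarrow> \<zeta> i \<in> borel_measurable (F (r i))" "\<And>i. i \<in> N \<Longrightarrow> bounded (\<zeta> i ` space P)"
    using E by (auto simp: elementary_def)
  have rT: "r i \<le> T" "0 \<le> t i" if "i \<in> N" for i using h(1-3)[OF that] by auto
  note em = entry_measurable[OF h(4)] and eb = entry_bounded[OF h(5)]
  have eM: "(\<lambda>\<omega>. \<zeta> n \<omega> $ i $ j) \<in> borel_measurable M" if "n \<in> N" for n i j
    by (rule measurable_augmented_M[OF em[OF that] rT(1)[OF that]])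
  have comp: "elem_integral N r t \<zeta> \<omega> $ i = (\<Sum>n\<in>N. \<Sum>j\<in>UNIV. \<zeta> n \<omega> $ i $ j * (B (t n) \<omega> - B (r n) \<omega>) $ j)" for i \<omega>
    by (simp add: elem_integral_def matrix_vector_mult_def)
  have int1: "integrable M (\<lambda>\<omega>. \<zeta> n \<omega> $ i $ j * (B (t n) \<omega> - B (r n) \<omega>) $ j)"
    and ex1: "expectation (\<lambda>\<omega>. \<zeta> n \<omega> $ i $ j * (B (t n) \<omega> - B (r n) \<omega>) $ j) = 0" if "n \<in> N" for n i j
    by (rule integrable_times_increment[OF h(1-3)[OF that] em[OF that] integrable_bounded_M[OF eM[OF that] eb[OF that]]]
      expectation_times_increment[OF h(1-3)[OF that] em[OF that] integrable_bounded_M[OF eM[OF that] eb[OF that]]])+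
  show ci: "integrable M (\<lambda>\<omega>. elem_integral N r t \<zeta> \<omega> $ i)" for i
    unfolding comp by (intro Bochner_Integration.integrable_sum int1)
  show "expectation (\<lambda>\<omega>. elem_integral N r t \<zeta> \<omega> $ i) = 0"
    unfolding comp
    by (subst Bochner_Integration.integral_sum, intro Bochner_Integration.integrable_sum int1, assumption,
        rule sum.neutral, intro ballI, subst Bochner_Integration.integral_sum, rule int1, assumption, simp only: ex1 sum.neutral_const)
  show "elem_integral N r t \<zeta> \<in> borel_measurable M"
    using borel_measurable_integrable[OF ci]
    by (subst borel_measurable_euclidean_space) (auto simp: Basis_vec_def inner_axis)
  have sq: "(norm (elem_integral N r t \<zeta> \<omega>))\<^sup>2 = (\<Sum>n\<in>N. \<Sum>m\<in>N. \<Sum>i\<in>UNIV. \<Sum>j\<in>UNIV. \<Sum>k\<in>UNIV.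
      (\<zeta> n \<omega> $ i $ j * (B (t n) \<omega> - B (r n) \<omega>) $ j) * (\<zeta> m \<omega> $ i $ k * (B (t m) \<omega> - B (r m) \<omega>) $ k))" for \<omega>
    unfolding power2_norm_eq_inner elem_integral_def inner_sum_left inner_sum_right inner_mult_increments
    by (rule sum.swap)
  note int2 = integrable_product_increments[OF h(1-3) h(1-3) em eb em eb]
  note ex2 = expectation_product_increments[OF h(1-3) h(1-3) em eb em eb]
  show "integrable M (\<lambda>\<omega>. (norm (elem_integral N r t \<zeta> \<omega>))\<^sup>2)"
    unfolding sq by (intro Bochner_Integration.integrable_sum int2)
  have int3: "integrable M (\<lambda>\<omega>. \<zeta> n \<omega> $ i $ j * \<zeta> m \<omega> $ i $ k)" if "n \<in> N" "m \<in> N" for n m i j k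
    by (intro integrable_mult_bounded integrable_bounded_M eM eb that)
  have inn: "\<zeta> n \<omega> \<bullet> \<zeta> m \<omega> = (\<Sum>i\<in>UNIV. \<Sum>j\<in>UNIV. \<zeta> n \<omega> $ i $ j * \<zeta> m \<omega> $ i $ j)" for n m \<omega>
    by (simp add: inner_vec_def)
  show "integrable M (\<lambda>\<omega>. \<Sum>i\<in>N. \<Sum>j\<in>N. max 0 (min (t i) (t j) - max (r i) (r j)) * (\<zeta> i \<omega> \<bullet> \<zeta> j \<omega>))"
    unfolding inn by (intro Bochner_Integration.integrable_sum Bochner_Integration.integrable_mult_right int3)
  let ?o = "\<lambda>n m. max 0 (min (t n) (t m) - max (r n) (r m))"
  have "expectation (\<lambda>\<omega>. (norm (elem_integral N r t \<zeta> \<omega>))\<^sup>2) =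
      (\<Sum>n\<in>N. \<Sum>m\<in>N. \<Sum>i\<in>UNIV. \<Sum>j\<in>UNIV. \<Sum>k\<in>UNIV. (if j = k then ?o n m else 0) * expectation (\<lambda>\<omega>. \<zeta> n \<omega> $ i $ j * \<zeta> m \<omega> $ i $ k))"
    unfolding sq
    by (subst Bochner_Integration.integral_sum, (intro Bochner_Integration.integrable_sum int2; assumption), rule sum.cong[OF refl])+
       (rule ex2)
  also have "\<dots> = (\<Sum>n\<in>N. \<Sum>m\<in>N. ?o n m * (\<Sum>i\<in>UNIV. \<Sum>j\<in>UNIV. expectation (\<lambda>\<omega>. \<zeta> n \<omega> $ i $ j * \<zeta> m \<omega> $ i $ j)))"
    unfolding sum_distrib_left
    by (intro sum.cong refl) (simp add: if_distrib[where f="\<lambda>x. x * _"] sum.delta' cong: if_cong)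
  also have "\<dots> = (\<Sum>n\<in>N. \<Sum>m\<in>N. expectation (\<lambda>\<omega>. ?o n m * (\<zeta> n \<omega> \<bullet> \<zeta> m \<omega>)))"
    unfolding inn
    by (intro sum.cong refl) (simp add: Bochner_Integration.integral_sum Bochner_Integration.integrable_sum int3)
  also have "\<dots> = expectation (\<lambda>\<omega>. \<Sum>i\<in>N. \<Sum>j\<in>N. ?o i j * (\<zeta> i \<omega> \<bullet> \<zeta> j \<omega>))"
    unfolding inn
    by (rule sym, (subst Bochner_Integration.integral_sum, (intro Bochner_Integration.integrable_sum
        Bochner_Integration.integrable_mult_right int3; assumption), rule sum.cong[OF refl])+) (rule refl)
  finally show "expectation (\<lambda>\<omega>. (norm (elem_integral N r t \<zeta> \<omega>))\<^sup>2) =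
      expectation (\<lambda>\<omega>. \<Sum>i\<in>N. \<Sum>j\<in>N. ?o i j * (\<zeta> i \<omega> \<bullet> \<zeta> j \<omega>))" .
qed

lemma finite_measure_interval: "finite_measure (restrict_space lborel {a..s::real})"
  by (rule finite_measureI) (simp add: emeasure_restrict_space space_restrict_space emeasure_lborel_Icc_eq)

lemma integral_indicator_interval:
  assumes "a \<le> r" "t \<le> s"
  shows "integral\<^sup>L (restrict_space lborel {a..s}) (\<lambda>v. indicat_real {r<..t} v) = max 0 (t - r)"
proof -
  have "integral\<^sup>L (restrict_space lborel {a..s}) (\<lambda>v. indicat_real {r<..t} v)
      = integral\<^sup>L lborel (\<lambda>v. indicat_real {a..s} v *\<^sub>R indicat_real {r<..t} v)"
    by (subst integral_restrict_space) (auto simp: set_lebesgue_integral_def)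
  also have "(\<lambda>v. indicat_real {a..s} v *\<^sub>R indicat_real {r<..t} v) = indicat_real {r<..t}"
    using assms by (auto simp: indicator_def fun_eq_iff)
  finally show ?thesis by (simp add: max_def)
qed

text \<open>
  The pathwise energy of the integrand is the same double sum over overlaps that
  \<open>elem_integral_sq\<close> gives for the second moment of the integral; together they form the
  isometry for elementary integrands.
\<close>

lemma elem_value_sq_integral:
  assumes "finite N" and "\<And>i. i \<in> N \<Longrightarrow> a \<le> r i \<and> t i \<le> s"
  shows "integral\<^sup>L (restrict_space lborel {a..s}) (\<lambda>v. (norm (elem_value N r t \<zeta> v \<omega>))\<^sup>2)
    = (\<Sum>i\<in>N. \<Sum>j\<in>N. max 0 (min (t i) (t j) - max (r i) (r j)) * (\<zeta> i \<omega> \<bullet> \<zeta> j \<omega>))"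
proof -
  let ?I = "\<lambda>i j. indicat_real {max (r i) (r j)<..min (t i) (t j)}"
  have sq: "(norm (elem_value N r t \<zeta> v \<omega>))\<^sup>2 = (\<Sum>i\<in>N. \<Sum>j\<in>N. ?I i j v * (\<zeta> i \<omega> \<bullet> \<zeta> j \<omega>))" for v
    unfolding power2_norm_eq_inner elem_value_def inner_sum_left inner_sum_right
    by (subst sum.swap, intro sum.cong refl) (auto simp: indicator_def)
  note fm = finite_measure_interval[of a s]
  have int: "integrable (restrict_space lborel {a..s}) (?I i j)" for i j
    by (rule finite_measure.integrable_const_bound[OF fm, of _ 1]) (auto intro!: measurable_restrict_space1)
  have I: "integral\<^sup>L (restrict_space lborel {a..s}) (?I i j) = max 0 (min (t i) (t j) - max (r i) (r j))"
    if "i \<in> N" "j \<in> N" for i j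
    by (rule integral_indicator_interval) (use assms(2)[OF that(1)] in auto)
  show ?thesis
    unfolding sq using int I by (simp add: Bochner_Integration.integral_sum Bochner_Integration.integrable_sum)
qed

end

section \<open>Limits in probability and in mean square\<close>

lemma abs_norm_sq_diff_le:
  fixes x y :: "'a::real_normed_vector"
  assumes "0 < \<theta>"
  shows "\<bar>(norm x)\<^sup>2 - (norm y)\<^sup>2\<bar> \<le> (1 + 1 / \<theta>) * (norm (x - y))\<^sup>2 + \<theta> * (norm y)\<^sup>2"
proof -
  define d where "d = norm (x - y)"
  define c where "c = norm y"
  have d: "0 \<le> d" "\<bar>norm x - norm y\<bar> \<le> d" unfolding d_def by (auto intro: norm_triangle_ineq3)
  have "(norm x)\<^sup>2 - (norm y)\<^sup>2 = (norm x - norm y) * (norm x + norm y)" by (simp add: power2_eq_square algebra_simps)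
  then have "\<bar>(norm x)\<^sup>2 - (norm y)\<^sup>2\<bar> = \<bar>norm x - norm y\<bar> * (norm x + norm y)" by (simp add: abs_mult)
  also have "\<dots> \<le> d * (d + 2 * c)" using d unfolding c_def by (intro mult_mono) auto
  also have "\<dots> \<le> (1 + 1 / \<theta>) * d\<^sup>2 + \<theta> * c\<^sup>2"
  proof -
    have "0 \<le> (d - \<theta> * c)\<^sup>2 / \<theta>" using assms by simp
    also have "\<dots> = d\<^sup>2 / \<theta> - 2 * d * c + \<theta> * c\<^sup>2" using assms by (simp add: field_simps power2_eq_square)
    finally show ?thesis by (simp add: algebra_simps power2_eq_square)
  qed
  finally show ?thesis by (simp add: d_def c_def)
qed

text \<open>
  Combined with \<open>abs_norm_sq_diff_le\<close>: if the mean square distance d tends to 0, then the second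
  moments q converge.
\<close>

lemma perturbation_limit:
  fixes q d :: "nat \<Rightarrow> real"
  assumes d: "d \<longlonglongrightarrow> 0" and c: "0 \<le> c"
    and q: "\<And>\<theta> m. 0 < \<theta> \<Longrightarrow> \<bar>q m - q0\<bar> \<le> (1 + 1 / \<theta>) * d m + \<theta> * c"
  shows "q \<longlonglongrightarrow> q0"
proof (rule LIMSEQ_I)
  fix e :: real assume e: "0 < e"
  define \<theta> where "\<theta> = e / (2 * (c + 1))"
  have \<theta>: "0 < \<theta>" using e c by (simp add: \<theta>_def)
  have \<theta>c: "\<theta> * c < e / 2" using e c by (simp add: \<theta>_def field_simps)
  have "(\<lambda>m. (1 + 1 / \<theta>) * d m + \<theta> * c) \<longlonglongrightarrow> (1 + 1 / \<theta>) * 0 + \<theta> * c"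
    by (intro tendsto_intros d)
  then have "eventually (\<lambda>m. (1 + 1 / \<theta>) * d m + \<theta> * c < e) sequentially"
    by (rule order_tendstoD) (use \<theta>c e in simp)
  then obtain N where "\<And>m. m \<ge> N \<Longrightarrow> (1 + 1 / \<theta>) * d m + \<theta> * c < e"
    by (auto simp: eventually_sequentially)
  then show "\<exists>no. \<forall>n\<ge>no. norm (q n - q0) < e"
    using q[OF \<theta>] by (intro exI[of _ N]) (auto intro: le_less_trans)
qed

lemma norm_diff_sq_le:
  fixes x y z :: "'a::real_normed_vector"
  shows "(norm (x - y))\<^sup>2 \<le> 2 * (norm (x - z))\<^sup>2 + 2 * (norm (y - z))\<^sup>2"
proof -
  have "norm (x - y) \<le> norm (x - z) + norm (y - z)"
    using norm_triangle_ineq4[of "x - z" "y - z"] by simp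
  then have "(norm (x - y))\<^sup>2 \<le> (norm (x - z) + norm (y - z))\<^sup>2" by (intro power_mono) auto
  also have "\<dots> \<le> 2 * (norm (x - z))\<^sup>2 + 2 * (norm (y - z))\<^sup>2"
    using sum_squares_bound[of "norm (x - z)" "norm (y - z)"] by (simp add: power2_sum)
  finally show ?thesis .
qed

context prob_space
begin

lemma convergence_in_prob_AE_subseq:
  fixes J :: "nat \<Rightarrow> 'a \<Rightarrow> 'b::euclidean_space"
  assumes J: "\<And>m. J m \<in> borel_measurable M" "I \<in> borel_measurable M"
    and lim: "\<And>\<epsilon>. 0 < \<epsilon> \<Longrightarrow> (\<lambda>m. prob {\<omega> \<in> space M. \<epsilon> < norm (J m \<omega> - I \<omega>)}) \<longlonglongrightarrow> 0"
  shows "\<exists>\<rho>. strict_mono (\<rho> :: nat \<Rightarrow> nat) \<and> (AE \<omega> in M. (\<lambda>l. J (\<rho> l) \<omega>) \<longlonglongrightarrow> I \<omega>)"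
proof -
  \<comment> \<open>truncation makes convergence in probability equivalent to convergence in mean\<close>
  define U where "U = (\<lambda>m \<omega>. min 1 (norm (J m \<omega> - I \<omega>)))"
  have Um: "U m \<in> borel_measurable M" for m using J unfolding U_def by measurable
  have Ui: "integrable M (U m)" for m
    by (rule integrable_const_bound[of _ 1, OF _ Um]) (auto simp: U_def)
  have "(\<lambda>m. expectation (U m)) \<longlonglongrightarrow> 0"
  proof (rule LIMSEQ_I)
    fix e :: real assume e: "0 < e"
    let ?A = "\<lambda>m. {\<omega> \<in> space M. e / 2 < norm (J m \<omega> - I \<omega>)}"
    have A: "?A m \<in> events" for m using J by measurable
    have le: "expectation (U m) \<le> e / 2 + prob (?A m)" for m
    proof -
      have "expectation (U m) \<le> expectation (\<lambda>\<omega>. e / 2 + indicator (?A m) \<omega>)"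
      proof (rule integral_mono[OF Ui])
        show "integrable M (\<lambda>\<omega>. e / 2 + indicat_real (?A m) \<omega>)"
          using A[of m] by (intro Bochner_Integration.integrable_add integrable_const) (simp add: integrable_real_indicator emeasure_eq_measure)
        show "U m \<omega> \<le> e / 2 + indicator (?A m) \<omega>" if "\<omega> \<in> space M" for \<omega>
          using that e by (auto simp: U_def indicator_def)
      qed
      also have "\<dots> = e / 2 + prob (?A m)"
        using A[of m] by (subst Bochner_Integration.integral_add) (simp_all add: prob_space integrable_real_indicator emeasure_eq_measure)
      finally show ?thesis .
    qed
    have "0 < e / 2" using e by simp
    from LIMSEQ_D[OF lim[OF this] this]
    obtain N where N: "\<And>m. m \<ge> N \<Longrightarrow> prob (?A m) < e / 2" by auto
    have "norm (expectation (U m) - 0) < e" if "m \<ge> N" for m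
    proof -
      have "0 \<le> expectation (U m)" by (intro Bochner_Integration.integral_nonneg) (simp add: U_def)
      then show ?thesis using le[of m] N[OF that] by simp
    qed
    then show "\<exists>no. \<forall>n\<ge>no. norm (expectation (U n) - 0) < e" by blast
  qed
  moreover have "norm (U m \<omega>) = U m \<omega>" for m \<omega> by (simp add: U_def)
  ultimately have "(\<lambda>m. expectation (\<lambda>\<omega>. norm (U m \<omega>))) \<longlonglongrightarrow> 0" by simp
  from tendsto_L1_AE_subseq[OF Ui this]
  obtain \<rho> where \<rho>: "strict_mono \<rho>" "AE \<omega> in M. (\<lambda>l. U (\<rho> l) \<omega>) \<longlonglongrightarrow> 0" by blast
  have "AE \<omega> in M. (\<lambda>l. J (\<rho> l) \<omega>) \<longlonglongrightarrow> I \<omega>"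
    using \<rho>(2)
  proof eventually_elim
    case (elim \<omega>)
    have "eventually (\<lambda>l. U (\<rho> l) \<omega> < 1) sequentially" by (rule order_tendstoD(2)[OF elim]) simp
    then have "eventually (\<lambda>l. U (\<rho> l) \<omega> = norm (J (\<rho> l) \<omega> - I \<omega>)) sequentially"
      by eventually_elim (auto simp: U_def)
    from Lim_transform_eventually[OF elim this]
    have "(\<lambda>l. norm (J (\<rho> l) \<omega> - I \<omega>)) \<longlonglongrightarrow> 0" .
    then show ?case by (simp add: tendsto_norm_zero_iff LIM_zero_iff)
  qed
  with \<rho>(1) show ?thesis by blast
qed

lemma
  fixes J :: "nat \<Rightarrow> 'a \<Rightarrow> 'b::euclidean_space"
  assumes J: "\<And>m. J m \<in> borel_measurable M" "I \<in> borel_measurable M"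
    and lim: "\<And>\<epsilon>. 0 < \<epsilon> \<Longrightarrow> (\<lambda>m. prob {\<omega> \<in> space M. \<epsilon> < norm (J m \<omega> - I \<omega>)}) \<longlonglongrightarrow> 0"
    and e: "e \<longlonglongrightarrow> 0" "\<And>m. 0 \<le> e m"
    and cauchy: "\<And>m l. integrable M (\<lambda>\<omega>. (norm (J m \<omega> - J l \<omega>))\<^sup>2) \<and>
      expectation (\<lambda>\<omega>. (norm (J m \<omega> - J l \<omega>))\<^sup>2) \<le> e m + e l"
  shows L2_limit_integrable: "integrable M (\<lambda>\<omega>. (norm (J m \<omega> - I \<omega>))\<^sup>2)"
    and L2_limit_bound: "expectation (\<lambda>\<omega>. (norm (J m \<omega> - I \<omega>))\<^sup>2) \<le> e m"
proof -
  obtain \<rho> :: "nat \<Rightarrow> nat" where \<rho>: "strict_mono \<rho>" "AE \<omega> in M. (\<lambda>l. J (\<rho> l) \<omega>) \<longlonglongrightarrow> I \<omega>"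
    using convergence_in_prob_AE_subseq[OF J lim] by blast
  have m1: "(\<lambda>\<omega>. (norm (J m \<omega> - I \<omega>))\<^sup>2) \<in> borel_measurable M" using J by measurable
  have m2: "(\<lambda>\<omega>. ennreal ((norm (J m \<omega> - J (\<rho> l) \<omega>))\<^sup>2)) \<in> borel_measurable M" for l using J by measurable
  have "(\<integral>\<^sup>+\<omega>. ennreal ((norm (J m \<omega> - I \<omega>))\<^sup>2) \<partial>M)
      = (\<integral>\<^sup>+\<omega>. liminf (\<lambda>l. ennreal ((norm (J m \<omega> - J (\<rho> l) \<omega>))\<^sup>2)) \<partial>M)"
  proof (rule nn_integral_cong_AE, use \<rho>(2) in eventually_elim)
    case (elim \<omega>)
    have "(\<lambda>l. ennreal ((norm (J m \<omega> - J (\<rho> l) \<omega>))\<^sup>2)) \<longlonglongrightarrow> ennreal ((norm (J m \<omega> - I \<omega>))\<^sup>2)"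
      by (intro tendsto_ennrealI tendsto_intros elim)
    from lim_imp_Liminf[OF _ this] show ?case by simp
  qed
  also have "\<dots> \<le> liminf (\<lambda>l. \<integral>\<^sup>+\<omega>. ennreal ((norm (J m \<omega> - J (\<rho> l) \<omega>))\<^sup>2) \<partial>M)"
    by (rule nn_integral_liminf[OF m2])
  also have "\<dots> \<le> liminf (\<lambda>l. ennreal (e m + e (\<rho> l)))"
  proof (rule Liminf_mono, rule always_eventually, rule allI)
    fix l
    have "(\<integral>\<^sup>+\<omega>. ennreal ((norm (J m \<omega> - J (\<rho> l) \<omega>))\<^sup>2) \<partial>M)
       = ennreal (expectation (\<lambda>\<omega>. (norm (J m \<omega> - J (\<rho> l) \<omega>))\<^sup>2))"
      using cauchy[of m "\<rho> l"] by (intro nn_integral_eq_integral) auto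
    also have "\<dots> \<le> ennreal (e m + e (\<rho> l))" using cauchy[of m "\<rho> l"] by (intro ennreal_leI) auto
    finally show "(\<integral>\<^sup>+\<omega>. ennreal ((norm (J m \<omega> - J (\<rho> l) \<omega>))\<^sup>2) \<partial>M) \<le> ennreal (e m + e (\<rho> l))" .
  qed
  also have "\<dots> = ennreal (e m)"
  proof -
    have "(\<lambda>l. e (\<rho> l)) \<longlonglongrightarrow> 0" using LIMSEQ_subseq_LIMSEQ[OF e(1) \<rho>(1)] by (simp add: comp_def)
    then have "(\<lambda>l. ennreal (e m + e (\<rho> l))) \<longlonglongrightarrow> ennreal (e m + 0)"
      by (intro tendsto_ennrealI tendsto_intros)
    from lim_imp_Liminf[OF _ this] show ?thesis by simp
  qed
  finally have le: "(\<integral>\<^sup>+\<omega>. ennreal ((norm (J m \<omega> - I \<omega>))\<^sup>2) \<partial>M) \<le> ennreal (e m)" .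
  show i: "integrable M (\<lambda>\<omega>. (norm (J m \<omega> - I \<omega>))\<^sup>2)"
    by (rule integrableI_bounded[OF m1]) (use le in \<open>auto intro: le_less_trans\<close>)
  show "expectation (\<lambda>\<omega>. (norm (J m \<omega> - I \<omega>))\<^sup>2) \<le> e m"
    using le by (subst (asm) nn_integral_eq_integral[OF i]) (auto simp: e(2))
qed

end

context brownian
begin

text \<open>
  The simple process on the time interval up to s, switched off once the energy accumulated by
  the current step exceeds R. That sum is known when the step begins, because step j is weighted by a variable
  known at its left end; so the stopped process is again simple, and its energy never exceeds R.
\<close>

definition stopped :: "(nat \<Rightarrow> real) \<Rightarrow> (nat \<Rightarrow> 'w \<Rightarrow> real^'d^'m) \<Rightarrow> real \<Rightarrow> real \<Rightarrow> nat \<Rightarrow> 'w \<Rightarrow> real^'d^'m"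
  where "stopped \<tau> \<xi> s R i \<omega> =
    (if \<tau> i < s \<and> (\<Sum>j\<le>i. (min (\<tau> (Suc j)) s - min (\<tau> j) s) * (norm (\<xi> j \<omega>))\<^sup>2) \<le> R then \<xi> i \<omega> else 0)"

lemma
  assumes sp: "simple_process F a b k \<tau> \<xi>" and ab: "0 \<le> a" "b \<le> T" and s: "a \<le> s" "s \<le> b"
  shows simple_mono: "i \<le> j \<Longrightarrow> j \<le> k \<Longrightarrow> \<tau> i \<le> \<tau> j"
    and simple_clip: "i \<le> k \<Longrightarrow> a \<le> min (\<tau> i) s \<and> min (\<tau> i) s \<le> s"
    and stopped_elementary: "elementary {..<k} (\<lambda>i. min (\<tau> i) s) (\<lambda>i. min (\<tau> (Suc i)) s) (stopped \<tau> \<xi> s R)"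
proof -
  have \<tau>: "\<tau> 0 = a" "\<tau> k = b" "\<And>i. i < k \<Longrightarrow> \<tau> i \<le> \<tau> (Suc i)"
    and \<xi>: "\<And>i. i < k \<Longrightarrow> \<xi> i \<in> borel_measurable (F (\<tau> i))" "\<And>i. i < k \<Longrightarrow> bounded (\<xi> i ` space P)"
    using sp by (auto simp: simple_process_def)
  show mono: "\<tau> i \<le> \<tau> j" if "i \<le> j" "j \<le> k" for i j
    using that
  proof (induction j rule: dec_induct)
    case (step n)
    then show ?case using \<tau>(3)[of n] by simp
  qed simp
  have ran: "a \<le> \<tau> i" "\<tau> i \<le> b" if "i \<le> k" for i
    using mono[of 0 i] mono[of i k] that \<tau> by auto
  show "i \<le> k \<Longrightarrow> a \<le> min (\<tau> i) s \<and> min (\<tau> i) s \<le> s" for i using ran[of i] s by auto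
  have meas: "stopped \<tau> \<xi> s R i \<in> borel_measurable (F (min (\<tau> i) s))" if i: "i < k" for i
  proof (cases "\<tau> i < s")
    case True
    have x: "\<xi> j \<in> borel_measurable (F (\<tau> i))" if "j \<le> i" for j
      using measurable_augmented_mono[OF \<xi>(1)[of j] mono[of j i]] that i by simp
    have y: "(\<lambda>\<omega>. \<Sum>j\<le>i. (min (\<tau> (Suc j)) s - min (\<tau> j) s) * (norm (\<xi> j \<omega>))\<^sup>2) \<in> borel_measurable (F (\<tau> i))"
    proof (rule borel_measurable_sum)
      fix j assume "j \<in> {..i}"
      then have [measurable]: "\<xi> j \<in> borel_measurable (F (\<tau> i))" using x by simp
      show "(\<lambda>\<omega>. (min (\<tau> (Suc j)) s - min (\<tau> j) s) * (norm (\<xi> j \<omega>))\<^sup>2) \<in> borel_measurable (F (\<tau> i))"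
        by measurable
    qed
    have [measurable]: "\<xi> i \<in> borel_measurable (F (\<tau> i))" using x by simp
    note y[measurable]
    have "min (\<tau> i) s = \<tau> i" using True by simp
    moreover have "(\<lambda>\<omega>. if (\<Sum>j\<le>i. (min (\<tau> (Suc j)) s - min (\<tau> j) s) * (norm (\<xi> j \<omega>))\<^sup>2) \<le> R then \<xi> i \<omega> else 0)
      \<in> borel_measurable (F (\<tau> i))" by measurable
    ultimately show ?thesis using True unfolding stopped_def[abs_def] by simp
  next
    case False
    then show ?thesis unfolding stopped_def[abs_def] by simp
  qed
  have bdd: "bounded (stopped \<tau> \<xi> s R i ` space P)" if i: "i < k" for i
  proof -
    obtain C where C: "\<And>\<omega>. \<omega> \<in> space P \<Longrightarrow> norm (\<xi> i \<omega>) \<le> C" using \<xi>(2)[OF i] by (auto simp: bounded_iff)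
    then have "norm (stopped \<tau> \<xi> s R i \<omega>) \<le> \<bar>C\<bar>" if "\<omega> \<in> space P" for \<omega>
      using C[OF that] by (auto simp: stopped_def)
    then show ?thesis by (auto simp: bounded_iff)
  qed
  show "elementary {..<k} (\<lambda>i. min (\<tau> i) s) (\<lambda>i. min (\<tau> (Suc i)) s) (stopped \<tau> \<xi> s R)"
    unfolding elementary_def
  proof (intro conjI ballI)
    fix i assume "i \<in> {..<k}"
    then have i: "i < k" by simp
    show "0 \<le> min (\<tau> i) s" using ran[of i] i ab s by auto
    show "min (\<tau> i) s \<le> min (\<tau> (Suc i)) s" using \<tau>(3)[OF i] by auto
    show "min (\<tau> (Suc i)) s \<le> T" using s ab by auto
    show "stopped \<tau> \<xi> s R i \<in> borel_measurable (F (min (\<tau> i) s))" by (rule meas[OF i])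
    show "bounded (stopped \<tau> \<xi> s R i ` space P)" by (rule bdd[OF i])
  qed simp
qed

lemma disjoint_overlap_sum:
  fixes c :: "nat \<Rightarrow> nat \<Rightarrow> real"
  assumes "\<And>i j. i \<le> j \<Longrightarrow> j \<le> k \<Longrightarrow> \<sigma> i \<le> (\<sigma> j :: real)"
  shows "(\<Sum>i<k. \<Sum>j<k. max 0 (min (\<sigma> (Suc i)) (\<sigma> (Suc j)) - max (\<sigma> i) (\<sigma> j)) * c i j)
    = (\<Sum>i<k. (\<sigma> (Suc i) - \<sigma> i) * c i i)"
proof (rule sum.cong[OF refl])
  fix i assume i: "i \<in> {..<k}"
  have "max 0 (min (\<sigma> (Suc i)) (\<sigma> (Suc j)) - max (\<sigma> i) (\<sigma> j)) * c i j = (if j = i then (\<sigma> (Suc i) - \<sigma> i) * c i i else 0)"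
    if j: "j < k" for j
    using assms[of "Suc i" j] assms[of "Suc j" i] assms[of i "Suc i"] i j
    by (cases i j rule: linorder_cases) auto
  then have "(\<Sum>j<k. max 0 (min (\<sigma> (Suc i)) (\<sigma> (Suc j)) - max (\<sigma> i) (\<sigma> j)) * c i j)
      = (\<Sum>j<k. if j = i then (\<sigma> (Suc i) - \<sigma> i) * c i i else 0)"
    by (intro sum.cong) auto
  also have "\<dots> = (\<sigma> (Suc i) - \<sigma> i) * c i i" using i by simp
  finally show "(\<Sum>j<k. max 0 (min (\<sigma> (Suc i)) (\<sigma> (Suc j)) - max (\<sigma> i) (\<sigma> j)) * c i j) = (\<sigma> (Suc i) - \<sigma> i) * c i i" .
qed

lemma stopped_energy_le:
  fixes \<xi> :: "nat \<Rightarrow> 'w \<Rightarrow> real^'d^'m"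
  assumes "\<And>i. i < k \<Longrightarrow> \<tau> i \<le> \<tau> (Suc i)" and "0 \<le> R"
  shows "(\<Sum>i<k. (min (\<tau> (Suc i)) s - min (\<tau> i) s) * (norm (stopped \<tau> \<xi> s R i \<omega>))\<^sup>2) \<le> R"
  using assms(1)
proof (induction k)
  case 0
  then show ?case using assms(2) by simp
next
  case (Suc k)
  let ?d = "\<lambda>i. min (\<tau> (Suc i)) s - min (\<tau> i) s"
  have d: "0 \<le> ?d i" if "i \<le> k" for i using Suc.prems[of i] that by auto
  show ?case
  proof (cases "\<tau> k < s \<and> (\<Sum>j\<le>k. ?d j * (norm (\<xi> j \<omega>))\<^sup>2) \<le> R")
    case True
    have "(\<Sum>i<Suc k. ?d i * (norm (stopped \<tau> \<xi> s R i \<omega>))\<^sup>2) \<le> (\<Sum>i<Suc k. ?d i * (norm (\<xi> i \<omega>))\<^sup>2)"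
      using d by (intro sum_mono mult_left_mono) (auto simp: stopped_def)
    also have "\<dots> \<le> R" using True by (simp add: lessThan_Suc_atMost)
    finally show ?thesis .
  next
    case False
    then have "stopped \<tau> \<xi> s R k \<omega> = 0" by (auto simp: stopped_def)
    then show ?thesis using Suc.IH Suc.prems by simp
  qed
qed

lemma
  fixes \<xi> :: "nat \<Rightarrow> 'w \<Rightarrow> real^'d^'m"
  assumes \<tau>: "\<And>i. i < k \<Longrightarrow> \<tau> i \<le> \<tau> (Suc i)"
    and total: "(\<Sum>i<k. (min (\<tau> (Suc i)) s - min (\<tau> i) s) * (norm (\<xi> i \<omega>))\<^sup>2) \<le> R"
  shows stopped_value_eq: "v \<le> s \<Longrightarrow> elem_value {..<k} (\<lambda>i. min (\<tau> i) s) (\<lambda>i. min (\<tau> (Suc i)) s) (stopped \<tau> \<xi> s R) v \<omega>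
      = simple_value k \<tau> \<xi> v \<omega>"
    and stopped_integral_eq: "elem_integral {..<k} (\<lambda>i. min (\<tau> i) s) (\<lambda>i. min (\<tau> (Suc i)) s) (stopped \<tau> \<xi> s R) \<omega>
      = simple_integral B k \<tau> \<xi> s \<omega>"
proof -
  let ?d = "\<lambda>i. min (\<tau> (Suc i)) s - min (\<tau> i) s"
  have eq: "stopped \<tau> \<xi> s R i \<omega> = \<xi> i \<omega>" if i: "i < k" "\<tau> i < s" for i
  proof -
    have "(\<Sum>j\<le>i. ?d j * (norm (\<xi> j \<omega>))\<^sup>2) \<le> (\<Sum>j<k. ?d j * (norm (\<xi> j \<omega>))\<^sup>2)"
      using i(1) \<tau> by (intro sum_mono2) (auto simp: min.coboundedI1 intro!: mult_nonneg_nonneg)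
    then show ?thesis using total i by (simp add: stopped_def)
  qed
  show "elem_value {..<k} (\<lambda>i. min (\<tau> i) s) (\<lambda>i. min (\<tau> (Suc i)) s) (stopped \<tau> \<xi> s R) v \<omega>
      = simple_value k \<tau> \<xi> v \<omega>" if "v \<le> s"
    unfolding elem_value_def simple_value_def
  proof (rule sum.cong[OF refl])
    fix i assume "i \<in> {..<k}"
    then show "indicat_real {min (\<tau> i) s<..min (\<tau> (Suc i)) s} v *\<^sub>R stopped \<tau> \<xi> s R i \<omega> = indicat_real {\<tau> i<..\<tau> (Suc i)} v *\<^sub>R \<xi> i \<omega>"
      using eq[of i] that by (cases "\<tau> i < s") (auto simp: indicator_def)
  qed
  show "elem_integral {..<k} (\<lambda>i. min (\<tau> i) s) (\<lambda>i. min (\<tau> (Suc i)) s) (stopped \<tau> \<xi> s R) \<omega>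
      = simple_integral B k \<tau> \<xi> s \<omega>"
    unfolding elem_integral_def simple_integral_def
  proof (rule sum.cong[OF refl])
    fix i assume i: "i \<in> {..<k}"
    show "stopped \<tau> \<xi> s R i \<omega> *v (B (min (\<tau> (Suc i)) s) \<omega> - B (min (\<tau> i) s) \<omega>) =
         \<xi> i \<omega> *v (B (min (\<tau> (Suc i)) s) \<omega> - B (min (\<tau> i) s) \<omega>)"
    proof (cases "\<tau> i < s")
      case True
      then show ?thesis using eq[of i] i by simp
    next
      case False
      then have "min (\<tau> (Suc i)) s = s" "min (\<tau> i) s = s" using \<tau>[of i] i by auto
      then show ?thesis by (simp add: matrix_vector_mult_0_right)
    qed
  qed
qed

end

section \<open>The Ito isometry for bounded integrands\<close>

context brownian
begin

text \<open>
  The integrals J of the stopped approximations form a Cauchy sequence in mean square: by the elementary isometry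
  the distance of two of them is that of their integrands, and each integrand approaches H. As J
  also tends to \<open>I s\<close> in probability, it does so in mean square, and both the mean and the second moment pass
  to the limit. The time s stays below b because progressive measurability of the integrand is known only up to times
  before b.
\<close>

lemma
  fixes H :: "real \<Rightarrow> 'w \<Rightarrow> real^'d^'m"
  assumes ito: "ito_integral P B a b H I" and ab: "0 \<le> a" "b \<le> T" and s: "a \<le> s" "s < b"
    and K: "\<And>r \<omega>. a \<le> r \<Longrightarrow> r < b \<Longrightarrow> \<omega> \<in> space P \<Longrightarrow> norm (H r \<omega>) \<le> K"
  shows ito_sq_integrable: "integrable M (\<lambda>\<omega>. (norm (I s \<omega>))\<^sup>2)"
    and ito_integrable: "integrable M (\<lambda>\<omega>. I s \<omega> $ i)"
    and ito_mean: "expectation (\<lambda>\<omega>. I s \<omega> $ i) = 0"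
    and ito_energy_integrable: "integrable M (\<lambda>\<omega>. integral\<^sup>L (restrict_space lborel {a..s}) (\<lambda>v. (norm (H v \<omega>))\<^sup>2))"
    and ito_isometry: "expectation (\<lambda>\<omega>. (norm (I s \<omega>))\<^sup>2)
      = expectation (\<lambda>\<omega>. integral\<^sup>L (restrict_space lborel {a..s}) (\<lambda>v. (norm (H v \<omega>))\<^sup>2))"
    and ito_section_measurable: "\<omega> \<in> space P \<Longrightarrow> (\<lambda>v. H v \<omega>) \<in> borel_measurable (restrict_space lborel {a..s})"
proof -
  define L where "L = restrict_space lborel {a..s}"
  have spL: "space L = {a..s}" by (simp add: L_def space_restrict_space)
  have finL: "finite_measure L" unfolding L_def by (rule finite_measure_interval)
  interpret L: finite_measure L by (rule finL)
  have mL: "measure L (space L) = s - a"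
    using s by (simp add: L_def measure_restrict_space space_restrict_space)
  obtain \<omega>0 where \<omega>0: "\<omega>0 \<in> space P" using P.not_empty by blast
  have K0: "0 \<le> K" using K[of a \<omega>0] s \<omega>0 by (auto intro: order_trans[OF norm_ge_zero])
  have sT: "s \<le> T" using s ab by simp
  have prog: "(\<lambda>(r, \<omega>). H r \<omega>) \<in> borel_measurable (restrict_space borel {a..s} \<Otimes>\<^sub>M F s)"
    using ito s by (auto simp: ito_integral_def progressive_on_def)
  have Hm: "(\<lambda>x. H (snd x) (fst x)) \<in> borel_measurable (M \<Otimes>\<^sub>M L)"
  proof -
    have c1: "snd \<in> measurable (M \<Otimes>\<^sub>M L) (restrict_space borel {a..s})"
    proof -
      have "sets L = sets (restrict_space borel {a..s})" unfolding L_def by (rule sets_restrict_space_cong) simp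
      then have "measurable (M \<Otimes>\<^sub>M L) (restrict_space borel {a..s}) = measurable (M \<Otimes>\<^sub>M L) L"
        by (intro measurable_cong_sets) auto
      then show ?thesis by simp
    qed
    have "(\<lambda>x. x) \<in> measurable M (F s)"
      by (rule measurableI) (use augmented_subset[OF sT] sets.sets_into_space[of _ "F s"] in \<open>auto simp: Int_absorb2\<close>)
    then have c2: "fst \<in> measurable (M \<Otimes>\<^sub>M L) (F s)"
      by (rule measurable_compose[OF measurable_fst])
    have "(\<lambda>x. (snd x, fst x)) \<in> measurable (M \<Otimes>\<^sub>M L) (restrict_space borel {a..s} \<Otimes>\<^sub>M F s)"
      by (rule measurable_Pair[OF c1 c2])
    from measurable_compose[OF this prog] show ?thesis by simp
  qed
  have Hv: "(\<lambda>v. H v \<omega>) \<in> borel_measurable L" if "\<omega> \<in> space P" for \<omega>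
    using measurable_compose[OF measurable_Pair1'[of \<omega> M L] Hm] that by simp
  then show "\<omega> \<in> space P \<Longrightarrow> (\<lambda>v. H v \<omega>) \<in> borel_measurable (restrict_space lborel {a..s})" for \<omega>
    unfolding L_def .
  have HK: "norm (H v \<omega>) \<le> K" if "v \<in> {a..s}" "\<omega> \<in> space P" for v \<omega>
    using K[of v \<omega>] that s by auto

  from ito obtain k \<tau> \<xi> where
    sp: "\<And>m. simple_process F a b (k m) (\<tau> m) (\<xi> m)" and
    V0: "tendsto_zero_in_prob M (\<lambda>m \<omega>.
        \<integral>\<^sup>+s\<in>{a..b}. ennreal ((norm (simple_value (k m) (\<tau> m) (\<xi> m) s \<omega> - H s \<omega>))\<^sup>2) \<partial>lborel)" and
    W0: "tendsto_zero_in_prob M (\<lambda>m \<omega>.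
        SUP s\<in>{a..b}. ennreal (norm (simple_integral B (k m) (\<tau> m) (\<xi> m) s \<omega> - I s \<omega>)))"
    unfolding ito_integral_def by blast
  define V where "V = (\<lambda>m \<omega>. \<integral>\<^sup>+s\<in>{a..b}. ennreal ((norm (simple_value (k m) (\<tau> m) (\<xi> m) s \<omega> - H s \<omega>))\<^sup>2) \<partial>lborel)"
  define W where "W = (\<lambda>m \<omega>. SUP s\<in>{a..b}. ennreal (norm (simple_integral B (k m) (\<tau> m) (\<xi> m) s \<omega> - I s \<omega>)))"
  have Vm: "V m \<in> borel_measurable M" and Vlim: "0 < \<epsilon> \<Longrightarrow> (\<lambda>m. prob {\<omega> \<in> space M. V m \<omega> > ennreal \<epsilon>}) \<longlonglongrightarrow> 0" for m \<epsilon>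
    using V0 unfolding V_def tendsto_zero_in_prob_def by auto
  have Wm: "W m \<in> borel_measurable M" and Wlim: "0 < \<epsilon> \<Longrightarrow> (\<lambda>m. prob {\<omega> \<in> space M. W m \<omega> > ennreal \<epsilon>}) \<longlonglongrightarrow> 0" for m \<epsilon>
    using W0 unfolding W_def tendsto_zero_in_prob_def by auto
  have sb: "s \<le> b" using s by simp
  have \<tau>mono: "i < k m \<Longrightarrow> \<tau> m i \<le> \<tau> m (Suc i)" for m i
    using sp[of m] by (auto simp: simple_process_def)

  \<comment> \<open>twice the largest energy of H, plus room for an approximation error of 1\<close>
  define R where "R = 2 * K\<^sup>2 * (s - a) + 2"
  have R0: "0 \<le> R" using s by (simp add: R_def)
  define r where "r = (\<lambda>m i. min (\<tau> m i) s)"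
  define t where "t = (\<lambda>m i. min (\<tau> m (Suc i)) s)"
  define \<zeta> where "\<zeta> = (\<lambda>m. stopped (\<tau> m) (\<xi> m) s R)"
  have el: "elementary {..<k m} (r m) (t m) (\<zeta> m)" for m
    unfolding r_def t_def \<zeta>_def by (rule stopped_elementary[OF sp ab s(1) sb])
  have clip: "i < k m \<Longrightarrow> a \<le> r m i \<and> t m i \<le> s" for i m
    unfolding r_def t_def using simple_clip[OF sp ab s(1) sb, of i m] by auto
  define J where "J = (\<lambda>m. elem_integral {..<k m} (r m) (t m) (\<zeta> m))"
  define val where "val = (\<lambda>m. elem_value {..<k m} (r m) (t m) (\<zeta> m))"
  define D where "D = (\<lambda>m \<omega>. integral\<^sup>L L (\<lambda>v. (norm (val m v \<omega> - H v \<omega>))\<^sup>2))"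
  define Q where "Q = (\<lambda>m \<omega>. integral\<^sup>L L (\<lambda>v. (norm (val m v \<omega>))\<^sup>2))"
  define QH where "QH = (\<lambda>\<omega>. integral\<^sup>L L (\<lambda>v. (norm (H v \<omega>))\<^sup>2))"
  have \<zeta>M: "\<zeta> m i \<in> borel_measurable M" if "i < k m" for m i
  proof (rule measurable_augmented_M)
    show "\<zeta> m i \<in> borel_measurable (F (r m i))" using el[of m] that by (auto simp: elementary_def)
    show "r m i \<le> T" using sT by (simp add: r_def)
  qed

  \<comment> \<open>all integrands below are bounded and measurable along each path, so their energies are finite\<close>
  define good where "good = (\<lambda>x :: real \<Rightarrow> real^'d^'m. x \<in> borel_measurable L \<and> (\<exists>C. \<forall>v\<in>{a..s}. norm (x v) \<le> C))"
  have good_int: "integrable L (\<lambda>v. (norm (x v))\<^sup>2)" if g: "good x" for x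
  proof -
    obtain C where C: "\<And>v. v \<in> {a..s} \<Longrightarrow> norm (x v) \<le> C" and [measurable]: "x \<in> borel_measurable L"
      using g unfolding good_def by blast
    show ?thesis
      by (rule L.integrable_const_bound[of _ "C\<^sup>2"]) (use C in \<open>auto simp: spL intro!: AE_I2 power_mono\<close>)
  qed
  have good_diff: "good (\<lambda>v. x v - y v)" if g: "good x" "good y" for x y
  proof -
    obtain C C' where C: "\<And>v. v \<in> {a..s} \<Longrightarrow> norm (x v) \<le> C" "\<And>v. v \<in> {a..s} \<Longrightarrow> norm (y v) \<le> C'"
      using g unfolding good_def by blast
    have "norm (x v - y v) \<le> C + C'" if "v \<in> {a..s}" for v
      using norm_triangle_ineq4[of "x v" "y v"] C[OF that] by linarith
    moreover have "(\<lambda>v. x v - y v) \<in> borel_measurable L" using g by (auto simp: good_def)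
    ultimately show ?thesis unfolding good_def by blast
  qed
  have goodH: "good (\<lambda>v. H v \<omega>)" if "\<omega> \<in> space P" for \<omega>
    unfolding good_def using Hv[OF that] HK[OF _ that] by blast
  have ident_L: "(\<lambda>v. v) \<in> borel_measurable L"
    unfolding L_def by (rule measurable_restrict_space1) simp
  have ind_L: "(\<lambda>v. indicat_real {p<..q} v) \<in> borel_measurable L" for p q :: real
    by (rule measurable_compose[OF ident_L]) simp
  have good_sum: "good (\<lambda>v. \<Sum>i<n. indicat_real {p i<..q i} v *\<^sub>R z i)" for n :: nat and p q :: "nat \<Rightarrow> real" and z
  proof -
    have "norm (\<Sum>i<n. indicat_real {p i<..q i} v *\<^sub>R z i) \<le> (\<Sum>i<n. norm (z i))" for v
      by (rule order_trans[OF norm_sum], rule sum_mono) (simp add: indicator_def)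
    then show ?thesis unfolding good_def
      by (intro conjI borel_measurable_sum borel_measurable_scaleR borel_measurable_const ind_L) blast
  qed
  have goodV: "good (\<lambda>v. val m v \<omega>)" for m \<omega>
    unfolding val_def elem_value_def by (rule good_sum)
  have Q_eq: "Q m \<omega> = (\<Sum>i<k m. (t m i - r m i) * (norm (\<zeta> m i \<omega>))\<^sup>2)" for m \<omega>
  proof -
    have "Q m \<omega> = (\<Sum>i<k m. \<Sum>j<k m. max 0 (min (t m i) (t m j) - max (r m i) (r m j)) * (\<zeta> m i \<omega> \<bullet> \<zeta> m j \<omega>))"
      unfolding Q_def val_def L_def by (rule elem_value_sq_integral) (use clip in auto)
    also have "\<dots> = (\<Sum>i<k m. (t m i - r m i) * (\<zeta> m i \<omega> \<bullet> \<zeta> m i \<omega>))"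
      unfolding t_def r_def
      by (rule disjoint_overlap_sum[of "k m" "\<lambda>i. min (\<tau> m i) s"])
         (intro min.mono simple_mono[OF sp ab s(1) sb] order_refl)
    finally show ?thesis by (simp add: power2_norm_eq_inner)
  qed
  have Q_le: "Q m \<omega> \<le> R" for m \<omega>
    unfolding Q_eq unfolding t_def r_def \<zeta>_def by (rule stopped_energy_le, erule \<tau>mono, rule R0)
  have QH0: "0 \<le> QH \<omega>" and QH_le: "\<omega> \<in> space P \<Longrightarrow> QH \<omega> \<le> K\<^sup>2 * (s - a)" for \<omega>
  proof -
    show "0 \<le> QH \<omega>" unfolding QH_def by (intro Bochner_Integration.integral_nonneg) simp
    assume w: "\<omega> \<in> space P"
    have "QH \<omega> \<le> integral\<^sup>L L (\<lambda>v. K\<^sup>2)"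
      unfolding QH_def
    proof (rule integral_mono[OF good_int[OF goodH[OF w]]])
      show "(norm (H v \<omega>))\<^sup>2 \<le> K\<^sup>2" if "v \<in> space L" for v
        using HK[OF _ w, of v] that spL by (auto intro!: power_mono)
    qed simp
    then show "QH \<omega> \<le> K\<^sup>2 * (s - a)" by (simp add: mL mult.commute)
  qed
  have D0: "0 \<le> D m \<omega>" for m \<omega> unfolding D_def by (intro Bochner_Integration.integral_nonneg) simp
  have D_le: "D m \<omega> \<le> 2 * R + 2 * (K\<^sup>2 * (s - a))" if "\<omega> \<in> space P" for m \<omega>
  proof -
    have "D m \<omega> \<le> integral\<^sup>L L (\<lambda>v. 2 * (norm (val m v \<omega>))\<^sup>2 + 2 * (norm (H v \<omega>))\<^sup>2)"
      unfolding D_def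
      by (rule integral_mono[OF good_int[OF good_diff[OF goodV goodH[OF that]]]])
         (use good_int[OF goodV] good_int[OF goodH[OF that]] norm_diff_sq_le[of _ _ 0] in auto)
    also have "\<dots> = 2 * Q m \<omega> + 2 * QH \<omega>"
      unfolding Q_def QH_def using good_int[OF goodV[of m \<omega>]] good_int[OF goodH[OF that]] by simp
    also have "\<dots> \<le> 2 * R + 2 * (K\<^sup>2 * (s - a))" using Q_le[of m \<omega>] QH_le[OF that] by simp
    finally show ?thesis .
  qed
  have diff_le: "integral\<^sup>L L (\<lambda>v. (norm (val m v \<omega> - val l v \<omega>))\<^sup>2) \<le> 2 * D m \<omega> + 2 * D l \<omega>"
    if "\<omega> \<in> space P" for m l \<omega>
  proof -
    have "integral\<^sup>L L (\<lambda>v. (norm (val m v \<omega> - val l v \<omega>))\<^sup>2)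
        \<le> integral\<^sup>L L (\<lambda>v. 2 * (norm (val m v \<omega> - H v \<omega>))\<^sup>2 + 2 * (norm (val l v \<omega> - H v \<omega>))\<^sup>2)"
      by (rule integral_mono[OF good_int[OF good_diff[OF goodV goodV]]])
         (use good_int[OF good_diff[OF goodV goodH[OF that]]] norm_diff_sq_le in auto)
    also have "\<dots> = 2 * D m \<omega> + 2 * D l \<omega>"
      unfolding D_def using good_int[OF good_diff[OF goodV goodH[OF that]]] by simp
    finally show ?thesis .
  qed
  have Q_pert: "\<bar>Q m \<omega> - QH \<omega>\<bar> \<le> (1 + 1 / \<theta>) * D m \<omega> + \<theta> * QH \<omega>" if "\<omega> \<in> space P" "0 < \<theta>" for m \<omega> \<theta>
  proof -
    note i1 = good_int[OF goodV[of m \<omega>]] and i2 = good_int[OF goodH[OF that(1)]]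
      and i3 = good_int[OF good_diff[OF goodV[of m \<omega>] goodH[OF that(1)]]]
    have "\<bar>Q m \<omega> - QH \<omega>\<bar> = \<bar>integral\<^sup>L L (\<lambda>v. (norm (val m v \<omega>))\<^sup>2 - (norm (H v \<omega>))\<^sup>2)\<bar>"
      unfolding Q_def QH_def using i1 i2 by simp
    also have "\<dots> \<le> integral\<^sup>L L (\<lambda>v. \<bar>(norm (val m v \<omega>))\<^sup>2 - (norm (H v \<omega>))\<^sup>2\<bar>)"
      by (rule integral_abs_bound)
    also have "\<dots> \<le> integral\<^sup>L L (\<lambda>v. (1 + 1 / \<theta>) * (norm (val m v \<omega> - H v \<omega>))\<^sup>2 + \<theta> * (norm (H v \<omega>))\<^sup>2)"
      by (rule integral_mono) (use i1 i2 i3 abs_norm_sq_diff_le[OF that(2)] in auto)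
    also have "\<dots> = (1 + 1 / \<theta>) * D m \<omega> + \<theta> * QH \<omega>"
      unfolding D_def QH_def using i2 i3 by simp
    finally show ?thesis .
  qed
  \<comment> \<open>an approximation error of at most 1 keeps the energy of the simple process below R, so stopping changes nothing\<close>
  have close: "D m \<omega> \<le> \<delta> \<and> J m \<omega> = simple_integral B (k m) (\<tau> m) (\<xi> m) s \<omega>"
    if w: "\<omega> \<in> space P" and V: "V m \<omega> \<le> ennreal \<delta>" and \<delta>: "0 \<le> \<delta>" "\<delta> \<le> 1" for m \<omega> \<delta>
  proof -
    let ?sv = "\<lambda>v. simple_value (k m) (\<tau> m) (\<xi> m) v \<omega>"
    have gsv: "good ?sv" unfolding simple_value_def by (rule good_sum)
    note i3 = good_int[OF good_diff[OF gsv goodH[OF w]]]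
    have "ennreal (integral\<^sup>L L (\<lambda>v. (norm (?sv v - H v \<omega>))\<^sup>2)) = (\<integral>\<^sup>+v. ennreal ((norm (?sv v - H v \<omega>))\<^sup>2) \<partial>L)"
      by (rule nn_integral_eq_integral[OF i3, symmetric]) simp
    also have "\<dots> = (\<integral>\<^sup>+v\<in>{a..s}. ennreal ((norm (?sv v - H v \<omega>))\<^sup>2) \<partial>lborel)"
      unfolding L_def by (rule nn_integral_restrict_space) simp
    also have "\<dots> \<le> V m \<omega>"
      unfolding V_def by (rule nn_integral_mono) (use s in \<open>auto simp: indicator_def\<close>)
    also have "\<dots> \<le> ennreal \<delta>" by (rule V)
    finally have le: "integral\<^sup>L L (\<lambda>v. (norm (?sv v - H v \<omega>))\<^sup>2) \<le> \<delta>" using \<delta> by simp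
    have sv_eq: "elem_value {..<k m} (r m) (t m) (\<xi> m) v \<omega> = ?sv v" if "v \<le> s" for v
      unfolding elem_value_def simple_value_def r_def t_def
      by (intro sum.cong refl) (use that in \<open>auto simp: indicator_def\<close>)
    have "(\<Sum>i<k m. (t m i - r m i) * (norm (\<xi> m i \<omega>))\<^sup>2)
       = integral\<^sup>L L (\<lambda>v. (norm (elem_value {..<k m} (r m) (t m) (\<xi> m) v \<omega>))\<^sup>2)"
    proof -
      have "integral\<^sup>L L (\<lambda>v. (norm (elem_value {..<k m} (r m) (t m) (\<xi> m) v \<omega>))\<^sup>2)
        = (\<Sum>i<k m. \<Sum>j<k m. max 0 (min (t m i) (t m j) - max (r m i) (r m j)) * (\<xi> m i \<omega> \<bullet> \<xi> m j \<omega>))"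
        unfolding L_def by (rule elem_value_sq_integral) (use clip in auto)
      also have "\<dots> = (\<Sum>i<k m. (t m i - r m i) * (\<xi> m i \<omega> \<bullet> \<xi> m i \<omega>))"
        unfolding t_def r_def
        by (rule disjoint_overlap_sum[of "k m" "\<lambda>i. min (\<tau> m i) s"])
           (intro min.mono simple_mono[OF sp ab s(1) sb] order_refl)
      finally show ?thesis by (simp add: power2_norm_eq_inner)
    qed
    also have "\<dots> = integral\<^sup>L L (\<lambda>v. (norm (?sv v))\<^sup>2)"
      by (intro Bochner_Integration.integral_cong refl) (simp add: spL sv_eq)
    also have "\<dots> \<le> integral\<^sup>L L (\<lambda>v. 2 * (norm (?sv v - H v \<omega>))\<^sup>2 + 2 * (norm (H v \<omega>))\<^sup>2)"
      by (rule integral_mono[OF good_int[OF gsv]])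
         (use i3 good_int[OF goodH[OF w]] norm_diff_sq_le[of "?sv _" 0 "H _ \<omega>"] in auto)
    also have "\<dots> = 2 * integral\<^sup>L L (\<lambda>v. (norm (?sv v - H v \<omega>))\<^sup>2) + 2 * QH \<omega>"
      unfolding QH_def using i3 good_int[OF goodH[OF w]] by simp
    also have "\<dots> \<le> R" using le \<delta> QH_le[OF w] by (simp add: R_def)
    finally have total: "(\<Sum>i<k m. (min (\<tau> m (Suc i)) s - min (\<tau> m i) s) * (norm (\<xi> m i \<omega>))\<^sup>2) \<le> R"
      by (simp add: r_def t_def)
    have veq: "val m v \<omega> = ?sv v" if "v \<le> s" for v
      unfolding val_def r_def t_def \<zeta>_def by (rule stopped_value_eq, erule \<tau>mono, rule total, rule that)
    have "D m \<omega> = integral\<^sup>L L (\<lambda>v. (norm (?sv v - H v \<omega>))\<^sup>2)"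
      unfolding D_def by (intro Bochner_Integration.integral_cong refl) (simp add: spL veq)
    moreover have "J m \<omega> = simple_integral B (k m) (\<tau> m) (\<xi> m) s \<omega>"
      unfolding J_def r_def t_def \<zeta>_def by (rule stopped_integral_eq, erule \<tau>mono, rule total)
    ultimately show ?thesis using le by simp
  qed
  have valm: "(\<lambda>x. val m (snd x) (fst x)) \<in> borel_measurable (M \<Otimes>\<^sub>M L)" for m
    unfolding val_def elem_value_def
    by (intro borel_measurable_sum borel_measurable_scaleR measurable_compose[OF measurable_snd ind_L]
        measurable_compose[OF measurable_fst \<zeta>M]) simp
  have Dm: "D m \<in> borel_measurable M" for m
  proof -
    have "(\<lambda>x. (norm (val m (snd x) (fst x) - H (snd x) (fst x)))\<^sup>2) \<in> borel_measurable (M \<Otimes>\<^sub>M L)"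
      using valm[of m] Hm by measurable
    then show ?thesis unfolding D_def
      by (intro L.borel_measurable_lebesgue_integral) (simp add: case_prod_beta)
  qed
  have QHm: "QH \<in> borel_measurable M"
  proof -
    have "(\<lambda>x. (norm (H (snd x) (fst x)))\<^sup>2) \<in> borel_measurable (M \<Otimes>\<^sub>M L)"
      using Hm by measurable
    then show ?thesis unfolding QH_def
      by (intro L.borel_measurable_lebesgue_integral) (simp add: case_prod_beta)
  qed
  have Di: "integrable M (D m)" for m
    by (rule integrable_const_bound[of _ "2 * R + 2 * (K\<^sup>2 * (s - a))"]) (use D_le D0 Dm in auto)
  have QHi: "integrable M QH"
    by (rule integrable_const_bound[of _ "K\<^sup>2 * (s - a)"]) (use QH_le QH0 QHm in auto)
  then show "integrable M (\<lambda>\<omega>. integral\<^sup>L (restrict_space lborel {a..s}) (\<lambda>v. (norm (H v \<omega>))\<^sup>2))"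
    unfolding QH_def L_def .
  have Qi: "integrable M (Q m)" and Jsq: "integrable M (\<lambda>\<omega>. (norm (J m \<omega>))\<^sup>2)"
    and J_iso: "expectation (\<lambda>\<omega>. (norm (J m \<omega>))\<^sup>2) = expectation (Q m)" for m
  proof -
    have e: "Q m \<omega> = (\<Sum>i<k m. \<Sum>j<k m. max 0 (min (t m i) (t m j) - max (r m i) (r m j)) * (\<zeta> m i \<omega> \<bullet> \<zeta> m j \<omega>))" for \<omega>
      unfolding Q_def val_def L_def by (rule elem_value_sq_integral) (use clip in auto)
    show "integrable M (Q m)" unfolding e[abs_def] by (rule elem_sq_integrable[OF el])
    show "integrable M (\<lambda>\<omega>. (norm (J m \<omega>))\<^sup>2)" unfolding J_def by (rule elem_integral_sq_integrable[OF el])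
    show "expectation (\<lambda>\<omega>. (norm (J m \<omega>))\<^sup>2) = expectation (Q m)"
      unfolding J_def e[abs_def] by (rule elem_integral_sq[OF el])
  qed
  \<comment> \<open>distance of the stopped approximations to H; it bounds their distance to each other through the isometry\<close>
  define e where "e = (\<lambda>m. 2 * expectation (D m))"
  have e0: "0 \<le> e m" for m unfolding e_def using D0 by (simp add: Bochner_Integration.integral_nonneg)
  define G where "G = 2 * R + 2 * (K\<^sup>2 * (s - a))"
  have G0: "0 \<le> G" using R0 s by (simp add: G_def)
  have ED: "expectation (D m) \<le> \<delta> + G * prob {\<omega> \<in> space M. V m \<omega> > ennreal \<delta>}" if "0 \<le> \<delta>" "\<delta> \<le> 1" for m \<delta>
  proof -
    let ?A = "{\<omega> \<in> space M. V m \<omega> > ennreal \<delta>}"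
    have A: "?A \<in> events" using Vm[of m] by measurable
    have i: "integrable M (\<lambda>\<omega>. \<delta> + G * indicat_real ?A \<omega>)"
      using A by (intro Bochner_Integration.integrable_add integrable_const integrable_mult_right)
        (simp add: integrable_real_indicator emeasure_eq_measure)
    have "expectation (D m) \<le> expectation (\<lambda>\<omega>. \<delta> + G * indicat_real ?A \<omega>)"
    proof (rule integral_mono[OF Di i])
      fix \<omega> assume w: "\<omega> \<in> space M"
      show "D m \<omega> \<le> \<delta> + G * indicat_real ?A \<omega>"
      proof (cases "\<omega> \<in> ?A")
        case True
        then show ?thesis using D_le[of \<omega> m] w that by (simp add: G_def)
      next
        case False
        then have "V m \<omega> \<le> ennreal \<delta>" using w by auto
        then show ?thesis using close[of \<omega> m \<delta>] w that False by simp
      qed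
    qed
    also have "\<dots> = \<delta> + G * prob ?A"
      using A by (subst Bochner_Integration.integral_add)
       (auto intro!: integrable_mult_right simp: P.prob_space integrable_real_indicator emeasure_eq_measure sets.Int_space_eq2[of _ M, simplified])
    finally show ?thesis .
  qed
  have e_lim: "e \<longlonglongrightarrow> 0"
  proof (rule LIMSEQ_I)
    fix \<epsilon> :: real assume \<epsilon>: "0 < \<epsilon>"
    define \<delta> where "\<delta> = min 1 (\<epsilon> / 8)"
    have \<delta>: "0 < \<delta>" "\<delta> \<le> 1" "\<delta> \<le> \<epsilon> / 8" using \<epsilon> by (auto simp: \<delta>_def)
    have "(\<lambda>m. G * prob {\<omega> \<in> space M. V m \<omega> > ennreal \<delta>}) \<longlonglongrightarrow> G * 0"
      by (intro tendsto_intros Vlim \<delta>)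
    from order_tendstoD(2)[OF this, of "\<epsilon> / 8"] \<epsilon>
    obtain N where N: "\<And>m. m \<ge> N \<Longrightarrow> G * prob {\<omega> \<in> space M. V m \<omega> > ennreal \<delta>} < \<epsilon> / 8"
      by (auto simp: eventually_sequentially)
    have "norm (e m - 0) < \<epsilon>" if "m \<ge> N" for m
      using ED[of \<delta> m] N[OF that] \<delta> e0[of m] \<epsilon> unfolding e_def by simp
    then show "\<exists>no. \<forall>n\<ge>no. norm (e n - 0) < \<epsilon>" by blast
  qed
  have Jm: "J m \<in> borel_measurable M" for m unfolding J_def by (rule elem_integral_measurable[OF el])
  have Im: "I s \<in> borel_measurable M"
  proof (rule measurable_augmented_M[OF _ sT])
    show "I s \<in> borel_measurable (F s)" using ito s by (auto simp: ito_integral_def adapted_on_def)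
  qed
  have J_lim: "(\<lambda>m. prob {\<omega> \<in> space M. \<epsilon> < norm (J m \<omega> - I s \<omega>)}) \<longlonglongrightarrow> 0" if \<epsilon>: "0 < \<epsilon>" for \<epsilon>
  proof (rule tendsto_sandwich[OF _ _ tendsto_const])
    show "eventually (\<lambda>m. 0 \<le> prob {\<omega> \<in> space M. \<epsilon> < norm (J m \<omega> - I s \<omega>)}) sequentially" by simp
    show "(\<lambda>m. prob {\<omega> \<in> space M. V m \<omega> > ennreal 1} + prob {\<omega> \<in> space M. W m \<omega> > ennreal \<epsilon>}) \<longlonglongrightarrow> 0"
      using tendsto_add[OF Vlim[of 1] Wlim[OF \<epsilon>]] by simp
    show "eventually (\<lambda>m. prob {\<omega> \<in> space M. \<epsilon> < norm (J m \<omega> - I s \<omega>)}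
      \<le> prob {\<omega> \<in> space M. V m \<omega> > ennreal 1} + prob {\<omega> \<in> space M. W m \<omega> > ennreal \<epsilon>}) sequentially"
    proof (rule always_eventually, rule allI)
      fix m
      let ?A = "{\<omega> \<in> space M. V m \<omega> > ennreal 1}" and ?C = "{\<omega> \<in> space M. W m \<omega> > ennreal \<epsilon>}"
      have A: "?A \<in> events" using Vm[of m] by measurable
      have C: "?C \<in> events" using Wm[of m] by measurable
      have sub: "{\<omega> \<in> space M. \<epsilon> < norm (J m \<omega> - I s \<omega>)} \<subseteq> ?A \<union> ?C"
      proof safe
        fix \<omega> assume w: "\<omega> \<in> space M" "\<epsilon> < norm (J m \<omega> - I s \<omega>)" and nC: "\<not> W m \<omega> > ennreal \<epsilon>"
        show "V m \<omega> > ennreal 1"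
        proof (rule ccontr)
          assume "\<not> V m \<omega> > ennreal 1"
          then have "J m \<omega> = simple_integral B (k m) (\<tau> m) (\<xi> m) s \<omega>"
            using close[of \<omega> m 1] w by auto
          then have "ennreal (norm (J m \<omega> - I s \<omega>)) \<le> W m \<omega>"
            unfolding W_def using s by (auto intro!: SUP_upper)
          moreover have "ennreal \<epsilon> < ennreal (norm (J m \<omega> - I s \<omega>))"
            using w(2) \<epsilon> by (simp add: ennreal_less_iff)
          ultimately show False using nC by auto
        qed
      qed
      have "prob {\<omega> \<in> space M. \<epsilon> < norm (J m \<omega> - I s \<omega>)} \<le> prob (?A \<union> ?C)"
        by (rule finite_measure_mono[OF sub sets.Un[OF A C]])
      also have "\<dots> \<le> prob ?A + prob ?C" by (rule measure_Un_le[OF A C])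
      finally show "prob {\<omega> \<in> space M. \<epsilon> < norm (J m \<omega> - I s \<omega>)} \<le> prob ?A + prob ?C" .
    qed
  qed
  have cauchy: "integrable M (\<lambda>\<omega>. (norm (J m \<omega> - J l \<omega>))\<^sup>2) \<and>
      expectation (\<lambda>\<omega>. (norm (J m \<omega> - J l \<omega>))\<^sup>2) \<le> e m + e l" for m l
  proof -
    \<comment> \<open>the difference of two approximations as one elementary integral\<close>
    define N where "N = {..<k m} <+> {..<k l}"
    define r' where "r' = case_sum (r m) (r l)"
    define t' where "t' = case_sum (t m) (t l)"
    define \<zeta>' where "\<zeta>' = case_sum (\<zeta> m) (\<lambda>i \<omega>. - \<zeta> l i \<omega>)"
    have el': "elementary N r' t' \<zeta>'"
      unfolding elementary_def
    proof (intro conjI ballI)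
      show "finite N" by (simp add: N_def)
      fix i assume "i \<in> N"
      then consider (l) p where "i = Inl p" "p < k m" | (r) p where "i = Inr p" "p < k l"
        by (auto simp: N_def)
      then have "0 \<le> r' i \<and> r' i \<le> t' i \<and> t' i \<le> T \<and> \<zeta>' i \<in> borel_measurable (F (r' i)) \<and> bounded (\<zeta>' i ` space P)"
      proof cases
        case l
        then show ?thesis using el[of m] by (simp add: elementary_def r'_def t'_def \<zeta>'_def)
      next
        case r
        have "bounded (uminus ` (\<zeta> l p ` space P))"
          unfolding bounded_uminus using el[of l] r(2) by (simp add: elementary_def)
        then show ?thesis using el[of l] r by (simp add: elementary_def r'_def t'_def \<zeta>'_def image_image)
      qed
      then show "0 \<le> r' i" "r' i \<le> t' i" "t' i \<le> T" "\<zeta>' i \<in> borel_measurable (F (r' i))" "bounded (\<zeta>' i ` space P)"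
        by simp_all
    qed
    have clip': "a \<le> r' i \<and> t' i \<le> s" if "i \<in> N" for i
      using that clip[of _ m] clip[of _ l] unfolding N_def r'_def t'_def by auto
    have neg: "(- X) *v x = - (X *v x)" for X :: "real^'d^'m" and x
      by (simp add: matrix_vector_mult_def vec_eq_iff sum_negf)
    have Ji: "elem_integral N r' t' \<zeta>' \<omega> = J m \<omega> - J l \<omega>" for \<omega>
      unfolding elem_integral_def N_def J_def by (simp add: sum.Plus r'_def t'_def \<zeta>'_def neg sum_negf)
    have Vi: "elem_value N r' t' \<zeta>' v \<omega> = val m v \<omega> - val l v \<omega>" for v \<omega>
      unfolding elem_value_def N_def val_def 
      by (simp only: sum.Plus finite_lessThan comp_def sum.case r'_def t'_def \<zeta>'_def scaleR_minus_right sum_negf add_uminus_conv_diff)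
    have finN: "finite N" by (simp add: N_def)
    have ev: "integral\<^sup>L L (\<lambda>v. (norm (val m v \<omega> - val l v \<omega>))\<^sup>2) =
      (\<Sum>i\<in>N. \<Sum>j\<in>N. max 0 (min (t' i) (t' j) - max (r' i) (r' j)) * (\<zeta>' i \<omega> \<bullet> \<zeta>' j \<omega>))" for \<omega>
      unfolding Vi[symmetric] L_def by (rule elem_value_sq_integral[OF finN clip'])
    have "integrable M (\<lambda>\<omega>. (norm (J m \<omega> - J l \<omega>))\<^sup>2)"
      using elem_integral_sq_integrable[OF el'] unfolding Ji .
    moreover have "expectation (\<lambda>\<omega>. (norm (J m \<omega> - J l \<omega>))\<^sup>2)
        = expectation (\<lambda>\<omega>. integral\<^sup>L L (\<lambda>v. (norm (val m v \<omega> - val l v \<omega>))\<^sup>2))"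
      using elem_integral_sq[OF el'] unfolding Ji ev .
    moreover have "\<dots> \<le> expectation (\<lambda>\<omega>. 2 * D m \<omega> + 2 * D l \<omega>)"
    proof (rule integral_mono)
      show "integrable M (\<lambda>\<omega>. integral\<^sup>L L (\<lambda>v. (norm (val m v \<omega> - val l v \<omega>))\<^sup>2))"
        using elem_sq_integrable[OF el'] unfolding ev .
      show "integrable M (\<lambda>\<omega>. 2 * D m \<omega> + 2 * D l \<omega>)" using Di by simp
    qed (use diff_le in simp)
    moreover have "\<dots> = e m + e l" unfolding e_def using Di[of m] Di[of l] by simp
    ultimately show ?thesis by simp
  qed
  have J_I: "integrable M (\<lambda>\<omega>. (norm (J m \<omega> - I s \<omega>))\<^sup>2)"
    and J_I_le: "expectation (\<lambda>\<omega>. (norm (J m \<omega> - I s \<omega>))\<^sup>2) \<le> e m" for m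
    by (rule L2_limit_integrable[OF Jm Im J_lim e_lim e0 cauchy] L2_limit_bound[OF Jm Im J_lim e_lim e0 cauchy]; assumption)+
  show I_sq: "integrable M (\<lambda>\<omega>. (norm (I s \<omega>))\<^sup>2)"
  proof (rule Bochner_Integration.integrable_bound)
    show "integrable M (\<lambda>\<omega>. 2 * (norm (J 0 \<omega> - I s \<omega>))\<^sup>2 + 2 * (norm (J 0 \<omega>))\<^sup>2)"
      using J_I[of 0] Jsq[of 0] by simp
    show "(\<lambda>\<omega>. (norm (I s \<omega>))\<^sup>2) \<in> borel_measurable M" using Im by measurable
    show "AE \<omega> in M. norm ((norm (I s \<omega>))\<^sup>2) \<le> norm (2 * (norm (J 0 \<omega> - I s \<omega>))\<^sup>2 + 2 * (norm (J 0 \<omega>))\<^sup>2)"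
      using norm_diff_sq_le[of "I s _" 0 "J 0 _"] by (intro AE_I2) (simp add: norm_minus_commute)
  qed
  \<comment> \<open>both sides of the isometry are limits of the same sequence\<close>
  have lim1: "(\<lambda>m. expectation (\<lambda>\<omega>. (norm (J m \<omega>))\<^sup>2)) \<longlonglongrightarrow> expectation (\<lambda>\<omega>. (norm (I s \<omega>))\<^sup>2)"
  proof (rule perturbation_limit[OF e_lim])
    show "0 \<le> expectation (\<lambda>\<omega>. (norm (I s \<omega>))\<^sup>2)" by (intro Bochner_Integration.integral_nonneg) simp
    fix \<theta> :: real and m assume \<theta>: "0 < \<theta>"
    have "\<bar>expectation (\<lambda>\<omega>. (norm (J m \<omega>))\<^sup>2) - expectation (\<lambda>\<omega>. (norm (I s \<omega>))\<^sup>2)\<bar>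
      = \<bar>expectation (\<lambda>\<omega>. (norm (J m \<omega>))\<^sup>2 - (norm (I s \<omega>))\<^sup>2)\<bar>" using Jsq I_sq by simp
    also have "\<dots> \<le> expectation (\<lambda>\<omega>. \<bar>(norm (J m \<omega>))\<^sup>2 - (norm (I s \<omega>))\<^sup>2\<bar>)" by (rule integral_abs_bound)
    also have "\<dots> \<le> expectation (\<lambda>\<omega>. (1 + 1 / \<theta>) * (norm (J m \<omega> - I s \<omega>))\<^sup>2 + \<theta> * (norm (I s \<omega>))\<^sup>2)"
      by (rule integral_mono) (use Jsq[of m] I_sq J_I[of m] abs_norm_sq_diff_le[OF \<theta>] in auto)
    also have "\<dots> = (1 + 1 / \<theta>) * expectation (\<lambda>\<omega>. (norm (J m \<omega> - I s \<omega>))\<^sup>2) + \<theta> * expectation (\<lambda>\<omega>. (norm (I s \<omega>))\<^sup>2)"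
      using I_sq J_I[of m] by simp
    also have "\<dots> \<le> (1 + 1 / \<theta>) * e m + \<theta> * expectation (\<lambda>\<omega>. (norm (I s \<omega>))\<^sup>2)"
      using J_I_le[of m] \<theta> by (intro add_right_mono mult_left_mono) auto
    finally show "\<bar>expectation (\<lambda>\<omega>. (norm (J m \<omega>))\<^sup>2) - expectation (\<lambda>\<omega>. (norm (I s \<omega>))\<^sup>2)\<bar>
      \<le> (1 + 1 / \<theta>) * e m + \<theta> * expectation (\<lambda>\<omega>. (norm (I s \<omega>))\<^sup>2)" .
  qed
  have lim2: "(\<lambda>m. expectation (Q m)) \<longlonglongrightarrow> expectation QH"
  proof (rule perturbation_limit[OF e_lim])
    show "0 \<le> expectation QH" using QH0 by (intro Bochner_Integration.integral_nonneg) simp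
    fix \<theta> :: real and m assume \<theta>: "0 < \<theta>"
    have "\<bar>expectation (Q m) - expectation QH\<bar> = \<bar>expectation (\<lambda>\<omega>. Q m \<omega> - QH \<omega>)\<bar>" using Qi QHi by simp
    also have "\<dots> \<le> expectation (\<lambda>\<omega>. \<bar>Q m \<omega> - QH \<omega>\<bar>)" by (rule integral_abs_bound)
    also have "\<dots> \<le> expectation (\<lambda>\<omega>. (1 + 1 / \<theta>) * D m \<omega> + \<theta> * QH \<omega>)"
      by (rule integral_mono) (use Qi[of m] QHi Di[of m] Q_pert[OF _ \<theta>] in auto)
    also have "\<dots> = (1 + 1 / \<theta>) * expectation (D m) + \<theta> * expectation QH"
      using QHi Di[of m] by simp
    also have "\<dots> \<le> (1 + 1 / \<theta>) * e m + \<theta> * expectation QH"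
      using e0[of m] \<theta> unfolding e_def by (intro add_right_mono mult_left_mono) auto
    finally show "\<bar>expectation (Q m) - expectation QH\<bar> \<le> (1 + 1 / \<theta>) * e m + \<theta> * expectation QH" .
  qed
  have "expectation (\<lambda>\<omega>. (norm (I s \<omega>))\<^sup>2) = expectation QH"
    by (rule LIMSEQ_unique[OF lim1 lim2[folded J_iso]])
  then show "expectation (\<lambda>\<omega>. (norm (I s \<omega>))\<^sup>2)
      = expectation (\<lambda>\<omega>. integral\<^sup>L (restrict_space lborel {a..s}) (\<lambda>v. (norm (H v \<omega>))\<^sup>2))"
    unfolding QH_def L_def .
  have comp_m: "(\<lambda>x::real^'m. x $ i) \<in> borel_measurable borel" for i
    by (intro borel_measurable_continuous_onI continuous_intros)
  have comp_le: "\<bar>x $ i\<bar> \<le> \<theta> + (norm x)\<^sup>2 / \<theta>" if "0 < \<theta>" for x :: "real^'m" and i \<theta>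
  proof -
    have "norm x \<le> \<theta> + (norm x)\<^sup>2 / \<theta>"
    proof (cases "norm x \<le> \<theta>")
      case True then show ?thesis using that by (simp add: add_increasing2)
    next
      case False
      then have "norm x * \<theta> \<le> norm x * norm x" by (intro mult_left_mono) auto
      then have "norm x \<le> (norm x)\<^sup>2 / \<theta>" using that by (simp add: field_simps power2_eq_square)
      then show ?thesis using that by simp
    qed
    then show ?thesis using component_le_norm_cart[of x i] by linarith
  qed
  have Ii: "integrable M (\<lambda>\<omega>. I s \<omega> $ i)" for i
  proof (rule Bochner_Integration.integrable_bound)
    show "integrable M (\<lambda>\<omega>. 1 + (norm (I s \<omega>))\<^sup>2 / 1)" using I_sq by simp
    show "(\<lambda>\<omega>. I s \<omega> $ i) \<in> borel_measurable M" by (rule measurable_compose[OF Im comp_m])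
    show "AE \<omega> in M. norm (I s \<omega> $ i) \<le> norm (1 + (norm (I s \<omega>))\<^sup>2 / 1)"
      using comp_le[of 1 "I s _" i] by (intro AE_I2) simp
  qed
  then show "integrable M (\<lambda>\<omega>. I s \<omega> $ i)" .
  have Jint: "integrable M (\<lambda>\<omega>. J m \<omega> $ i)" and Jmean: "expectation (\<lambda>\<omega>. J m \<omega> $ i) = 0" for m i
    unfolding J_def by (rule elem_integral_integrable[OF el] elem_integral_mean[OF el])+
  have mean_le: "\<bar>expectation (\<lambda>\<omega>. I s \<omega> $ i)\<bar> \<le> \<theta>" if \<theta>: "0 < \<theta>" for \<theta>
  proof (rule LIMSEQ_le_const)
    have "(\<lambda>m. \<theta> + e m / \<theta>) \<longlonglongrightarrow> \<theta> + 0 / \<theta>" using \<theta> by (intro tendsto_intros e_lim) auto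
    then show "(\<lambda>m. \<theta> + e m / \<theta>) \<longlonglongrightarrow> \<theta>" by simp
    have "\<bar>expectation (\<lambda>\<omega>. I s \<omega> $ i)\<bar> \<le> \<theta> + e m / \<theta>" for m
    proof -
      have "\<bar>expectation (\<lambda>\<omega>. I s \<omega> $ i)\<bar> = \<bar>expectation (\<lambda>\<omega>. J m \<omega> $ i - I s \<omega> $ i)\<bar>"
        using Jint[of m i] Ii[of i] Jmean[of m i] by simp
      also have "\<dots> \<le> expectation (\<lambda>\<omega>. \<bar>J m \<omega> $ i - I s \<omega> $ i\<bar>)" by (rule integral_abs_bound)
      also have "\<dots> \<le> expectation (\<lambda>\<omega>. \<theta> + (norm (J m \<omega> - I s \<omega>))\<^sup>2 / \<theta>)"
        by (rule integral_mono) (use Jint[of m i] Ii[of i] J_I[of m] comp_le[OF \<theta>, of "J m _ - I s _" i] in auto)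
      also have "\<dots> = \<theta> + expectation (\<lambda>\<omega>. (norm (J m \<omega> - I s \<omega>))\<^sup>2) / \<theta>"
        using J_I[of m] by (simp add: P.prob_space)
      also have "\<dots> \<le> \<theta> + e m / \<theta>" using J_I_le[of m] \<theta> by (simp add: divide_right_mono)
      finally show ?thesis .
    qed
    then show "\<exists>N. \<forall>n\<ge>N. \<bar>expectation (\<lambda>\<omega>. I s \<omega> $ i)\<bar> \<le> \<theta> + e n / \<theta>" by blast
  qed
  have "\<bar>expectation (\<lambda>\<omega>. I s \<omega> $ i)\<bar> \<le> 0"
    by (rule field_le_epsilon) (simp only: add_0 mean_le)
  then show "expectation (\<lambda>\<omega>. I s \<omega> $ i) = 0" by simp
qed

text \<open>
  At the left endpoint every simple integral vanishes, and the convergence in probability is uniform in time.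
\<close>

lemma ito_start:
  fixes H :: "real \<Rightarrow> 'w \<Rightarrow> real^'d^'m"
  assumes ito: "ito_integral P B a b H I" and ab: "0 \<le> a" "a \<le> b" "b \<le> T"
  shows "AE \<omega> in M. I a \<omega> = 0"
proof -
  from ito obtain k \<tau> \<xi> where
    sp: "\<And>m. simple_process F a b (k m) (\<tau> m) (\<xi> m)" and
    W0: "tendsto_zero_in_prob M (\<lambda>m \<omega>.
        SUP s\<in>{a..b}. ennreal (norm (simple_integral B (k m) (\<tau> m) (\<xi> m) s \<omega> - I s \<omega>)))"
    unfolding ito_integral_def by blast
  define W where "W = (\<lambda>m \<omega>. SUP s\<in>{a..b}. ennreal (norm (simple_integral B (k m) (\<tau> m) (\<xi> m) s \<omega> - I s \<omega>)))"
  have Wm: "W m \<in> borel_measurable M" and Wlim: "0 < \<epsilon> \<Longrightarrow> (\<lambda>m. prob {\<omega> \<in> space M. W m \<omega> > ennreal \<epsilon>}) \<longlonglongrightarrow> 0" for m \<epsilon>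
    using W0 unfolding W_def tendsto_zero_in_prob_def by auto
  have Im: "I a \<in> borel_measurable M"
  proof (rule measurable_augmented_M)
    show "I a \<in> borel_measurable (F a)" using ito ab by (auto simp: ito_integral_def adapted_on_def)
  qed (use ab in simp)
  have zero: "simple_integral B (k m) (\<tau> m) (\<xi> m) a \<omega> = 0" for m \<omega>
    unfolding simple_integral_def
  proof (rule sum.neutral, rule ballI)
    fix i assume "i \<in> {..<k m}"
    then have "min (\<tau> m (Suc i)) a = a" "min (\<tau> m i) a = a"
      using simple_mono[OF sp ab(1,3) order_refl ab(2), of 0 i m] simple_mono[OF sp ab(1,3) order_refl ab(2), of 0 "Suc i" m]
        sp[of m] by (auto simp: simple_process_def)
    then show "\<xi> m i \<omega> *v (B (min (\<tau> m (Suc i)) a) \<omega> - B (min (\<tau> m i) a) \<omega>) = 0"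
      by (simp add: matrix_vector_mult_0_right)
  qed
  have "AE \<omega> in M. norm (I a \<omega>) \<le> \<epsilon>" if \<epsilon>: "0 < \<epsilon>" for \<epsilon>
  proof -
    let ?A = "{\<omega> \<in> space M. \<epsilon> < norm (I a \<omega>)}"
    have A: "?A \<in> events" using Im by measurable
    have "prob ?A \<le> prob {\<omega> \<in> space M. W m \<omega> > ennreal \<epsilon>}" for m
    proof (rule finite_measure_mono)
      show "{\<omega> \<in> space M. W m \<omega> > ennreal \<epsilon>} \<in> events" using Wm[of m] by measurable
      show "?A \<subseteq> {\<omega> \<in> space M. W m \<omega> > ennreal \<epsilon>}"
      proof safe
        fix \<omega> assume w: "\<omega> \<in> space M" "\<epsilon> < norm (I a \<omega>)"
        have "ennreal (norm (simple_integral B (k m) (\<tau> m) (\<xi> m) a \<omega> - I a \<omega>)) \<le> W m \<omega>"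
          unfolding W_def using ab by (intro SUP_upper) auto
        moreover have "ennreal \<epsilon> < ennreal (norm (I a \<omega>))" using w(2) \<epsilon> by (simp add: ennreal_less_iff)
        ultimately show "ennreal \<epsilon> < W m \<omega>" by (simp add: zero less_le_trans)
      qed
    qed
    then have "prob ?A \<le> 0" using Wlim[OF \<epsilon>] by (intro LIMSEQ_le_const) auto
    then have "prob ?A = 0" using measure_nonneg[of M ?A] by linarith
    then have "AE \<omega> in M. \<not> \<epsilon> < norm (I a \<omega>)"
      using A by (subst (asm) prob_eq_0) auto
    then show ?thesis by eventually_elim simp
  qed
  then have "AE \<omega> in M. \<forall>n. norm (I a \<omega>) \<le> 1 / real (Suc n)" by (subst AE_all_countable) simp
  then show ?thesis
  proof eventually_elim
    case (elim \<omega>)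
    have "norm (I a \<omega>) \<le> 0"
    proof (rule LIMSEQ_le_const[OF LIMSEQ_inverse_real_of_nat])
      show "\<exists>N. \<forall>n\<ge>N. norm (I a \<omega>) \<le> inverse (real (Suc n))"
        using elim by (auto simp: inverse_eq_divide)
    qed
    then show ?case by simp
  qed
qed

end

section \<open>A maximum principle with a penalty, and uniform ellipticity\<close>

text \<open>
  The penalty lies below a paraboloid touching it at x, and w is its gradient there; this is
  \<open>sqrt b \<le> (a + b) / (2 sqrt a)\<close> for \<open>a = 1 + |x|\<^sup>2\<close> and \<open>b = 1 + |y|\<^sup>2\<close>. Neither the constant 1/2 nor the bound
  on w depends on x, so the penalty costs the same everywhere.
\<close>

lemma sqrt_one_plus_norm_sq_expansion:
  fixes x :: "'a::real_inner"
  shows "\<exists>w. norm w \<le> 1 \<and> (\<forall>y. sqrt (1 + (norm y)\<^sup>2) \<le> sqrt (1 + (norm x)\<^sup>2) + (w \<bullet> (y - x) + (norm (y - x))\<^sup>2 / 2))"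
proof (intro exI conjI allI)
  define A where "A = sqrt (1 + (norm x)\<^sup>2)"
  have A1: "1 \<le> A" by (simp add: A_def)
  have A2: "A\<^sup>2 = 1 + (norm x)\<^sup>2" by (simp add: A_def)
  have "norm x \<le> A" unfolding A_def by (rule real_le_rsqrt) simp
  then show "norm ((1 / A) *\<^sub>R x) \<le> 1" using A1 by simp
  fix y :: 'a
  define D where "D = sqrt (1 + (norm y)\<^sup>2)"
  have D2: "D\<^sup>2 = 1 + (norm y)\<^sup>2" by (simp add: D_def)
  have yx: "(norm y)\<^sup>2 = (norm x)\<^sup>2 + 2 * (x \<bullet> (y - x)) + (norm (y - x))\<^sup>2"
    by (simp add: power2_norm_eq_inner algebra_simps inner_commute)
  have "0 \<le> (D - A)\<^sup>2" by simp
  have "2 * A * D \<le> 2 * A\<^sup>2 + (2 * (x \<bullet> (y - x)) + (norm (y - x))\<^sup>2)"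
  proof -
    have "(D - A)\<^sup>2 = D\<^sup>2 - 2 * A * D + A\<^sup>2" by (simp add: power2_eq_square algebra_simps)
    then show ?thesis using \<open>0 \<le> (D - A)\<^sup>2\<close> A2 D2 yx by linarith
  qed
  then have "D \<le> (2 * A\<^sup>2 + (2 * (x \<bullet> (y - x)) + (norm (y - x))\<^sup>2)) / (2 * A)"
    using A1 by (simp add: field_simps)
  also have "\<dots> = A + ((1 / A) *\<^sub>R x) \<bullet> (y - x) + (norm (y - x))\<^sup>2 / (2 * A)"
    using A1 by (simp add: field_simps power2_eq_square)
  also have "(norm (y - x))\<^sup>2 / (2 * A) \<le> (norm (y - x))\<^sup>2 / 2"
    using A1 by (intro divide_left_mono) auto
  finally show "sqrt (1 + (norm y)\<^sup>2) \<le> sqrt (1 + (norm x)\<^sup>2) + (((1 / A) *\<^sub>R x) \<bullet> (y - x) + (norm (y - x))\<^sup>2 / 2)"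
    unfolding A_def[symmetric] D_def[symmetric] by simp
qed

text \<open>
  Only space needs a penalty: time runs through a compact interval, and the penalised function is
  negative enough outside a large ball for its supremum to be attained. At a maximum before the
  terminal time, \<open>\<Psi>\<close> would be touched from above by a paraboloid with coefficient \<open>\<epsilon>\<close>, which
  \<open>no_max\<close> excludes; so the maximum is at the terminal time, and \<open>\<epsilon>\<close> can be taken as small as desired.
\<close>

lemma maximum_principle_penalized:
  fixes \<Psi> :: "real \<Rightarrow> 'a::euclidean_space \<Rightarrow> real"
  assumes bdd: "\<And>t x. t \<in> {0..T} \<Longrightarrow> \<bar>\<Psi> t x\<bar> \<le> N"
    and cont: "continuous_on ({0..T} \<times> UNIV) (\<lambda>(t, x). \<Psi> t x)"
    and \<epsilon>0: "0 < \<epsilon>0"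
    and no_max: "\<And>\<epsilon> t x w. 0 < \<epsilon> \<Longrightarrow> \<epsilon> < \<epsilon>0 \<Longrightarrow> 0 \<le> t \<Longrightarrow> t < T \<Longrightarrow> norm w \<le> 1 \<Longrightarrow>
      (\<And>s y. s \<in> {0..T} \<Longrightarrow> \<Psi> s y \<le> \<Psi> t x + \<epsilon> * (w \<bullet> (y - x) + (norm (y - x))\<^sup>2 / 2)) \<Longrightarrow> False"
    and top: "\<And>x. \<Psi> T x \<le> m"
    and t: "t \<in> {0..T}"
  shows "\<Psi> t x \<le> m"
proof (rule ccontr)
  assume "\<not> \<Psi> t x \<le> m"
  define pen where "pen = (\<lambda>y::'a. sqrt (1 + (norm y)\<^sup>2))"
  have pen1: "1 \<le> pen y" and penn: "norm y \<le> pen y" for y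
    unfolding pen_def by (auto intro: real_le_rsqrt)
  define \<epsilon> where "\<epsilon> = min (\<epsilon>0 / 2) ((\<Psi> t x - m) / (2 * pen x))"
  have "0 < (\<Psi> t x - m) / (2 * pen x)"
    using \<open>\<not> \<Psi> t x \<le> m\<close> pen1[of x] by simp
  then have \<epsilon>: "0 < \<epsilon>" "\<epsilon> < \<epsilon>0" using \<epsilon>0 by (auto simp: \<epsilon>_def)
  have "\<epsilon> * pen x \<le> (\<Psi> t x - m) / (2 * pen x) * pen x"
    using pen1[of x] by (intro mult_right_mono) (auto simp: \<epsilon>_def)
  also have "\<dots> = (\<Psi> t x - m) / 2" using pen1[of x] by (simp add: field_simps)
  finally have \<epsilon>x: "m < \<Psi> t x - \<epsilon> * pen x" using \<open>\<not> \<Psi> t x \<le> m\<close> by simp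
  define G where "G = (\<lambda>z::real \<times> 'a. \<Psi> (fst z) (snd z) - \<epsilon> * pen (snd z))"
  have N0: "0 \<le> N" using bdd[OF t, of x] by linarith
  \<comment> \<open>outside this radius the penalty exceeds the whole oscillation of the function\<close>
  define \<rho> where "\<rho> = (2 * N + \<epsilon> * pen x) / \<epsilon> + 1"
  have \<rho>: "\<epsilon> * \<rho> = 2 * N + \<epsilon> * pen x + \<epsilon>" using \<epsilon> by (simp add: \<rho>_def field_simps)
  have "pen x \<le> \<rho>" using \<epsilon> N0 by (simp add: \<rho>_def add_divide_distrib)
  then have x\<rho>: "norm x \<le> \<rho>" using penn[of x] by simp
  define S where "S = {0..T} \<times> cball (0::'a) \<rho>"
  have S: "compact S" "(t, x) \<in> S" using t x\<rho> by (auto simp: S_def intro!: compact_Times)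
  have "continuous_on S G"
    unfolding G_def pen_def
  proof (intro continuous_intros)
    have "continuous_on S (\<lambda>(t, x). \<Psi> t x)" by (rule continuous_on_subset[OF cont]) (auto simp: S_def)
    then show "continuous_on S (\<lambda>z. \<Psi> (fst z) (snd z))" by (simp add: case_prod_beta)
  qed
  with S obtain z where z: "z \<in> S" "\<And>z'. z' \<in> S \<Longrightarrow> G z' \<le> G z"
    using continuous_attains_sup[of S G] by blast
  obtain t0 x0 where z_eq: "z = (t0, x0)" by (cases z)
  have t0: "t0 \<in> {0..T}" using z(1) by (simp add: S_def z_eq)
  have glob: "\<Psi> s y - \<epsilon> * pen y \<le> \<Psi> t0 x0 - \<epsilon> * pen x0" if s: "s \<in> {0..T}" for s y
  proof (cases "norm y \<le> \<rho>")
    case True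
    then show ?thesis using z(2)[of "(s, y)"] s by (simp add: S_def z_eq G_def)
  next
    case False
    have "\<epsilon> * \<rho> \<le> \<epsilon> * pen y" using False penn[of y] \<epsilon> by (intro mult_left_mono) auto
    then have "\<Psi> s y - \<epsilon> * pen y \<le> \<Psi> t x - \<epsilon> * pen x"
      using bdd[OF s, of y] bdd[OF t, of x] \<rho> \<epsilon> by linarith
    also have "\<dots> \<le> \<Psi> t0 x0 - \<epsilon> * pen x0" using z(2)[OF S(2)] by (simp add: z_eq G_def)
    finally show ?thesis .
  qed
  show False
  proof (cases "t0 = T")
    case True
    have "\<Psi> t x - \<epsilon> * pen x \<le> \<Psi> T x0 - \<epsilon> * pen x0" using glob[OF t, of x] True by simp
    also have "\<dots> \<le> m" using top[of x0] \<epsilon> pen1[of x0] by (simp add: add_increasing2 algebra_simps mult_nonneg_nonneg)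
    finally show False using \<epsilon>x by simp
  next
    case False
    then have t0': "0 \<le> t0" "t0 < T" using t0 by auto
    obtain w where w: "norm w \<le> 1" "\<And>y. pen y \<le> pen x0 + (w \<bullet> (y - x0) + (norm (y - x0))\<^sup>2 / 2)"
      using sqrt_one_plus_norm_sq_expansion[of x0] unfolding pen_def by blast
    show False
    proof (rule no_max[OF \<epsilon> t0' w(1)])
      fix s y assume s: "s \<in> {0..T}"
      have "\<epsilon> * pen y \<le> \<epsilon> * (pen x0 + (w \<bullet> (y - x0) + (norm (y - x0))\<^sup>2 / 2))"
        using w(2)[of y] \<epsilon> by (intro mult_left_mono) auto
      then show "\<Psi> s y \<le> \<Psi> t0 x0 + \<epsilon> * (w \<bullet> (y - x0) + (norm (y - x0))\<^sup>2 / 2)"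
        using glob[OF s, of y] by (simp add: distrib_left)
    qed
  qed
qed

text \<open>
  The first-order condition for a maximum of \<open>\<phi>\<close> minus the paraboloid.
\<close>

lemma derivative_at_paraboloid_contact:
  fixes \<phi> :: "'a::euclidean_space \<Rightarrow> real"
  assumes der: "(\<phi> has_derivative \<phi>') (at x)"
    and le: "\<And>y. \<phi> y \<le> \<phi> x + \<epsilon> * (w \<bullet> (y - x) + (norm (y - x))\<^sup>2 / 2)"
  shows "\<phi>' z = \<epsilon> * (w \<bullet> z)"
proof -
  define \<psi> where "\<psi> = (\<lambda>y. \<phi> y - \<epsilon> * (w \<bullet> (y - x) + ((y - x) \<bullet> (y - x)) / 2))"
  have "(\<psi> has_derivative (\<lambda>z. \<phi>' z - \<epsilon> * (w \<bullet> z))) (at x)"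
    unfolding \<psi>_def by (rule derivative_eq_intros der refl | simp)+
  moreover have "\<forall>y\<in>UNIV. \<psi> y \<le> \<psi> x"
    using le[unfolded power2_norm_eq_inner] by (auto simp: \<psi>_def algebra_simps)
  ultimately have "(\<lambda>z. \<phi>' z - \<epsilon> * (w \<bullet> z)) = (\<lambda>z. 0)"
    by (intro differential_zero_maxmin[of x UNIV]) auto
  from fun_cong[OF this, of z] show ?thesis by simp
qed

lemma norm_sq_vec: "(norm (v :: 'b::real_inner ^ 'm))\<^sup>2 = (\<Sum>i\<in>UNIV. (norm (v $ i))\<^sup>2)"
  by (simp add: power2_norm_eq_inner inner_vec_def)

lemma norm_sq_matrix_columns: "(norm (A :: real^'d^'e))\<^sup>2 = (\<Sum>j\<in>UNIV. (norm (A *v axis j 1))\<^sup>2)"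
proof -
  have "(\<Sum>j\<in>UNIV. (norm (A *v axis j 1))\<^sup>2) = (\<Sum>j\<in>UNIV. \<Sum>i\<in>UNIV. (A $ i $ j)\<^sup>2)"
    unfolding matrix_vector_mult_basis norm_sq_vec by (simp add: column_def)
  also have "\<dots> = (\<Sum>i\<in>UNIV. \<Sum>j\<in>UNIV. (A $ i $ j)\<^sup>2)" by (rule sum.swap)
  also have "\<dots> = (norm A)\<^sup>2" unfolding norm_sq_vec by simp
  finally show ?thesis by simp
qed

lemma sigma_condition_elliptic:
  fixes \<sigma> :: "real \<Rightarrow> real^'d \<Rightarrow> real^'n \<Rightarrow> real^'d^'d" and p :: "real^'d^'n"
  assumes sig: "sigma_condition T \<sigma> L\<^sub>\<sigma> C\<^sub>\<sigma>" and t: "t \<in> {0..T}"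
  shows sigma_norm_sq_le: "(norm (\<sigma> t x y))\<^sup>2 \<le> real CARD('d) * C\<^sub>\<sigma>"
    and mat_act_lower: "(norm p)\<^sup>2 / C\<^sub>\<sigma> \<le> (norm (mat_act (\<sigma> t x y) p))\<^sup>2"
    and mat_act_upper: "(norm (mat_act (\<sigma> t x y) p))\<^sup>2 \<le> C\<^sub>\<sigma> * (norm p)\<^sup>2"
    and mat_act_inverse: "mat_act (matrix_inv (\<sigma> t x y)) (mat_act (\<sigma> t x y) p) = p"
proof -
  let ?S = "\<sigma> t x y"
  have C: "0 < C\<^sub>\<sigma>" and
    lo: "1 / C\<^sub>\<sigma> * (norm z)\<^sup>2 \<le> (norm (?S *v z))\<^sup>2" and up: "(norm (?S *v z))\<^sup>2 \<le> C\<^sub>\<sigma> * (norm z)\<^sup>2" for z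
    using sig t by (auto simp: sigma_condition_def)
  have "(norm ?S)\<^sup>2 \<le> (\<Sum>j\<in>UNIV. C\<^sub>\<sigma> * (norm (axis j (1::real) :: real^'d))\<^sup>2)"
    unfolding norm_sq_matrix_columns by (intro sum_mono up)
  then show "(norm ?S)\<^sup>2 \<le> real CARD('d) * C\<^sub>\<sigma>" by simp
  have act: "(norm (mat_act ?S p))\<^sup>2 = (\<Sum>i\<in>UNIV. (norm (?S *v (p $ i)))\<^sup>2)"
    unfolding norm_sq_vec[of "mat_act ?S p"] by (simp add: mat_act_def)
  have "(norm p)\<^sup>2 / C\<^sub>\<sigma> = (\<Sum>i\<in>UNIV. 1 / C\<^sub>\<sigma> * (norm (p $ i))\<^sup>2)"
    unfolding norm_sq_vec[of p] by (simp add: sum_divide_distrib)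
  also have "\<dots> \<le> (norm (mat_act ?S p))\<^sup>2" unfolding act by (intro sum_mono lo)
  finally show "(norm p)\<^sup>2 / C\<^sub>\<sigma> \<le> (norm (mat_act ?S p))\<^sup>2" .
  have "(norm (mat_act ?S p))\<^sup>2 \<le> (\<Sum>i\<in>UNIV. C\<^sub>\<sigma> * (norm (p $ i))\<^sup>2)" unfolding act by (intro sum_mono up)
  also have "\<dots> = C\<^sub>\<sigma> * (norm p)\<^sup>2" unfolding norm_sq_vec[of p] by (simp add: sum_distrib_left)
  finally show "(norm (mat_act ?S p))\<^sup>2 \<le> C\<^sub>\<sigma> * (norm p)\<^sup>2" .
  have "inj ((*v) ?S)"
  proof (rule injI)
    fix z z' assume "?S *v z = ?S *v z'"
    then have "?S *v (z - z') = 0" by (simp add: matrix_vector_mult_diff_distrib)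
    then have "1 / C\<^sub>\<sigma> * (norm (z - z'))\<^sup>2 \<le> 0" using lo[of "z - z'"] by simp
    then show "z = z'" using C by (simp add: divide_le_0_iff)
  qed
  then have "invertible ?S"
    by (simp add: invertible_left_inverse matrix_left_invertible_injective)
  then have "matrix_inv ?S ** ?S = mat 1"
    unfolding invertible_def matrix_inv_def by (rule someI2_ex) simp
  then show "mat_act (matrix_inv ?S) (mat_act ?S p) = p"
    by (simp add: mat_act_def matrix_vector_mul_assoc)
qed

context brownian
begin

text \<open>
  Since the paths are continuous, the events that X stays in a ball up to time \<open>t + h\<close> exhaust the
  probability space as h tends to 0. Rational times make these events measurable. One event serves all smaller h.
\<close>

lemma path_stays_close:
  fixes X :: "real \<Rightarrow> 'w \<Rightarrow> real^'d"
  assumes t: "t < T" and X: "\<And>s. t \<le> s \<Longrightarrow> s \<le> T \<Longrightarrow> X s \<in> borel_measurable M"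
    and cont: "AE \<omega> in M. continuous_on {t..T} (\<lambda>s. X s \<omega>)" and start: "AE \<omega> in M. X t \<omega> = x"
    and \<rho>: "0 < \<rho>" and \<pi>: "0 < \<pi>"
  shows "\<exists>h>0. t + h < T \<and> (\<exists>A\<in>events. 1 - \<pi> < prob A \<and> (\<forall>\<omega>\<in>A. \<forall>r\<in>{t..t + h}. norm (X r \<omega> - x) \<le> \<rho>))"
proof -
  have "AE \<omega> in M. continuous_on {t..T} (\<lambda>s. X s \<omega>) \<and> X t \<omega> = x" using cont start by auto
  then obtain N where N: "{\<omega> \<in> space M. \<not> (continuous_on {t..T} (\<lambda>s. X s \<omega>) \<and> X t \<omega> = x)} \<subseteq> N" "N \<in> null_sets M"
    unfolding eventually_ae_filter by blast
  define h where "h = (\<lambda>n. (T - t) / real (n + 2))"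
  have h0: "0 < h n" and hT: "t + h n < T" for n
  proof -
    show "0 < h n" using t by (simp add: h_def)
    have "(T - t) / real (n + 2) < (T - t) / 1" using t by (intro divide_strict_left_mono) auto
    then show "t + h n < T" by (simp add: h_def)
  qed
  have h_lim: "h \<longlonglongrightarrow> 0"
    unfolding h_def by (rule LIMSEQ_ignore_initial_segment, rule lim_const_over_n)
  define Q where "Q = (\<lambda>n. {r \<in> \<rat>. t < r \<and> r < t + h n})"
  have Qc: "countable (Q n)" for n
    unfolding Q_def by (rule countable_subset[OF _ countable_rat]) auto
  define A where "A = (\<lambda>n. {\<omega> \<in> space M - N. \<forall>r\<in>Q n. norm (X r \<omega> - x) \<le> \<rho>})"
  have A_events: "A n \<in> events" for n
  proof -
    have "(\<Union>r\<in>Q n. {\<omega> \<in> space M. \<not> norm (X r \<omega> - x) \<le> \<rho>}) \<in> events"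
    proof (rule sets.countable_UN'[OF Qc], safe)
      fix r assume "r \<in> Q n"
      then have [measurable]: "X r \<in> borel_measurable M" using X[of r] hT[of n] by (auto simp: Q_def)
      show "{\<omega> \<in> space M. \<not> norm (X r \<omega> - x) \<le> \<rho>} \<in> events" by measurable
    qed
    then have "space M - (\<Union>r\<in>Q n. {\<omega> \<in> space M. \<not> norm (X r \<omega> - x) \<le> \<rho>}) \<in> events" by (rule sets.compl_sets)
    moreover have "space M - (\<Union>r\<in>Q n. {\<omega> \<in> space M. \<not> norm (X r \<omega> - x) \<le> \<rho>})
       = {\<omega> \<in> space M. \<forall>r\<in>Q n. norm (X r \<omega> - x) \<le> \<rho>}" by auto
    ultimately have "{\<omega> \<in> space M. \<forall>r\<in>Q n. norm (X r \<omega> - x) \<le> \<rho>} \<in> events" by simp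
    moreover have "A n = {\<omega> \<in> space M. \<forall>r\<in>Q n. norm (X r \<omega> - x) \<le> \<rho>} - N" by (auto simp: A_def)
    ultimately show ?thesis using N(2) by auto
  qed
  have A_close: "norm (X r \<omega> - x) \<le> \<rho>" if w: "\<omega> \<in> A n" and r: "r \<in> {t..t + h n}" for \<omega> n r
  proof -
    have c: "continuous_on {t..T} (\<lambda>s. X s \<omega>)" using w N(1) by (auto simp: A_def)
    show ?thesis
    proof (rule ccontr)
      assume nle: "\<not> norm (X r \<omega> - x) \<le> \<rho>"
      have rT: "r \<in> {t..T}" using r hT[of n] by auto
      have "0 < norm (X r \<omega> - x) - \<rho>" using nle by simp
      then obtain \<delta> where \<delta>: "0 < \<delta>"
        "\<And>r'. r' \<in> {t..T} \<Longrightarrow> dist r' r < \<delta> \<Longrightarrow> dist (X r' \<omega>) (X r \<omega>) < norm (X r \<omega> - x) - \<rho>"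
        using c[unfolded continuous_on_iff, rule_format, OF rT] by blast
      have "max t (r - \<delta>) < min (t + h n) (r + \<delta>)" using r h0[of n] \<delta>(1) by auto
      then obtain q where q: "max t (r - \<delta>) < of_rat q" "of_rat q < min (t + h n) (r + \<delta>)"
        using of_rat_dense by blast
      then have qQ: "of_rat q \<in> Q n" by (auto simp: Q_def)
      have "(of_rat q :: real) \<in> {t..T}" "dist (of_rat q) r < \<delta>"
        using q hT[of n] by (auto simp: dist_real_def abs_less_iff)
      from \<delta>(2)[OF this] have "norm (X (of_rat q) \<omega> - X r \<omega>) < norm (X r \<omega> - x) - \<rho>" by (simp add: dist_norm)
      moreover have "norm (X (of_rat q) \<omega> - x) \<le> \<rho>" using w qQ by (auto simp: A_def)
      moreover have "norm (X r \<omega> - x) \<le> norm (X (of_rat q) \<omega> - X r \<omega>) + norm (X (of_rat q) \<omega> - x)"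
        using norm_triangle_ineq4[of "X (of_rat q) \<omega> - x" "X (of_rat q) \<omega> - X r \<omega>"] by simp
      ultimately show False by linarith
    qed
  qed
  have "incseq A"
  proof (rule incseq_SucI)
    fix n
    have "h (Suc n) \<le> h n" using t by (auto simp: h_def intro!: divide_left_mono)
    then show "A n \<subseteq> A (Suc n)" by (auto simp: A_def Q_def)
  qed
  moreover have "(\<Union>n. A n) = space M - N"
  proof safe
    fix \<omega> assume w: "\<omega> \<in> space M" "\<omega> \<notin> N"
    then have c: "continuous_on {t..T} (\<lambda>s. X s \<omega>)" "X t \<omega> = x" using N(1) by auto
    obtain \<delta> where \<delta>: "0 < \<delta>" "\<And>r. r \<in> {t..T} \<Longrightarrow> dist r t < \<delta> \<Longrightarrow> dist (X r \<omega>) (X t \<omega>) < \<rho>"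
      using c(1)[unfolded continuous_on_iff, rule_format, of t \<rho>] t \<rho> by auto
    obtain n where n: "h n < \<delta>"
      using order_tendstoD(2)[OF h_lim \<delta>(1)] by (auto simp: eventually_sequentially)
    have "norm (X r \<omega> - x) \<le> \<rho>" if "r \<in> Q n" for r
    proof -
      have "r \<in> {t..T}" "dist r t < \<delta>" using that hT[of n] n by (auto simp: Q_def dist_real_def)
      from \<delta>(2)[OF this] show ?thesis by (simp add: c(2) dist_norm)
    qed
    then show "\<omega> \<in> (\<Union>n. A n)" using w by (auto simp: A_def)
  qed (auto simp: A_def)
  moreover have "prob (space M - N) = 1"
    using N(2) prob_compl[of N] by (auto simp: measure_eq_0_null_sets)
  ultimately have "(\<lambda>n. prob (A n)) \<longlonglongrightarrow> 1"
    using finite_Lim_measure_incseq[of A] A_events by auto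
  from order_tendstoD(1)[OF this, of "1 - \<pi>"] \<pi>
  obtain n where "1 - \<pi> < prob (A n)" by (auto simp: eventually_sequentially)
  then show ?thesis using h0 hT A_events A_close by blast
qed

end

section \<open>Decoupling solutions started at a point\<close>

context brownian
begin

text \<open>
  What the estimates below use about the diffusion X started at (t, x) and the martingale part I of
  \<open>u(s, X s)\<close>. The lower bound on the second moment of I is stated for an event A on which the gradient is large,
  because \<open>\<sigma>\<close> may be discontinuous in time: near (t, x) the integrand Z of I need not be close to a
  constant, but ellipticity bounds it from below by the gradient, which is continuous.
\<close>

definition local_solution :: "(real \<Rightarrow> real^'d \<Rightarrow> real^'n \<Rightarrow> real^'d^'d) \<Rightarrow>
    (real \<Rightarrow> real^'d \<Rightarrow> real^'n \<Rightarrow> real^'d^'n \<Rightarrow> real^'n) \<Rightarrow> (real \<Rightarrow> real^'d \<Rightarrow> real^'n) \<Rightarrow>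
    real \<Rightarrow> real \<Rightarrow> real^'d \<Rightarrow> (real \<Rightarrow> 'w \<Rightarrow> real^'d) \<Rightarrow> (real \<Rightarrow> 'w \<Rightarrow> real^'n) \<Rightarrow> bool"
  where "local_solution \<sigma> f u C t x X I \<longleftrightarrow>
    (\<forall>s\<in>{t..T}. X s \<in> borel_measurable M) \<and>
    (AE \<omega> in M. continuous_on {t..T} (\<lambda>s. X s \<omega>)) \<and> (AE \<omega> in M. X t \<omega> = x) \<and>
    (\<forall>s\<in>{t..<T}.
      (\<forall>j. integrable M (\<lambda>\<omega>. (X s \<omega> - x) $ j) \<and> expectation (\<lambda>\<omega>. (X s \<omega> - x) $ j) = 0) \<and>
      integrable M (\<lambda>\<omega>. (norm (X s \<omega> - x))\<^sup>2) \<and>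
      expectation (\<lambda>\<omega>. (norm (X s \<omega> - x))\<^sup>2) \<le> real CARD('d) * C * (s - t) \<and>
      (\<forall>i. integrable M (\<lambda>\<omega>. I s \<omega> $ i) \<and> expectation (\<lambda>\<omega>. I s \<omega> $ i) = 0) \<and>
      integrable M (\<lambda>\<omega>. (norm (I s \<omega>))\<^sup>2) \<and>
      (\<forall>A\<in>events. \<forall>c. (\<forall>\<omega>\<in>A. \<forall>r\<in>{t..s}. c \<le> (norm (jacobian (u r) (at (X r \<omega>))))\<^sup>2) \<longrightarrow>
         prob A * (s - t) * c / C \<le> expectation (\<lambda>\<omega>. (norm (I s \<omega>))\<^sup>2)) \<and>
      (AE \<omega> in M. (\<lambda>r. f r (X r \<omega>) (u r (X r \<omega>)) (jacobian (u r) (at (X r \<omega>)))) absolutely_integrable_on {t..s} \<and>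
         u s (X s \<omega>) - u t x = I s \<omega> - integral {t..s} (\<lambda>r. f r (X r \<omega>) (u r (X r \<omega>)) (jacobian (u r) (at (X r \<omega>))))))"

text \<open>
  Both stochastic integrals have bounded integrands, \<open>\<sigma>\<close> by ellipticity and Z because Du is bounded,
  so the isometry applies to them. In the driver \<open>\<sigma>\<close> cancels against its inverse, which leaves f evaluated at
  u and Du along X.
\<close>

lemma ex_local_solution:
  fixes u :: "real \<Rightarrow> real^'d \<Rightarrow> real^'n"
  assumes dec: "decoupling_solution P B T \<sigma> f g u" and sig: "sigma_condition T \<sigma> L\<^sub>\<sigma> C\<^sub>\<sigma>"
    and t: "0 \<le> t" "t < T"
  shows "\<exists>X I. local_solution \<sigma> f u C\<^sub>\<sigma> t x X I"
proof -
  let ?J = "\<lambda>r y. jacobian (u r) (at y)"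
  have C: "0 < C\<^sub>\<sigma>" using sig by (simp add: sigma_condition_def)
  have tT: "t \<in> {0..T}" using t by simp
  obtain K where K: "\<And>r y. 0 \<le> r \<Longrightarrow> r < T \<Longrightarrow> norm (?J r y) \<le> K"
    using dec unfolding decoupling_solution_def bounded_iff by fastforce
  from dec tT obtain X where sde: "sde_solution P B T \<sigma> u t x X"
    and bsde: "bsde_holds P B T \<sigma> f g t X (\<lambda>s \<omega>. u s (X s \<omega>))
      (\<lambda>s \<omega>. mat_act (\<sigma> s (X s \<omega>) (u s (X s \<omega>))) (?J s (X s \<omega>)))"
    unfolding decoupling_solution_def Let_def by blast
  define Z where "Z = (\<lambda>s \<omega>. mat_act (\<sigma> s (X s \<omega>) (u s (X s \<omega>))) (?J s (X s \<omega>)))"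
  define drv where "drv = (\<lambda>\<omega> r. f r (X r \<omega>) (u r (X r \<omega>)) (?J r (X r \<omega>)))"
  from sde obtain IX where
    X: "adapted_on F t T X" "AE \<omega> in P. continuous_on {t..T} (\<lambda>s. X s \<omega>)"
    and IX: "ito_integral P B t T (\<lambda>s \<omega>. \<sigma> s (X s \<omega>) (u s (X s \<omega>))) IX"
    and X_eq: "AE \<omega> in P. \<forall>t'\<in>{t..T}. X t' \<omega> = x + IX t' \<omega>"
    unfolding sde_solution_def by blast
  from bsde obtain I where I: "ito_integral P B t T Z I"
    and Y: "AE \<omega> in P. (\<lambda>s. f s (X s \<omega>) (u s (X s \<omega>)) (mat_act (matrix_inv (\<sigma> s (X s \<omega>) (u s (X s \<omega>)))) (Z s \<omega>)))
        absolutely_integrable_on {t..T} \<and>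
      (\<forall>t'\<in>{t..T}. u t' (X t' \<omega>) = g (X T \<omega>) + integral {t'..T}
        (\<lambda>s. f s (X s \<omega>) (u s (X s \<omega>)) (mat_act (matrix_inv (\<sigma> s (X s \<omega>) (u s (X s \<omega>)))) (Z s \<omega>))) - (I T \<omega> - I t' \<omega>))"
    unfolding bsde_holds_def Let_def Z_def by blast
  have drv_eq: "f s (X s \<omega>) (u s (X s \<omega>)) (mat_act (matrix_inv (\<sigma> s (X s \<omega>) (u s (X s \<omega>)))) (Z s \<omega>)) = drv \<omega> s"
    if "s \<in> {t..T}" for s \<omega>
    using that t unfolding Z_def drv_def by (subst mat_act_inverse[OF sig]) auto
  have Y': "AE \<omega> in M. drv \<omega> absolutely_integrable_on {t..T} \<and>
      (\<forall>t'\<in>{t..T}. u t' (X t' \<omega>) = g (X T \<omega>) + integral {t'..T} (drv \<omega>) - (I T \<omega> - I t' \<omega>))"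
    using AE_completion[OF Y]
  proof eventually_elim
    case (elim \<omega>)
    have e: "integral {t'..T} (\<lambda>s. f s (X s \<omega>) (u s (X s \<omega>)) (mat_act (matrix_inv (\<sigma> s (X s \<omega>) (u s (X s \<omega>)))) (Z s \<omega>)))
       = integral {t'..T} (drv \<omega>)" if "t' \<in> {t..T}" for t'
      using that by (intro integral_cong drv_eq) auto
    have "drv \<omega> absolutely_integrable_on {t..T}"
      by (subst set_integrable_cong[OF refl refl drv_eq[symmetric]]) (use elim in auto)
    then show ?case using elim e by simp
  qed
  have IX0: "AE \<omega> in M. IX t \<omega> = 0" using ito_start[OF IX] t by simp
  have I0: "AE \<omega> in M. I t \<omega> = 0" using ito_start[OF I] t by simp
  have X0: "AE \<omega> in M. X t \<omega> = x"
    using AE_completion[OF X_eq] IX0 by eventually_elim (use t in auto)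
  have Xm: "X s \<in> borel_measurable M" if "s \<in> {t..T}" for s
    using X(1) that by (intro measurable_augmented_M[of _ s]) (auto simp: adapted_on_def)
  define KS where "KS = sqrt (real CARD('d) * C\<^sub>\<sigma>)"
  have sK: "norm (\<sigma> r (X r \<omega>) (u r (X r \<omega>))) \<le> KS" if "t \<le> r" "r < T" "\<omega> \<in> space P" for r \<omega>
    unfolding KS_def by (intro real_le_rsqrt sigma_norm_sq_le[OF sig]) (use that t in auto)
  define KZ where "KZ = sqrt (C\<^sub>\<sigma> * K\<^sup>2)"
  have ZK: "norm (Z r \<omega>) \<le> KZ" if "t \<le> r" "r < T" "\<omega> \<in> space P" for r \<omega>
    unfolding KZ_def
  proof (rule real_le_rsqrt)
    have "(norm (Z r \<omega>))\<^sup>2 \<le> C\<^sub>\<sigma> * (norm (?J r (X r \<omega>)))\<^sup>2"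
      unfolding Z_def by (rule mat_act_upper[OF sig]) (use that t in auto)
    also have "\<dots> \<le> C\<^sub>\<sigma> * K\<^sup>2" using C K[of r] that t by (intro mult_left_mono power_mono) auto
    finally show "(norm (Z r \<omega>))\<^sup>2 \<le> C\<^sub>\<sigma> * K\<^sup>2" .
  qed
  have main: "(\<forall>j. integrable M (\<lambda>\<omega>. (X s \<omega> - x) $ j) \<and> expectation (\<lambda>\<omega>. (X s \<omega> - x) $ j) = 0) \<and>
      integrable M (\<lambda>\<omega>. (norm (X s \<omega> - x))\<^sup>2) \<and>
      expectation (\<lambda>\<omega>. (norm (X s \<omega> - x))\<^sup>2) \<le> real CARD('d) * C\<^sub>\<sigma> * (s - t) \<and>
      (\<forall>i. integrable M (\<lambda>\<omega>. I s \<omega> $ i) \<and> expectation (\<lambda>\<omega>. I s \<omega> $ i) = 0) \<and>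
      integrable M (\<lambda>\<omega>. (norm (I s \<omega>))\<^sup>2) \<and>
      (\<forall>A\<in>events. \<forall>c. (\<forall>\<omega>\<in>A. \<forall>r\<in>{t..s}. c \<le> (norm (?J r (X r \<omega>)))\<^sup>2) \<longrightarrow>
         prob A * (s - t) * c / C\<^sub>\<sigma> \<le> expectation (\<lambda>\<omega>. (norm (I s \<omega>))\<^sup>2)) \<and>
      (AE \<omega> in M. drv \<omega> absolutely_integrable_on {t..s} \<and>
         u s (X s \<omega>) - u t x = I s \<omega> - integral {t..s} (drv \<omega>))" if s: "s \<in> {t..<T}" for s
  proof -
    have s': "t \<le> s" "s < T" using s by auto
    let ?L = "restrict_space lborel {t..s}"
    interpret L: finite_measure ?L by (rule finite_measure_interval)
    have mL: "measure ?L {t..s} = s - t"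
      using s' by (simp add: measure_restrict_space)
    have spL: "space ?L = {t..s}" by (simp add: space_restrict_space)
    note IXf = ito_sq_integrable[OF IX t(1) order_refl s' sK] ito_integrable[OF IX t(1) order_refl s' sK]
      ito_mean[OF IX t(1) order_refl s' sK] ito_energy_integrable[OF IX t(1) order_refl s' sK]
      ito_isometry[OF IX t(1) order_refl s' sK]
    note If = ito_sq_integrable[OF I t(1) order_refl s' ZK] ito_integrable[OF I t(1) order_refl s' ZK]
      ito_mean[OF I t(1) order_refl s' ZK] ito_energy_integrable[OF I t(1) order_refl s' ZK]
      ito_isometry[OF I t(1) order_refl s' ZK]
    have XIX: "AE \<omega> in M. X s \<omega> - x = IX s \<omega>"
      using AE_completion[OF X_eq] by eventually_elim (use s' in auto)
    have Xsm: "X s \<in> borel_measurable M" using Xm s by auto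
    have cm: "(\<lambda>y::real^'d. (y - x) $ j) \<in> borel_measurable borel" for j
      by (intro borel_measurable_continuous_onI continuous_intros)
    have IXm: "(\<lambda>\<omega>. IX s \<omega> $ j) \<in> borel_measurable M" "(\<lambda>\<omega>. (norm (IX s \<omega>))\<^sup>2) \<in> borel_measurable M" for j
      using IXf(2)[of j] IXf(1) by auto
    have Xcm: "(\<lambda>\<omega>. (X s \<omega> - x) $ j) \<in> borel_measurable M" for j
      by (rule measurable_compose[OF Xsm cm])
    have Xnm: "(\<lambda>\<omega>. (norm (X s \<omega> - x))\<^sup>2) \<in> borel_measurable M" using Xsm by measurable
    have 1: "integrable M (\<lambda>\<omega>. (X s \<omega> - x) $ j) \<and> expectation (\<lambda>\<omega>. (X s \<omega> - x) $ j) = 0" for j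
    proof -
      have ae: "AE \<omega> in M. (X s \<omega> - x) $ j = IX s \<omega> $ j" using XIX by eventually_elim simp
      show ?thesis
        using integrable_cong_AE[OF Xcm IXm(1) ae] integral_cong_AE[OF Xcm IXm(1) ae] IXf(2,3) by simp
    qed
    have ae2: "AE \<omega> in M. (norm (X s \<omega> - x))\<^sup>2 = (norm (IX s \<omega>))\<^sup>2" using XIX by eventually_elim simp
    have 2: "integrable M (\<lambda>\<omega>. (norm (X s \<omega> - x))\<^sup>2)"
      using integrable_cong_AE[OF Xnm IXm(2) ae2] IXf(1) by simp
    have 3: "expectation (\<lambda>\<omega>. (norm (X s \<omega> - x))\<^sup>2) \<le> real CARD('d) * C\<^sub>\<sigma> * (s - t)"
    proof -
      have "expectation (\<lambda>\<omega>. (norm (X s \<omega> - x))\<^sup>2) = expectation (\<lambda>\<omega>. (norm (IX s \<omega>))\<^sup>2)"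
        by (rule integral_cong_AE[OF Xnm IXm(2) ae2])
      also have "\<dots> = expectation (\<lambda>\<omega>. integral\<^sup>L ?L (\<lambda>v. (norm (\<sigma> v (X v \<omega>) (u v (X v \<omega>))))\<^sup>2))"
        by (rule IXf(5))
      also have "\<dots> \<le> expectation (\<lambda>\<omega>. real CARD('d) * C\<^sub>\<sigma> * (s - t))"
      proof (rule integral_mono[OF IXf(4)])
        fix \<omega> assume w: "\<omega> \<in> space M"
        have "(\<lambda>v. \<sigma> v (X v \<omega>) (u v (X v \<omega>))) \<in> borel_measurable ?L"
          by (rule ito_section_measurable[OF IX t(1) order_refl s' sK]) (use w in auto)
        then have [measurable]: "(\<lambda>v. (norm (\<sigma> v (X v \<omega>) (u v (X v \<omega>))))\<^sup>2) \<in> borel_measurable ?L" by measurable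
        have le: "(norm (\<sigma> v (X v \<omega>) (u v (X v \<omega>))))\<^sup>2 \<le> real CARD('d) * C\<^sub>\<sigma>" if "v \<in> {t..s}" for v
          by (rule sigma_norm_sq_le[OF sig]) (use that t s' in auto)
        have "integral\<^sup>L ?L (\<lambda>v. (norm (\<sigma> v (X v \<omega>) (u v (X v \<omega>))))\<^sup>2) \<le> integral\<^sup>L ?L (\<lambda>v. real CARD('d) * C\<^sub>\<sigma>)"
        proof (rule integral_mono)
          show "integrable ?L (\<lambda>v. (norm (\<sigma> v (X v \<omega>) (u v (X v \<omega>))))\<^sup>2)"
            by (rule L.integrable_const_bound[of _ "real CARD('d) * C\<^sub>\<sigma>"]) (use le in \<open>auto simp: spL intro!: AE_I2\<close>)
        qed (use le spL in auto)
        then show "integral\<^sup>L ?L (\<lambda>v. (norm (\<sigma> v (X v \<omega>) (u v (X v \<omega>))))\<^sup>2) \<le> real CARD('d) * C\<^sub>\<sigma> * (s - t)"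
          by (simp add: spL mL algebra_simps)
      qed (assumption+, rule integrable_const)
      also have "\<dots> = real CARD('d) * C\<^sub>\<sigma> * (s - t)" by (simp add: P.prob_space)
      finally show ?thesis .
    qed
    have 4: "prob A * (s - t) * c / C\<^sub>\<sigma> \<le> expectation (\<lambda>\<omega>. (norm (I s \<omega>))\<^sup>2)"
      if A: "A \<in> events" and c: "\<forall>\<omega>\<in>A. \<forall>r\<in>{t..s}. c \<le> (norm (?J r (X r \<omega>)))\<^sup>2" for A c
    proof -
      have "prob A * (s - t) * c / C\<^sub>\<sigma> = expectation (\<lambda>\<omega>. indicat_real A \<omega> * ((s - t) * c / C\<^sub>\<sigma>))"
        using A sets.sets_into_space[OF A] by (simp add: Int_absorb2)
      also have "\<dots> \<le> expectation (\<lambda>\<omega>. integral\<^sup>L ?L (\<lambda>v. (norm (Z v \<omega>))\<^sup>2))"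
      proof (rule integral_mono[OF _ If(4)])
        show "integrable M (\<lambda>\<omega>. indicat_real A \<omega> * ((s - t) * c / C\<^sub>\<sigma>))"
          using A by (intro integrable_mult_left integrable_real_indicator) (auto simp: emeasure_eq_measure)
        fix \<omega> assume w: "\<omega> \<in> space M"
        show "indicat_real A \<omega> * ((s - t) * c / C\<^sub>\<sigma>) \<le> integral\<^sup>L ?L (\<lambda>v. (norm (Z v \<omega>))\<^sup>2)"
        proof (cases "\<omega> \<in> A")
          case True
          have "(\<lambda>v. Z v \<omega>) \<in> borel_measurable ?L"
            by (rule ito_section_measurable[OF I t(1) order_refl s' ZK]) (use w in auto)
          then have [measurable]: "(\<lambda>v. (norm (Z v \<omega>))\<^sup>2) \<in> borel_measurable ?L" by measurable
          have "integral\<^sup>L ?L (\<lambda>v. c / C\<^sub>\<sigma>) \<le> integral\<^sup>L ?L (\<lambda>v. (norm (Z v \<omega>))\<^sup>2)"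
          proof (rule integral_mono)
            show "integrable ?L (\<lambda>v. (norm (Z v \<omega>))\<^sup>2)"
            proof (rule L.integrable_const_bound[of _ "KZ\<^sup>2"])
              show "AE v in ?L. norm ((norm (Z v \<omega>))\<^sup>2) \<le> KZ\<^sup>2"
                using ZK[of _ \<omega>] s' w by (intro AE_I2) (auto simp: spL intro!: power_mono)
            qed simp
            fix v assume v: "v \<in> space ?L"
            have "c / C\<^sub>\<sigma> \<le> (norm (?J v (X v \<omega>)))\<^sup>2 / C\<^sub>\<sigma>"
              using c True v C by (intro divide_right_mono) (auto simp: spL)
            also have "\<dots> \<le> (norm (Z v \<omega>))\<^sup>2"
              unfolding Z_def by (rule mat_act_lower[OF sig]) (use v s' t in \<open>auto simp: spL\<close>)
            finally show "c / C\<^sub>\<sigma> \<le> (norm (Z v \<omega>))\<^sup>2" .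
          qed simp
          then show ?thesis using True by (simp add: spL mL)
        next
          case False
          then show ?thesis by (simp add: Bochner_Integration.integral_nonneg)
        qed
      qed
      also have "\<dots> = expectation (\<lambda>\<omega>. (norm (I s \<omega>))\<^sup>2)" by (rule If(5)[symmetric])
      finally show ?thesis .
    qed
    have 5: "AE \<omega> in M. drv \<omega> absolutely_integrable_on {t..s} \<and> u s (X s \<omega>) - u t x = I s \<omega> - integral {t..s} (drv \<omega>)"
      using Y' I0 X0
    proof eventually_elim
      case (elim \<omega>)
      have ai: "drv \<omega> absolutely_integrable_on {t..T}" using elim by blast
      have i1: "drv \<omega> integrable_on {t..T}" using ai by (rule absolutely_integrable_on_def[THEN iffD1, THEN conjunct1])
      have "integral {t..s} (drv \<omega>) + integral {s..T} (drv \<omega>) = integral {t..T} (drv \<omega>)"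
        by (rule Henstock_Kurzweil_Integration.integral_combine) (use s' i1 in auto)
      then have i_eq: "integral {t..s} (drv \<omega>) = integral {t..T} (drv \<omega>) - integral {s..T} (drv \<omega>)"
        by (simp add: eq_diff_eq)
      have u_eq: "u s (X s \<omega>) = g (X T \<omega>) + integral {s..T} (drv \<omega>) - (I T \<omega> - I s \<omega>)"
        "u t (X t \<omega>) = g (X T \<omega>) + integral {t..T} (drv \<omega>) - (I T \<omega> - I t \<omega>)"
        using elim s' t by auto
      have "drv \<omega> absolutely_integrable_on {t..s}"
        by (rule absolutely_integrable_on_subinterval[OF ai]) (use s' in auto)
      moreover have "X t \<omega> = x" "I t \<omega> = 0" using elim by auto
      ultimately show ?case using u_eq unfolding i_eq by simp
    qed
    show ?thesis
      using 1 2 3 4 5 If(1-3) by blast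
  qed
  have "local_solution \<sigma> f u C\<^sub>\<sigma> t x X I"
    unfolding local_solution_def
    by (rule conjI, rule ballI, erule Xm, rule conjI, rule AE_completion[OF X(2)], rule conjI, rule X0,
        rule ballI, erule main[unfolded drv_def])
  then show ?thesis by blast
qed

text \<open>
  The equations started at time T are trivial and identify the terminal value at every point, which
  also shows that g is continuous.
\<close>

lemma decoupling_terminal:
  fixes u :: "real \<Rightarrow> real^'d \<Rightarrow> real^'n"
  assumes dec: "decoupling_solution P B T \<sigma> f g u" and T: "0 < T"
  shows "u T x = g x"
proof -
  have TT: "T \<in> {0..T}" using T by simp
  from dec TT obtain X where sde: "sde_solution P B T \<sigma> u T x X"
    and bsde: "bsde_holds P B T \<sigma> f g T X (\<lambda>s \<omega>. u s (X s \<omega>))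
      (\<lambda>s \<omega>. mat_act (\<sigma> s (X s \<omega>) (u s (X s \<omega>))) (jacobian (u s) (at (X s \<omega>))))"
    unfolding decoupling_solution_def Let_def by blast
  from sde obtain IX where
    IX: "ito_integral P B T T (\<lambda>s \<omega>. \<sigma> s (X s \<omega>) (u s (X s \<omega>))) IX"
    and X_eq: "AE \<omega> in P. \<forall>t'\<in>{T..T}. X t' \<omega> = x + IX t' \<omega>"
    unfolding sde_solution_def by blast
  from bsde have Y: "AE \<omega> in P. u T (X T \<omega>) = g (X T \<omega>)"
    unfolding bsde_holds_def Let_def by (auto elim!: eventually_mono)
  have "AE \<omega> in M. IX T \<omega> = 0" using ito_start[OF IX] T by simp
  with AE_completion[OF X_eq] AE_completion[OF Y] have "AE \<omega> in M. u T x = g x"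
    by eventually_elim auto
  then show ?thesis by (simp add: AE_const)
qed

end

section \<open>Short-time estimates along the solution\<close>

lemma norm_matrix_vector_mult_le: "norm ((p :: real^'d^'n) *v z) \<le> norm p * norm z"
proof (rule power2_le_imp_le)
  have "(norm (p *v z))\<^sup>2 = (\<Sum>i\<in>UNIV. (p $ i \<bullet> z)\<^sup>2)"
    unfolding norm_sq_vec[of "p *v z"] by (simp add: matrix_vector_mul_component)
  also have "\<dots> \<le> (\<Sum>i\<in>UNIV. (norm (p $ i))\<^sup>2 * (norm z)\<^sup>2)"
    by (rule sum_mono) (simp add: Cauchy_Schwarz_ineq power2_norm_eq_inner)
  also have "\<dots> = (norm p * norm z)\<^sup>2"
    unfolding power_mult_distrib norm_sq_vec[of p] by (simp add: sum_distrib_right)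
  finally show "(norm (p *v z))\<^sup>2 \<le> (norm p * norm z)\<^sup>2" .
qed simp

lemma norm_vector_matrix_mult_le: "norm (a v* (p :: real^'d^'n)) \<le> norm a * norm p"
proof (cases "a v* p = 0")
  case False
  have "(norm (a v* p))\<^sup>2 = a \<bullet> (p *v (a v* p))"
    unfolding power2_norm_eq_inner by (rule dot_lmul_matrix)
  also have "\<dots> \<le> norm a * norm (p *v (a v* p))" by (rule norm_cauchy_schwarz)
  also have "\<dots> \<le> norm a * (norm p * norm (a v* p))"
    by (intro mult_left_mono norm_matrix_vector_mult_le) simp
  finally have "norm (a v* p) * norm (a v* p) \<le> (norm a * norm p) * norm (a v* p)"
    by (simp add: power2_eq_square)
  then show ?thesis using False by simp
qed simp

text \<open>
  Used to carry the smallness of the gradient of \<open>a \<bullet> u\<close> from the contact point to nearby points.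
\<close>

lemma norm_vector_matrix_mult_near:
  fixes p p' :: "real^'d^'n"
  shows "norm (a v* p) \<le> norm (a v* p') + norm a * norm (p - p')"
proof -
  have "a v* p = a v* p' + a v* (p - p')"
    by (simp add: vector_matrix_mult_def vec_eq_iff sum.distrib[symmetric] algebra_simps)
  then have "norm (a v* p) \<le> norm (a v* p') + norm (a v* (p - p'))"
    by (metis norm_triangle_ineq)
  also have "\<dots> \<le> norm (a v* p') + norm a * norm (p - p')"
    using norm_vector_matrix_mult_le[of a "p - p'"] by simp
  finally show ?thesis .
qed

lemma inner_f_decomposition:
  fixes f :: "real \<Rightarrow> real^'d \<Rightarrow> real^'n \<Rightarrow> real^'d^'n \<Rightarrow> real^'n"
  assumes "f_decomposition T f b\<^sub>0 b" "t \<in> {0..T}"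
  shows "a \<bullet> f t x y p = (a v* p) \<bullet> b\<^sub>0 t x y p + a \<bullet> b t x y p"
proof -
  have "f t x y p = p *v b\<^sub>0 t x y p + b t x y p"
    using assms by (simp add: f_decomposition_def vec_eq_iff matrix_vector_mul_component)
  then show ?thesis by (simp add: inner_add_right dot_lmul_matrix)
qed

lemma continuous_near:
  fixes h :: "real \<Rightarrow> 'a::metric_space \<Rightarrow> 'b::metric_space"
  assumes cont: "continuous_on ({0..<T} \<times> UNIV) (\<lambda>(t, x). h t x)" and t: "0 \<le> t" "t < T" and e: "0 < e"
  shows "\<exists>\<rho>>0. \<forall>r y. t \<le> r \<longrightarrow> r < T \<longrightarrow> r \<le> t + \<rho> \<longrightarrow> dist y x \<le> \<rho> \<longrightarrow> dist (h r y) (h t x) < e"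
proof -
  have "(t, x) \<in> {0..<T} \<times> UNIV" using t by simp
  with cont e obtain \<delta> where \<delta>: "0 < \<delta>"
    "\<And>z. z \<in> {0..<T} \<times> UNIV \<Longrightarrow> dist z (t, x) < \<delta> \<Longrightarrow> dist ((\<lambda>(t, x). h t x) z) (h t x) < e"
    unfolding continuous_on_iff by fastforce
  show ?thesis
  proof (intro exI[of _ "\<delta> / 3"] conjI allI impI)
    fix r y assume r: "t \<le> r" "r < T" "r \<le> t + \<delta> / 3" "dist y x \<le> \<delta> / 3"
    have "dist (r, y) (t, x) \<le> dist r t + dist y x"
      unfolding dist_Pair_Pair by (rule sqrt_sum_squares_le_sum) auto
    also have "\<dots> < \<delta>" using r \<delta>(1) by (simp add: dist_real_def)
    finally show "dist (h r y) (h t x) < e" using \<delta>(2)[of "(r, y)"] r t by simp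
  qed (use \<delta> in simp)
qed

context brownian
begin

lemma local_solution_integrable_u:
  fixes u :: "real \<Rightarrow> real^'d \<Rightarrow> real^'n" and \<phi> :: "real^'n \<Rightarrow> real"
  assumes ls: "local_solution \<sigma> f u C t x X I" and s: "0 \<le> t" "t \<le> s" "s \<le> T"
    and N: "\<And>s y. s \<in> {0..T} \<Longrightarrow> norm (u s y) \<le> N"
    and cont: "continuous_on ({0..T} \<times> UNIV) (\<lambda>(t, x). u t x)"
    and \<phi>: "continuous_on UNIV \<phi>"
  shows "integrable M (\<lambda>\<omega>. \<phi> (u s (X s \<omega>)))"
proof -
  have Xs: "X s \<in> borel_measurable M" using ls s by (auto simp: local_solution_def)
  have "continuous_on UNIV (\<lambda>y. (\<lambda>(t, x). u t x) (s, y))"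
    by (rule continuous_on_compose2[OF cont]) (use s in \<open>auto intro!: continuous_intros\<close>)
  then have "continuous_on UNIV (\<lambda>y. \<phi> (u s y))"
    by (intro continuous_on_compose2[OF \<phi>]) auto
  then have m: "(\<lambda>\<omega>. \<phi> (u s (X s \<omega>))) \<in> borel_measurable M"
    by (intro measurable_compose[OF Xs] borel_measurable_continuous_onI)
  have "compact (\<phi> ` cball 0 N)" by (intro compact_continuous_image continuous_on_subset[OF \<phi>]) auto
  then have "bounded (\<phi> ` cball 0 N)" by (rule compact_imp_bounded)
  moreover have "(\<lambda>\<omega>. \<phi> (u s (X s \<omega>))) ` space P \<subseteq> \<phi> ` cball 0 N" using N[of s] s by auto
  ultimately have "bounded ((\<lambda>\<omega>. \<phi> (u s (X s \<omega>))) ` space P)" by (rule bounded_subset)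
  then show ?thesis by (rule integrable_bounded_M[OF m])
qed

lemma expectation_inner:
  fixes V :: "'w \<Rightarrow> real^'e"
  assumes "\<And>j. integrable M (\<lambda>\<omega>. V \<omega> $ j)" "\<And>j. expectation (\<lambda>\<omega>. V \<omega> $ j) = 0"
  shows "integrable M (\<lambda>\<omega>. w \<bullet> V \<omega>)" "expectation (\<lambda>\<omega>. w \<bullet> V \<omega>) = 0"
  unfolding inner_vec_def using assms by auto

lemma expectation_contact_le:
  assumes ls: "local_solution \<sigma> f u C t x X I" and s: "t \<le> s" "s < T" and \<epsilon>: "0 \<le> \<epsilon>"
    and \<phi>: "integrable M \<phi>"
    and le: "\<And>\<omega>. \<omega> \<in> space P \<Longrightarrow> \<phi> \<omega> \<le> k + \<epsilon> * (w \<bullet> (X s \<omega> - x) + (norm (X s \<omega> - x))\<^sup>2 / 2)"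
  shows "expectation \<phi> \<le> k + \<epsilon> * (real CARD('d) * C * (s - t)) / 2"
proof -
  have sT: "s \<in> {t..<T}" using s by simp
  have Xi: "integrable M (\<lambda>\<omega>. (X s \<omega> - x) $ j)" "expectation (\<lambda>\<omega>. (X s \<omega> - x) $ j) = 0" for j
    using ls sT unfolding local_solution_def by blast+
  have X2: "integrable M (\<lambda>\<omega>. (norm (X s \<omega> - x))\<^sup>2)"
    "expectation (\<lambda>\<omega>. (norm (X s \<omega> - x))\<^sup>2) \<le> real CARD('d) * C * (s - t)"
    using ls sT unfolding local_solution_def by blast+
  note wi = expectation_inner[of "\<lambda>\<omega>. X s \<omega> - x", OF Xi, of w]
  have "expectation \<phi> \<le> expectation (\<lambda>\<omega>. k + \<epsilon> * (w \<bullet> (X s \<omega> - x) + (norm (X s \<omega> - x))\<^sup>2 / 2))"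
    by (rule integral_mono[OF \<phi>]) (use wi X2 le in auto)
  also have "\<dots> = k + \<epsilon> * (expectation (\<lambda>\<omega>. (norm (X s \<omega> - x))\<^sup>2) / 2)"
    using wi X2(1) by (simp add: P.prob_space)
  also have "\<dots> \<le> k + \<epsilon> * ((real CARD('d) * C * (s - t)) / 2)"
    using X2(2) \<epsilon> by (intro add_left_mono mult_left_mono divide_right_mono) auto
  finally show ?thesis by simp
qed

lemma local_solution_path:
  assumes ls: "local_solution \<sigma> f u C t x X I" and t: "t < T" and \<rho>: "0 < \<rho>" "0 < \<pi>"
  shows "\<exists>h>0. t + h < T \<and> (\<exists>A\<in>events. 1 - \<pi> < prob A \<and> (\<forall>\<omega>\<in>A. \<forall>r\<in>{t..t + h}. norm (X r \<omega> - x) \<le> \<rho>))"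
  by (rule path_stays_close[OF t _ _ _ \<rho>]) (use ls in \<open>auto simp: local_solution_def\<close>)

text \<open>
  Up to errors of smaller order, \<open>a \<bullet> u\<close> decreases in mean along X at rate at most \<open>\<beta>\<close>, the bound on
  \<open>a \<bullet> f\<close> near (t, x). The bound G, valid everywhere but possibly much larger, is only felt on the unlikely event that X
  leaves the neighbourhood; choosing h small makes the product of G and its probability smaller than \<open>\<eta>\<close>.
\<close>

lemma drift_estimate:
  fixes u :: "real \<Rightarrow> real^'d \<Rightarrow> real^'n"
  assumes ls: "local_solution \<sigma> f u C t x X I" and t: "0 \<le> t" "t < T"
    and N: "\<And>s y. s \<in> {0..T} \<Longrightarrow> norm (u s y) \<le> N"
    and cont: "continuous_on ({0..T} \<times> UNIV) (\<lambda>(t, x). u t x)"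
    and G: "\<And>r y. t \<le> r \<Longrightarrow> r < T \<Longrightarrow> a \<bullet> f r y (u r y) (jacobian (u r) (at y)) \<le> G"
    and \<rho>: "0 < \<rho>"
    and near: "\<And>r y. t \<le> r \<Longrightarrow> r < T \<Longrightarrow> r \<le> t + \<rho> \<Longrightarrow> norm (y - x) \<le> \<rho> \<Longrightarrow>
      a \<bullet> f r y (u r y) (jacobian (u r) (at y)) \<le> \<beta>"
    and \<eta>: "0 < \<eta>"
  shows "\<exists>h0>0. t + h0 < T \<and> (\<forall>h. 0 < h \<and> h \<le> h0 \<longrightarrow>
    a \<bullet> u t x - h * (\<beta> + \<eta>) \<le> expectation (\<lambda>\<omega>. a \<bullet> u (t + h) (X (t + h) \<omega>)))"
proof -
  define G' where "G' = max G \<beta>"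
  have G': "\<beta> \<le> G'" "G \<le> G'" by (auto simp: G'_def)
  \<comment> \<open>admissible probability of leaving the neighbourhood\<close>
  define \<pi> where "\<pi> = \<eta> / (G' - \<beta> + 1)"
  have \<pi>: "0 < \<pi>" using \<eta> G' by (simp add: \<pi>_def)
  have G\<pi>: "(G' - \<beta>) * \<pi> \<le> \<eta>" using \<eta> G' by (simp add: \<pi>_def divide_le_eq algebra_simps)
  obtain h1 A where h1: "0 < h1" "t + h1 < T" and A: "A \<in> events" "1 - \<pi> < prob A"
    and close: "\<And>\<omega> r. \<omega> \<in> A \<Longrightarrow> r \<in> {t..t + h1} \<Longrightarrow> norm (X r \<omega> - x) \<le> \<rho>"
    using local_solution_path[OF ls t(2) \<rho> \<pi>] by blast
  define h0 where "h0 = min h1 \<rho>"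
  show ?thesis
  proof (intro exI[of _ h0] conjI allI impI)
    show "0 < h0" "t + h0 < T" using h1 \<rho> by (auto simp: h0_def)
    fix h assume h: "0 < h \<and> h \<le> h0"
    define s where "s = t + h"
    have s: "t \<le> s" "s < T" "s \<le> t + h1" "s \<le> t + \<rho>" "s - t = h" using h h1 by (auto simp: s_def h0_def)
    have sT: "s \<in> {t..<T}" using s by simp
    let ?drv = "\<lambda>\<omega> r. f r (X r \<omega>) (u r (X r \<omega>)) (jacobian (u r) (at (X r \<omega>)))"
    have Ii: "integrable M (\<lambda>\<omega>. I s \<omega> $ i)" "expectation (\<lambda>\<omega>. I s \<omega> $ i) = 0" for i
      using ls sT unfolding local_solution_def by blast+
    have eq: "AE \<omega> in M. ?drv \<omega> absolutely_integrable_on {t..s} \<and> u s (X s \<omega>) - u t x = I s \<omega> - integral {t..s} (?drv \<omega>)"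
      using ls sT unfolding local_solution_def by blast
    note aI = expectation_inner[of "I s", OF Ii, of a]
    define lo where "lo = (\<lambda>\<omega>. a \<bullet> u t x + a \<bullet> I s \<omega> - h * G' + h * (G' - \<beta>) * indicat_real A \<omega>)"
    have iA: "integrable M (indicat_real A)" using A by (simp add: integrable_real_indicator emeasure_eq_measure)
    have lo_i: "integrable M lo"
      unfolding lo_def using aI(1) iA by auto
    have "a \<bullet> u t x - h * (\<beta> + \<eta>) \<le> a \<bullet> u t x - h * G' + h * (G' - \<beta>) * prob A"
    proof -
      have "(G' - \<beta>) * (1 - prob A) \<le> (G' - \<beta>) * \<pi>" using A G' by (intro mult_left_mono) auto
      then have "(G' - \<beta>) * (1 - prob A) \<le> \<eta>" using G\<pi> by simp
      then have "h * ((G' - \<beta>) * (1 - prob A)) \<le> h * \<eta>" using h by (intro mult_left_mono) auto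
      then show ?thesis by (simp add: algebra_simps)
    qed
    also have "\<dots> = expectation lo"
      unfolding lo_def using aI iA A(1) sets.sets_into_space[OF A(1)] by (simp add: P.prob_space Int_absorb2)
    also have "\<dots> \<le> expectation (\<lambda>\<omega>. a \<bullet> u s (X s \<omega>))"
    proof (rule integral_mono_AE[OF lo_i])
      show "integrable M (\<lambda>\<omega>. a \<bullet> u s (X s \<omega>))"
        by (rule local_solution_integrable_u[OF ls t(1) s(1) _ N cont]) (use s in \<open>auto intro!: continuous_intros\<close>)
      show "AE \<omega> in M. lo \<omega> \<le> a \<bullet> u s (X s \<omega>)"
        using eq
      proof eventually_elim
        case (elim \<omega>)
        have int: "?drv \<omega> integrable_on {t..s}" using elim absolutely_integrable_on_def by blast
        have a_int: "(\<lambda>r. a \<bullet> ?drv \<omega> r) integrable_on {t..s}"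
          using integrable_linear[OF int bounded_linear_inner_right[of a]] by (simp add: o_def)
        have a_eq: "a \<bullet> integral {t..s} (?drv \<omega>) = integral {t..s} (\<lambda>r. a \<bullet> ?drv \<omega> r)"
          using integral_linear[OF int bounded_linear_inner_right[of a]] by (simp add: o_def)
        define B' where "B' = (if \<omega> \<in> A then \<beta> else G')"
        have "integral {t..s} (\<lambda>r. a \<bullet> ?drv \<omega> r) \<le> integral {t..s} (\<lambda>r. B')"
        proof (rule integral_le[OF a_int])
          fix r assume r: "r \<in> {t..s}"
          show "a \<bullet> ?drv \<omega> r \<le> B'"
          proof (cases "\<omega> \<in> A")
            case True
            then show ?thesis using near[of r "X r \<omega>"] close[OF True, of r] r s by (simp add: B'_def)
          next
            case False
            then show ?thesis using G[of r "X r \<omega>"] r s G' by (simp add: B'_def)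
          qed
        qed auto
        also have "\<dots> = h * B'" using s by simp
        finally have "a \<bullet> integral {t..s} (?drv \<omega>) \<le> h * B'" by (simp add: a_eq)
        moreover have "a \<bullet> u s (X s \<omega>) - a \<bullet> u t x = a \<bullet> I s \<omega> - a \<bullet> integral {t..s} (?drv \<omega>)"
          using elim by (simp flip: inner_diff_right)
        moreover have "lo \<omega> = a \<bullet> u t x + a \<bullet> I s \<omega> - h * B'"
          by (simp add: lo_def B'_def algebra_simps)
        ultimately show ?case by linarith
      qed
    qed
    finally show "a \<bullet> u t x - h * (\<beta> + \<eta>) \<le> expectation (\<lambda>\<omega>. a \<bullet> u (t + h) (X (t + h) \<omega>))"
      by (simp add: s_def)
  qed
qed

text \<open>
  The increment of \<open>u(s, X s)\<close> is a martingale increment, of size \<open>sqrt h\<close>, plus a drift of size h. By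
  the isometry the martingale part has second moment at least about \<open>h |Du|\<^sup>2 / C\<close>; half of this survives the
  crude splitting \<open>|I|\<^sup>2 \<le> 2 |I - D|\<^sup>2 + 2 |D|\<^sup>2\<close> by which the drift part D is removed.
\<close>

lemma energy_estimate:
  fixes u :: "real \<Rightarrow> real^'d \<Rightarrow> real^'n"
  assumes ls: "local_solution \<sigma> f u C t x X I" and t: "0 \<le> t" "t < T" and C: "0 < C"
    and N: "\<And>s y. s \<in> {0..T} \<Longrightarrow> norm (u s y) \<le> N"
    and cont: "continuous_on ({0..T} \<times> UNIV) (\<lambda>(t, x). u t x)"
    and contJ: "continuous_on ({0..<T} \<times> UNIV) (\<lambda>(t, x). jacobian (u t) (at x))"
    and G: "\<And>r y. t \<le> r \<Longrightarrow> r < T \<Longrightarrow> norm (f r y (u r y) (jacobian (u r) (at y))) \<le> G"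
    and \<eta>: "0 < \<eta>"
  shows "\<exists>h0>0. t + h0 < T \<and> (\<forall>h. 0 < h \<and> h \<le> h0 \<longrightarrow>
    h * ((norm (jacobian (u t) (at x)))\<^sup>2 / (2 * C) - \<eta>) \<le> expectation (\<lambda>\<omega>. (norm (u (t + h) (X (t + h) \<omega>) - u t x))\<^sup>2))"
proof -
  let ?J = "\<lambda>r y. jacobian (u r) (at y)"
  define \<kappa> where "\<kappa> = (norm (?J t x))\<^sup>2"
  have \<kappa>0: "0 \<le> \<kappa>" by (simp add: \<kappa>_def)
  have G0: "0 \<le> G" using G[of t x] t by (auto intro: order_trans[OF norm_ge_zero])
  have "continuous_on ({0..<T} \<times> UNIV) (\<lambda>(t, x). (norm (?J t x))\<^sup>2)"
    using continuous_on_power[OF continuous_on_norm[OF contJ], of 2] by (simp add: case_prod_beta)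
  from continuous_near[OF this t, of "\<eta> * C / 2" x] \<eta> C
  obtain \<rho> where \<rho>: "0 < \<rho>" "\<And>r y. t \<le> r \<Longrightarrow> r < T \<Longrightarrow> r \<le> t + \<rho> \<Longrightarrow> dist y x \<le> \<rho> \<Longrightarrow>
      dist ((norm (?J r y))\<^sup>2) \<kappa> < \<eta> * C / 2"
    unfolding \<kappa>_def by auto
  \<comment> \<open>the exceptional event and the variation \<open>\<eta> * C / 2\<close> of the gradient together cost half of \<open>\<eta>\<close>, the drift the other half\<close>
  define \<pi> where "\<pi> = \<eta> * C / (2 * (\<kappa> + 1))"
  have \<pi>: "0 < \<pi>" using \<eta> C \<kappa>0 by (simp add: \<pi>_def)
  have \<kappa>\<pi>: "\<kappa> * \<pi> \<le> \<eta> * C / 2"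
  proof -
    have "\<kappa> * \<pi> = \<eta> * C / 2 * (\<kappa> / (\<kappa> + 1))" using \<kappa>0 by (simp add: \<pi>_def field_simps)
    also have "\<dots> \<le> \<eta> * C / 2 * 1" using \<kappa>0 \<eta> C by (intro mult_left_mono) auto
    finally show ?thesis by simp
  qed
  obtain h1 A where h1: "0 < h1" "t + h1 < T" and A: "A \<in> events" "1 - \<pi> < prob A"
    and close: "\<And>\<omega> r. \<omega> \<in> A \<Longrightarrow> r \<in> {t..t + h1} \<Longrightarrow> norm (X r \<omega> - x) \<le> \<rho>"
    using local_solution_path[OF ls t(2) \<rho>(1) \<pi>] by blast
  define h2 where "h2 = \<eta> / (2 * (G\<^sup>2 + 1))"
  have h2: "0 < h2" using \<eta> by (simp add: h2_def add_nonneg_pos)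
  define h0 where "h0 = min (min h1 \<rho>) h2"
  show ?thesis
  proof (intro exI[of _ h0] conjI allI impI)
    show "0 < h0" "t + h0 < T" using h1 \<rho> h2 by (auto simp: h0_def)
    fix h assume h: "0 < h \<and> h \<le> h0"
    define s where "s = t + h"
    have s: "t \<le> s" "s < T" "s \<le> t + h1" "s \<le> t + \<rho>" "s - t = h" using h h1 by (auto simp: s_def h0_def)
    have sT: "s \<in> {t..<T}" using s by simp
    let ?drv = "\<lambda>\<omega> r. f r (X r \<omega>) (u r (X r \<omega>)) (?J r (X r \<omega>))"
    have I2: "integrable M (\<lambda>\<omega>. (norm (I s \<omega>))\<^sup>2)"
      using ls sT unfolding local_solution_def by blast
    have eq: "AE \<omega> in M. ?drv \<omega> absolutely_integrable_on {t..s} \<and> u s (X s \<omega>) - u t x = I s \<omega> - integral {t..s} (?drv \<omega>)"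
      using ls sT unfolding local_solution_def by blast
    have lower: "\<And>A c. A \<in> events \<Longrightarrow> (\<forall>\<omega>\<in>A. \<forall>r\<in>{t..s}. c \<le> (norm (?J r (X r \<omega>)))\<^sup>2) \<Longrightarrow>
         prob A * (s - t) * c / C \<le> expectation (\<lambda>\<omega>. (norm (I s \<omega>))\<^sup>2)"
      using ls sT unfolding local_solution_def by blast
    define c where "c = max 0 (\<kappa> - \<eta> * C / 2)"
    have c: "0 \<le> c" "\<kappa> - \<eta> * C / 2 \<le> c" "c \<le> \<kappa>" using \<kappa>0 \<eta> C by (auto simp: c_def)
    have "c \<le> (norm (?J r (X r \<omega>)))\<^sup>2" if w: "\<omega> \<in> A" and r: "r \<in> {t..s}" for \<omega> r
    proof -
      have "dist ((norm (?J r (X r \<omega>)))\<^sup>2) \<kappa> < \<eta> * C / 2"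
        by (rule \<rho>(2)) (use close[OF w, of r] r s in \<open>auto simp: dist_norm\<close>)
      then have "\<kappa> - \<eta> * C / 2 \<le> (norm (?J r (X r \<omega>)))\<^sup>2" unfolding dist_real_def by linarith
      then show ?thesis by (simp add: c_def)
    qed
    then have EI: "prob A * h * c / C \<le> expectation (\<lambda>\<omega>. (norm (I s \<omega>))\<^sup>2)"
      using lower[OF A(1), of c] s(5) by blast
    have EI': "h * (\<kappa> - \<eta> * C) / C \<le> expectation (\<lambda>\<omega>. (norm (I s \<omega>))\<^sup>2)"
    proof -
      have "c * (1 - prob A) \<le> \<kappa> * \<pi>" using c A \<kappa>0 by (intro mult_mono) auto
      then have "\<kappa> - \<eta> * C \<le> prob A * c" using c \<kappa>\<pi> by (simp add: algebra_simps)
      then have "h * (\<kappa> - \<eta> * C) / C \<le> h * (prob A * c) / C"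
        using h C by (intro divide_right_mono mult_left_mono) auto
      then show ?thesis using EI by (simp add: algebra_simps)
    qed
    have "continuous_on UNIV (\<lambda>v. (norm (v - u t x))\<^sup>2)" by (intro continuous_intros)
    from local_solution_integrable_u[OF ls t(1) s(1) _ N cont this]
    have Yi: "integrable M (\<lambda>\<omega>. (norm (u s (X s \<omega>) - u t x))\<^sup>2)" using s by simp
    have "expectation (\<lambda>\<omega>. (norm (I s \<omega>))\<^sup>2)
        \<le> expectation (\<lambda>\<omega>. 2 * (norm (u s (X s \<omega>) - u t x))\<^sup>2 + 2 * (G * h)\<^sup>2)"
    proof (rule integral_mono_AE[OF I2])
      show "integrable M (\<lambda>\<omega>. 2 * (norm (u s (X s \<omega>) - u t x))\<^sup>2 + 2 * (G * h)\<^sup>2)" using Yi by simp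
      show "AE \<omega> in M. (norm (I s \<omega>))\<^sup>2 \<le> 2 * (norm (u s (X s \<omega>) - u t x))\<^sup>2 + 2 * (G * h)\<^sup>2"
        using eq
      proof eventually_elim
        case (elim \<omega>)
        have int: "?drv \<omega> integrable_on {t..s}" using elim absolutely_integrable_on_def by blast
        have "norm (integral {t..s} (?drv \<omega>)) \<le> integral {t..s} (\<lambda>r. G)"
        proof (rule integral_norm_bound_integral[OF int])
          fix r assume "r \<in> {t..s}"
          then show "norm (?drv \<omega> r) \<le> G" using G[of r "X r \<omega>"] s by auto
        qed auto
        then have "norm (integral {t..s} (?drv \<omega>)) \<le> G * (s - t)" using s by (simp add: mult.commute)
        then have "(norm (integral {t..s} (?drv \<omega>)))\<^sup>2 \<le> (G * h)\<^sup>2" using s by (intro power_mono) auto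
        moreover have "I s \<omega> - integral {t..s} (?drv \<omega>) = u s (X s \<omega>) - u t x" using elim by simp
        ultimately show ?case
          using norm_diff_sq_le[of "I s \<omega>" 0 "integral {t..s} (?drv \<omega>)"] by simp
      qed
    qed
    also have "\<dots> = 2 * expectation (\<lambda>\<omega>. (norm (u s (X s \<omega>) - u t x))\<^sup>2) + 2 * (G * h)\<^sup>2"
      using Yi by (simp add: P.prob_space)
    finally have "h * (\<kappa> - \<eta> * C) / C \<le> 2 * expectation (\<lambda>\<omega>. (norm (u s (X s \<omega>) - u t x))\<^sup>2) + 2 * (G * h)\<^sup>2"
      using EI' by simp
    moreover have "2 * (G * h)\<^sup>2 \<le> h * \<eta>"
    proof -
      have "2 * (G\<^sup>2 + 1) * h \<le> 2 * (G\<^sup>2 + 1) * h2" using h by (intro mult_left_mono) (auto simp: h0_def)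
      also have "\<dots> = \<eta>" using add_nonneg_pos[of "G\<^sup>2" 1] by (simp add: h2_def)
      finally have "2 * G\<^sup>2 * h \<le> \<eta>" using h by (simp add: algebra_simps)
      then have "h * (2 * G\<^sup>2 * h) \<le> h * \<eta>" using h by (intro mult_left_mono) auto
      then show ?thesis by (simp add: power2_eq_square algebra_simps)
    qed
    moreover have "h * (\<kappa> - \<eta> * C) / C = 2 * (h * (\<kappa> / (2 * C))) - h * \<eta>" using C by (simp add: field_simps)
    ultimately show "h * ((norm (?J t x))\<^sup>2 / (2 * C) - \<eta>) \<le> expectation (\<lambda>\<omega>. (norm (u (t + h) (X (t + h) \<omega>) - u t x))\<^sup>2)"
      unfolding \<kappa>_def[symmetric] s_def[symmetric] by (simp add: algebra_simps)
  qed
qed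

end

section \<open>Bounds under the two growth conditions\<close>

context brownian
begin

lemma decoupling_bounds:
  fixes u :: "real \<Rightarrow> real^'d \<Rightarrow> real^'n"
  assumes dec: "decoupling_solution P B T \<sigma> f g u"
  obtains N K where "\<And>s y. s \<in> {0..T} \<Longrightarrow> norm (u s y) \<le> N"
    "\<And>s y. 0 \<le> s \<Longrightarrow> s < T \<Longrightarrow> norm (jacobian (u s) (at y)) \<le> K"
proof -
  have b: "bounded ((\<lambda>(t, x). u t x) ` ({0..T} \<times> UNIV))"
    "bounded ((\<lambda>(t, x). jacobian (u t) (at x)) ` ({0..<T} \<times> UNIV))"
    using dec by (auto simp: decoupling_solution_def)
  from b(1) obtain N where "\<And>s y. s \<in> {0..T} \<Longrightarrow> norm (u s y) \<le> N"
    unfolding bounded_iff by force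
  moreover from b(2) obtain K where "\<And>s y. 0 \<le> s \<Longrightarrow> s < T \<Longrightarrow> norm (jacobian (u s) (at y)) \<le> K"
    unfolding bounded_iff by force
  ultimately show thesis by (rule that)
qed

lemma decoupling_derivative:
  fixes u :: "real \<Rightarrow> real^'d \<Rightarrow> real^'n"
  assumes dec: "decoupling_solution P B T \<sigma> f g u" and t: "0 \<le> t" "t < T"
  shows "(u t has_derivative (\<lambda>z. jacobian (u t) (at x) *v z)) (at x)"
  using dec t unfolding decoupling_solution_def by (simp add: jacobian_works)

text \<open>
  The bound depends on u and on \<open>\<kappa>\<close>. It is used to choose the coefficient of the penalty, which
  tends to 0 in the end.
\<close>

lemma first_order_coefficient_bounded:
  fixes u :: "real \<Rightarrow> real^'d \<Rightarrow> real^'n"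
  assumes dec: "decoupling_solution P B T \<sigma> f g u" and T: "0 < T" and \<kappa>: "increasing_nonneg \<kappa>" and m: "0 < m"
    and b0: "\<And>t x y p. t \<in> {0..T} \<Longrightarrow> norm (b\<^sub>0 t x y p) \<le> m * (1 + \<kappa> (norm y + norm p))"
  shows "\<exists>Kb\<ge>0. \<forall>r y. 0 \<le> r \<longrightarrow> r < T \<longrightarrow> norm (b\<^sub>0 r y (u r y) (jacobian (u r) (at y))) \<le> Kb"
proof -
  let ?J = "\<lambda>r y. jacobian (u r) (at y)"
  obtain N K where N: "\<And>s y. s \<in> {0..T} \<Longrightarrow> norm (u s y) \<le> N"
    and K: "\<And>s y. 0 \<le> s \<Longrightarrow> s < T \<Longrightarrow> norm (?J s y) \<le> K"
    using decoupling_bounds[OF dec] by blast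
  have N0: "0 \<le> N" using N[of 0 0] T by (auto intro: order_trans[OF norm_ge_zero])
  have K0: "0 \<le> K" using K[of 0 0] T by (auto intro: order_trans[OF norm_ge_zero])
  show ?thesis
  proof (intro exI[of _ "m * (1 + \<kappa> (N + K))"] conjI allI impI)
    show "0 \<le> m * (1 + \<kappa> (N + K))" using m \<kappa> N0 K0 by (auto simp: increasing_nonneg_def)
    fix r y assume r: "0 \<le> r" "r < T"
    have "norm (u r y) + norm (?J r y) \<le> N + K" using N[of r y] K[of r y] r by simp
    then have "\<kappa> (norm (u r y) + norm (?J r y)) \<le> \<kappa> (N + K)"
      using \<kappa> N0 K0 unfolding increasing_nonneg_def
      by (intro mono_onD[where f=\<kappa> and A="{0..}"]) simp_all
    then have "m * (1 + \<kappa> (norm (u r y) + norm (?J r y))) \<le> m * (1 + \<kappa> (N + K))" using m by (intro mult_left_mono) auto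
    then show "norm (b\<^sub>0 r y (u r y) (?J r y)) \<le> m * (1 + \<kappa> (N + K))" using b0[of r y "u r y" "?J r y"] r by simp
  qed
qed

text \<open>
  Here \<open>\<Psi> = a \<bullet> u + (m + 1) t\<close>. At a contact point \<open>|a v* Du| \<le> \<epsilon>\<close>, so near it \<open>a \<bullet> f\<close> exceeds m by
  a multiple of \<open>\<epsilon>\<close> only, whereas the contact inequality and the drift estimate together force an excess
  that stays away from 0.
\<close>

lemma AB1_direction_bound:
  fixes u :: "real \<Rightarrow> real^'d \<Rightarrow> real^'n"
  assumes dec: "decoupling_solution P B T \<sigma> f g u" and sig: "sigma_condition T \<sigma> L\<^sub>\<sigma> C\<^sub>\<sigma>"
    and T: "0 < T" and AB1: "AB1 T f D m" and a: "a \<in> D" and top: "\<And>x. a \<bullet> g x \<le> k"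
    and t0: "t0 \<in> {0..T}"
  shows "a \<bullet> u t0 x0 \<le> k + (m + 1) * T"
proof -
  let ?J = "\<lambda>r y. jacobian (u r) (at y)"
  have C: "0 < C\<^sub>\<sigma>" using sig by (simp add: sigma_condition_def)
  obtain N K where N: "\<And>s y. s \<in> {0..T} \<Longrightarrow> norm (u s y) \<le> N"
    and K: "\<And>s y. 0 \<le> s \<Longrightarrow> s < T \<Longrightarrow> norm (?J s y) \<le> K"
    using decoupling_bounds[OF dec] by blast
  have cont: "continuous_on ({0..T} \<times> UNIV) (\<lambda>(t, x). u t x)"
    and contJ: "continuous_on ({0..<T} \<times> UNIV) (\<lambda>(t, x). ?J t x)"
    using dec by (auto simp: decoupling_solution_def)
  from AB1 obtain \<kappa> b\<^sub>0 b where m: "0 < m" and \<kappa>: "increasing_nonneg \<kappa>" and fd: "f_decomposition T f b\<^sub>0 b"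
    and b0: "\<And>t x y p. t \<in> {0..T} \<Longrightarrow> norm (b\<^sub>0 t x y p) \<le> m * (1 + \<kappa> (norm y + norm p))"
    and b: "\<And>t x y p. t \<in> {0..T} \<Longrightarrow> a \<bullet> b t x y p \<le> m + 1/2 * (norm (a v* p))\<^sup>2"
    using a unfolding AB1_def by blast
  have "\<exists>Kb\<ge>0. \<forall>r y. 0 \<le> r \<longrightarrow> r < T \<longrightarrow> norm (b\<^sub>0 r y (u r y) (?J r y)) \<le> Kb"
    by (rule first_order_coefficient_bounded[OF dec T \<kappa> m]) (rule b0)
  then obtain Kb where Kb0: "0 \<le> Kb" and
    b0K': "\<forall>r y. 0 \<le> r \<longrightarrow> r < T \<longrightarrow> norm (b\<^sub>0 r y (u r y) (?J r y)) \<le> Kb"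
    by (elim exE conjE) (rule that)
  note b0K = b0K'[rule_format]
  have af: "a \<bullet> f r y (u r y) (?J r y) \<le> q * Kb + m + q\<^sup>2 / 2" if r: "0 \<le> r" "r < T" and q: "norm (a v* ?J r y) \<le> q" for r y q
  proof -
    have "a \<bullet> f r y (u r y) (?J r y) = (a v* ?J r y) \<bullet> b\<^sub>0 r y (u r y) (?J r y) + a \<bullet> b r y (u r y) (?J r y)"
      by (rule inner_f_decomposition[OF fd]) (use r in simp)
    also have "(a v* ?J r y) \<bullet> b\<^sub>0 r y (u r y) (?J r y) \<le> norm (a v* ?J r y) * norm (b\<^sub>0 r y (u r y) (?J r y))"
      by (rule norm_cauchy_schwarz)
    also have "\<dots> \<le> q * Kb" using q b0K[OF r] by (intro mult_mono) (auto intro: order_trans[OF norm_ge_zero])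
    also have "a \<bullet> b r y (u r y) (?J r y) \<le> m + 1/2 * (norm (a v* ?J r y))\<^sup>2" by (rule b) (use r in simp)
    also have "(norm (a v* ?J r y))\<^sup>2 \<le> q\<^sup>2" using q by (intro power_mono) auto
    finally show ?thesis by simp
  qed
  define \<Psi> where "\<Psi> = (\<lambda>t x. a \<bullet> u t x + (m + 1) * t)"
  \<comment> \<open>bounds the drift caused by \<open>b\<^sub>0\<close>, the cost of the penalty and the square of the gradient at once\<close>
  define \<epsilon>0 where "\<epsilon>0 = 1 / (32 * Kb + real CARD('d) * C\<^sub>\<sigma> + 4)"
  have den: "0 < 32 * Kb + real CARD('d) * C\<^sub>\<sigma> + 4" using Kb0 C by (simp add: add_nonneg_pos)
  have "\<Psi> t0 x0 \<le> k + (m + 1) * T"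
  proof (rule maximum_principle_penalized[where \<Psi>=\<Psi> and T=T])
    show "\<bar>\<Psi> t x\<bar> \<le> norm a * N + (m + 1) * T" if "t \<in> {0..T}" for t x
    proof -
      have "\<bar>a \<bullet> u t x\<bar> \<le> norm a * norm (u t x)" by (rule Cauchy_Schwarz_ineq2)
      also have "\<dots> \<le> norm a * N" using N[OF that] by (intro mult_left_mono) auto
      finally have "\<bar>a \<bullet> u t x\<bar> \<le> norm a * N" .
      moreover have "0 \<le> (m + 1) * t" "(m + 1) * t \<le> (m + 1) * T" using that m by (auto intro!: mult_left_mono)
      ultimately show ?thesis unfolding \<Psi>_def by linarith
    qed
    show "continuous_on ({0..T} \<times> UNIV) (\<lambda>(t, x). \<Psi> t x)"
    proof -
      have "continuous_on ({0..T} \<times> UNIV) (\<lambda>z. a \<bullet> (\<lambda>(t, x). u t x) z + (m + 1) * fst z)"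
        by (intro continuous_intros cont)
      then show ?thesis by (simp add: \<Psi>_def case_prod_beta)
    qed
    show "0 < \<epsilon>0" using den by (simp add: \<epsilon>0_def)
    show "\<Psi> T x \<le> k + (m + 1) * T" for x
      using top[of x] by (simp add: \<Psi>_def decoupling_terminal[OF dec T])
    show "t0 \<in> {0..T}" by (rule t0)
    fix \<epsilon> t x w
    assume \<epsilon>: "0 < \<epsilon>" "\<epsilon> < \<epsilon>0" and t: "0 \<le> t" "t < T" and w: "norm w \<le> 1"
      and max: "\<And>s y. s \<in> {0..T} \<Longrightarrow> \<Psi> s y \<le> \<Psi> t x + \<epsilon> * (w \<bullet> (y - x) + (norm (y - x))\<^sup>2 / 2)"
    have \<epsilon>': "\<epsilon> * (32 * Kb) + \<epsilon> * (real CARD('d) * C\<^sub>\<sigma>) + 4 * \<epsilon> < 1"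
      using \<epsilon>(2) den by (simp add: \<epsilon>0_def less_divide_eq) (simp add: algebra_simps)
    have pos: "0 \<le> \<epsilon> * (32 * Kb)" "0 \<le> \<epsilon> * (real CARD('d) * C\<^sub>\<sigma>)" using \<epsilon> Kb0 C by auto
    have "(a v* ?J t x) \<bullet> z = \<epsilon> * (w \<bullet> z)" for z
    proof (rule derivative_at_paraboloid_contact[where \<phi>="\<lambda>y. \<Psi> t y" and x=x])
      show "((\<lambda>y. \<Psi> t y) has_derivative (\<lambda>z. (a v* ?J t x) \<bullet> z)) (at x)"
        unfolding \<Psi>_def dot_lmul_matrix
        by (auto intro!: derivative_eq_intros decoupling_derivative[OF dec t])
    qed (use max t in auto)
    from this[of "a v* ?J t x"] have "(norm (a v* ?J t x))\<^sup>2 \<le> \<epsilon> * norm (a v* ?J t x)"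
      unfolding power2_norm_eq_inner using norm_cauchy_schwarz[of w "a v* ?J t x"] w \<epsilon>
      by (metis (no_types, lifting) mult_left_mono mult_le_cancel_right1 mult_left_le_one_le less_imp_le norm_ge_zero order_trans)
    then have grad: "norm (a v* ?J t x) \<le> \<epsilon>"
      using \<epsilon> by (cases "a v* ?J t x = 0") (auto simp: power2_eq_square)
    define e where "e = \<epsilon> / (norm a + 1)"
    have na: "0 < norm a + 1" using norm_ge_zero[of a] by linarith
    have e: "0 < e" "norm a * e \<le> \<epsilon>"
      unfolding e_def times_divide_eq_right pos_divide_le_eq[OF na]
      using \<epsilon> na by (simp_all add: algebra_simps)
    obtain \<rho> where \<rho>: "0 < \<rho>" "\<And>r y. t \<le> r \<Longrightarrow> r < T \<Longrightarrow> r \<le> t + \<rho> \<Longrightarrow> dist y x \<le> \<rho> \<Longrightarrow> dist (?J r y) (?J t x) < e"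
      using continuous_near[OF contJ t e(1), of x] by blast
    define \<beta> where "\<beta> = 2 * \<epsilon> * Kb + m + (2 * \<epsilon>)\<^sup>2 / 2"
    have near: "a \<bullet> f r y (u r y) (?J r y) \<le> \<beta>" if "t \<le> r" "r < T" "r \<le> t + \<rho>" "norm (y - x) \<le> \<rho>" for r y
      unfolding \<beta>_def
    proof (rule af)
      have "norm (?J r y - ?J t x) \<le> e" using \<rho>(2)[of r y] that by (simp add: dist_norm)
      then have "norm a * norm (?J r y - ?J t x) \<le> norm a * e" by (intro mult_left_mono) auto
      then show "norm (a v* ?J r y) \<le> 2 * \<epsilon>"
        using norm_vector_matrix_mult_near[of a "?J r y" "?J t x"] grad e by simp
    qed (use that t in auto)
    have glob: "a \<bullet> f r y (u r y) (?J r y) \<le> (norm a * K) * Kb + m + (norm a * K)\<^sup>2 / 2" if "t \<le> r" "r < T" for r y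
    proof (rule af)
      have "norm a * norm (?J r y) \<le> norm a * K" using K[of r y] that t by (intro mult_left_mono) auto
      then show "norm (a v* ?J r y) \<le> norm a * K" using norm_vector_matrix_mult_le[of a "?J r y"] by simp
    qed (use that t in auto)
    obtain X I where ls: "local_solution \<sigma> f u C\<^sub>\<sigma> t x X I" using ex_local_solution[OF dec sig t] by blast
    have "0 < (1/4 :: real)" by simp
    from drift_estimate[OF ls t N cont glob \<rho>(1) near this]
    obtain h where h: "0 < h" "t + h < T"
      and low: "a \<bullet> u t x - h * (\<beta> + 1 / 4) \<le> expectation (\<lambda>\<omega>. a \<bullet> u (t + h) (X (t + h) \<omega>))" by blast
    have int: "integrable M (\<lambda>\<omega>. a \<bullet> u (t + h) (X (t + h) \<omega>))"
      by (rule local_solution_integrable_u[OF ls t(1) _ _ N cont]) (use h in \<open>auto intro!: continuous_intros\<close>)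
    have "expectation (\<lambda>\<omega>. a \<bullet> u (t + h) (X (t + h) \<omega>))
      \<le> (a \<bullet> u t x - (m + 1) * h) + \<epsilon> * (real CARD('d) * C\<^sub>\<sigma> * ((t + h) - t)) / 2"
    proof (rule expectation_contact_le[OF ls _ h(2) _ int, where w=w])
      fix \<omega>
      show "a \<bullet> u (t + h) (X (t + h) \<omega>) \<le> (a \<bullet> u t x - (m + 1) * h) +
          \<epsilon> * (w \<bullet> (X (t + h) \<omega> - x) + (norm (X (t + h) \<omega> - x))\<^sup>2 / 2)"
        using max[of "t + h" "X (t + h) \<omega>"] h t by (simp add: \<Psi>_def algebra_simps)
    qed (use h \<epsilon> in auto)
    with low have "h * (m + 1) \<le> h * (\<beta> + 1 / 4 + \<epsilon> * (real CARD('d) * C\<^sub>\<sigma>) / 2)"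
      by (simp add: algebra_simps)
    then have "m + 1 \<le> \<beta> + 1 / 4 + \<epsilon> * (real CARD('d) * C\<^sub>\<sigma>) / 2" using h(1) by simp
    moreover have "\<epsilon> \<le> 1 / 4" using \<epsilon>' pos by linarith
    then have "\<epsilon> * \<epsilon> \<le> (1 / 4) * \<epsilon>" using \<epsilon> by (intro mult_right_mono) auto
    moreover have "\<beta> = \<epsilon> * (32 * Kb) / 16 + m + 2 * (\<epsilon> * \<epsilon>)" by (simp add: \<beta>_def power2_eq_square)
    ultimately show False using \<epsilon>' pos \<epsilon>(1) by linarith
  qed
  moreover have "0 \<le> (m + 1) * t0" using t0 m by simp
  ultimately show ?thesis by (simp add: \<Psi>_def)
qed

text \<open>
  Here \<open>\<Psi> = exp (\<gamma> t) (|u|\<^sup>2 + 1)\<close>. Writing \<open>y0 = u t x\<close>, the gradient of \<open>|u|\<^sup>2\<close> is \<open>2 (y0 v* Du)\<close>, so the contact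
  condition makes \<open>y0 v* Du\<close> small while Du itself may be large. Expanding \<open>|Y|\<^sup>2\<close> around \<open>y0\<close> produces the drift
  \<open>2 (y0 \<bullet> f)\<close> and the energy, and Young's inequality plays the energy against the term \<open>|u| |Du|\<close> of the
  growth condition. This leaves a loss of rate c relative to \<open>|u|\<^sup>2 + 1\<close>, and \<open>\<gamma> = c + 1\<close> beats it.
\<close>

lemma AB2_norm_bound:
  fixes u :: "real \<Rightarrow> real^'d \<Rightarrow> real^'n"
  assumes dec: "decoupling_solution P B T \<sigma> f g u" and sig: "sigma_condition T \<sigma> L\<^sub>\<sigma> C\<^sub>\<sigma>"
    and T: "0 < T" and AB2: "AB2 T f m" and top: "\<And>x. norm (g x) \<le> k"
    and t0: "t0 \<in> {0..T}"
  shows "(norm (u t0 x0))\<^sup>2 \<le> exp ((4 * real CARD('n) * m + 2 * (real CARD('n))\<^sup>2 * m\<^sup>2 * C\<^sub>\<sigma> + 1) * T) * (k\<^sup>2 + 1)"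
proof -
  let ?J = "\<lambda>r y. jacobian (u r) (at y)"
  have C: "0 < C\<^sub>\<sigma>" using sig by (simp add: sigma_condition_def)
  obtain N K where N: "\<And>s y. s \<in> {0..T} \<Longrightarrow> norm (u s y) \<le> N"
    and K: "\<And>s y. 0 \<le> s \<Longrightarrow> s < T \<Longrightarrow> norm (?J s y) \<le> K"
    using decoupling_bounds[OF dec] by blast
  have N0: "0 \<le> N" using N[of 0 0] T by (auto intro: order_trans[OF norm_ge_zero])
  have K0: "0 \<le> K" using K[of 0 0] T by (auto intro: order_trans[OF norm_ge_zero])
  have cont: "continuous_on ({0..T} \<times> UNIV) (\<lambda>(t, x). u t x)"
    and contJ: "continuous_on ({0..<T} \<times> UNIV) (\<lambda>(t, x). ?J t x)"
    using dec by (auto simp: decoupling_solution_def)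
  from AB2 obtain \<kappa> b\<^sub>0 b where m: "0 < m" and \<kappa>: "increasing_nonneg \<kappa>" and fd: "f_decomposition T f b\<^sub>0 b"
    and b0: "\<And>t x y p. t \<in> {0..T} \<Longrightarrow> norm (b\<^sub>0 t x y p) \<le> m * (1 + \<kappa> (norm y + norm p))"
    and b: "\<And>t x y p i. t \<in> {0..T} \<Longrightarrow> \<bar>b t x y p $ i\<bar> \<le> m * (1 + norm y + norm p)"
    unfolding AB2_def by blast
  define n where "n = real CARD('n)"
  have n1: "1 \<le> n" unfolding n_def using one_le_card_finite[where 'a='n] by simp
  define c where "c = 4 * n * m + 2 * n\<^sup>2 * m\<^sup>2 * C\<^sub>\<sigma>"
  have c0: "0 \<le> c" using n1 m C by (simp add: c_def)
  define \<gamma> where "\<gamma> = c + 1"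
  have \<gamma>1: "1 \<le> \<gamma>" using c0 by (simp add: \<gamma>_def)
  have "\<exists>Kb\<ge>0. \<forall>r y. 0 \<le> r \<longrightarrow> r < T \<longrightarrow> norm (b\<^sub>0 r y (u r y) (?J r y)) \<le> Kb"
    by (rule first_order_coefficient_bounded[OF dec T \<kappa> m]) (rule b0)
  then obtain Kb where Kb0: "0 \<le> Kb" and
    b0K': "\<forall>r y. 0 \<le> r \<longrightarrow> r < T \<longrightarrow> norm (b\<^sub>0 r y (u r y) (?J r y)) \<le> Kb"
    by (elim exE conjE) (rule that)
  note b0K = b0K'[rule_format]
  have af: "a \<bullet> f r y (u r y) (?J r y) \<le> q * Kb + n * (norm a * (m * (1 + norm (u r y) + norm (?J r y))))"
    if r: "0 \<le> r" "r < T" and q: "norm (a v* ?J r y) \<le> q" for a r y q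
  proof -
    have "a \<bullet> f r y (u r y) (?J r y) = (a v* ?J r y) \<bullet> b\<^sub>0 r y (u r y) (?J r y) + a \<bullet> b r y (u r y) (?J r y)"
      by (rule inner_f_decomposition[OF fd]) (use r in simp)
    also have "(a v* ?J r y) \<bullet> b\<^sub>0 r y (u r y) (?J r y) \<le> norm (a v* ?J r y) * norm (b\<^sub>0 r y (u r y) (?J r y))"
      by (rule norm_cauchy_schwarz)
    also have "\<dots> \<le> q * Kb" using q b0K[OF r] by (intro mult_mono) (auto intro: order_trans[OF norm_ge_zero])
    also have "a \<bullet> b r y (u r y) (?J r y) \<le> (\<Sum>i\<in>(UNIV::'n set). norm a * (m * (1 + norm (u r y) + norm (?J r y))))"
      unfolding inner_vec_def
    proof (rule sum_mono)
      fix i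
      have "a $ i \<bullet> b r y (u r y) (?J r y) $ i \<le> \<bar>a $ i\<bar> * \<bar>b r y (u r y) (?J r y) $ i\<bar>"
        by (simp add: abs_mult[symmetric])
      also have "\<dots> \<le> norm a * (m * (1 + norm (u r y) + norm (?J r y)))"
        by (intro mult_mono component_le_norm_cart b) (use r in auto)
      finally show "a $ i \<bullet> b r y (u r y) (?J r y) $ i \<le> norm a * (m * (1 + norm (u r y) + norm (?J r y)))" .
    qed
    finally show ?thesis by (simp add: n_def)
  qed
  have fG: "norm (f r y (u r y) (?J r y)) \<le> K * Kb + n * (m * (1 + N + K))" if r: "0 \<le> r" "r < T" for r y
  proof -
    define v where "v = f r y (u r y) (?J r y)"
    have "norm (v v* ?J r y) \<le> norm v * K"
      using norm_vector_matrix_mult_le[of v "?J r y"] mult_left_mono[OF K[OF r, of y], of "norm v"] by simp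
    from af[OF r this]
    have "v \<bullet> v \<le> norm v * K * Kb + n * (norm v * (m * (1 + norm (u r y) + norm (?J r y))))" by (simp add: v_def)
    also have "\<dots> \<le> norm v * K * Kb + n * (norm v * (m * (1 + N + K)))"
      using N[of r y] K[OF r, of y] r m n1 by (intro add_left_mono mult_left_mono) auto
    finally have "norm v * norm v \<le> norm v * (K * Kb + n * (m * (1 + N + K)))"
      by (simp add: power2_norm_eq_inner[symmetric] power2_eq_square algebra_simps)
    moreover have "0 \<le> K * Kb + n * (m * (1 + N + K))" using K0 Kb0 n1 m N0 by simp
    ultimately have "norm v \<le> K * Kb + n * (m * (1 + N + K))"
      by (cases "v = 0") auto
    then show ?thesis by (simp add: v_def)
  qed
  define \<Psi> where "\<Psi> = (\<lambda>t x. exp (\<gamma> * t) * ((norm (u t x))\<^sup>2 + 1))"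
  \<comment> \<open>bounds the drift caused by \<open>b\<^sub>0\<close> and the cost of the penalty at once\<close>
  define \<epsilon>0 where "\<epsilon>0 = 1 / (32 * Kb + real CARD('d) * C\<^sub>\<sigma> + 1)"
  have den: "0 < 32 * Kb + real CARD('d) * C\<^sub>\<sigma> + 1" using Kb0 C by (simp add: add_nonneg_pos)
  have "\<Psi> t0 x0 \<le> exp (\<gamma> * T) * (k\<^sup>2 + 1)"
  proof (rule maximum_principle_penalized[where \<Psi>=\<Psi> and T=T])
    show "\<bar>\<Psi> t x\<bar> \<le> exp (\<gamma> * T) * (N\<^sup>2 + 1)" if "t \<in> {0..T}" for t x
    proof -
      have "exp (\<gamma> * t) * ((norm (u t x))\<^sup>2 + 1) \<le> exp (\<gamma> * T) * (N\<^sup>2 + 1)"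
        using N[OF that, of x] that \<gamma>1 by (intro mult_mono add_mono power_mono) auto
      then show ?thesis by (simp add: \<Psi>_def)
    qed
    show "continuous_on ({0..T} \<times> UNIV) (\<lambda>(t, x). \<Psi> t x)"
    proof -
      have "continuous_on ({0..T} \<times> UNIV) (\<lambda>z. exp (\<gamma> * fst z) * ((norm ((\<lambda>(t, x). u t x) z))\<^sup>2 + 1))"
        by (intro continuous_intros cont)
      then show ?thesis by (simp add: \<Psi>_def case_prod_beta)
    qed
    show "0 < \<epsilon>0" using den by (simp add: \<epsilon>0_def)
    show "\<Psi> T x \<le> exp (\<gamma> * T) * (k\<^sup>2 + 1)" for x
      using top[of x] by (simp add: \<Psi>_def decoupling_terminal[OF dec T] power_mono)
    show "t0 \<in> {0..T}" by (rule t0)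
    fix \<epsilon> t x w
    assume \<epsilon>: "0 < \<epsilon>" "\<epsilon> < \<epsilon>0" and t: "0 \<le> t" "t < T" and w: "norm w \<le> 1"
      and max: "\<And>s y. s \<in> {0..T} \<Longrightarrow> \<Psi> s y \<le> \<Psi> t x + \<epsilon> * (w \<bullet> (y - x) + (norm (y - x))\<^sup>2 / 2)"
    have \<epsilon>': "\<epsilon> * (32 * Kb) + \<epsilon> * (real CARD('d) * C\<^sub>\<sigma>) + \<epsilon> < 1"
      using \<epsilon>(2) den by (simp add: \<epsilon>0_def less_divide_eq) (simp add: algebra_simps)
    have pos: "0 \<le> \<epsilon> * (32 * Kb)" "0 \<le> \<epsilon> * (real CARD('d) * C\<^sub>\<sigma>)" using \<epsilon> Kb0 C by auto
    define y0 where "y0 = u t x"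
    define p0 where "p0 = ?J t x"
    define E where "E = exp (\<gamma> * t)"
    have E1: "1 \<le> E" using t \<gamma>1 by (simp add: E_def)
    have "E * (2 * ((y0 v* p0) \<bullet> z)) = \<epsilon> * (w \<bullet> z)" for z
    proof (rule derivative_at_paraboloid_contact[where \<phi>="\<lambda>y. \<Psi> t y" and x=x])
      show "((\<lambda>y. \<Psi> t y) has_derivative (\<lambda>z. E * (2 * ((y0 v* p0) \<bullet> z)))) (at x)"
        unfolding \<Psi>_def power2_norm_eq_inner y0_def p0_def E_def[symmetric] dot_lmul_matrix
        by (auto intro!: derivative_eq_intros decoupling_derivative[OF dec t] simp: inner_commute)
    qed (use max t in auto)
    from this[of "y0 v* p0"] have "E * (2 * (norm (y0 v* p0))\<^sup>2) = \<epsilon> * (w \<bullet> (y0 v* p0))"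
      by (simp add: power2_norm_eq_inner)
    also have "\<dots> \<le> \<epsilon> * norm (y0 v* p0)"
    proof -
      have "w \<bullet> (y0 v* p0) \<le> norm w * norm (y0 v* p0)" by (rule norm_cauchy_schwarz)
      also have "\<dots> \<le> 1 * norm (y0 v* p0)" using w by (intro mult_right_mono) auto
      finally show ?thesis using \<epsilon> by simp
    qed
    finally have "E * (2 * (norm (y0 v* p0))\<^sup>2) \<le> \<epsilon> * norm (y0 v* p0)" .
    moreover have "1 * (norm (y0 v* p0))\<^sup>2 \<le> (E * 2) * (norm (y0 v* p0))\<^sup>2" using E1 by (intro mult_right_mono) auto
    ultimately have "(norm (y0 v* p0))\<^sup>2 \<le> \<epsilon> * norm (y0 v* p0)" by simp
    then have grad: "norm (y0 v* p0) \<le> \<epsilon>"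
      using \<epsilon> by (cases "y0 v* p0 = 0") (auto simp: power2_eq_square)
    define e where "e = min (1 / 2) (\<epsilon> / (norm y0 + 1))"
    have ny: "0 < norm y0 + 1" using norm_ge_zero[of y0] by linarith
    have e: "0 < e" using \<epsilon> ny by (simp add: e_def)
    have e2: "e \<le> 1 / 2" unfolding e_def by (rule min.cobounded1)
    have ye: "norm y0 * e \<le> \<epsilon>"
    proof -
      have "norm y0 * e \<le> norm y0 * (\<epsilon> / (norm y0 + 1))" by (intro mult_left_mono) (auto simp: e_def)
      also have "\<dots> \<le> \<epsilon>"
        unfolding times_divide_eq_right pos_divide_le_eq[OF ny] using \<epsilon> by (simp add: algebra_simps)
      finally show ?thesis .
    qed
    obtain \<rho>1 where \<rho>1: "0 < \<rho>1" "\<And>r y. t \<le> r \<Longrightarrow> r < T \<Longrightarrow> r \<le> t + \<rho>1 \<Longrightarrow> dist y x \<le> \<rho>1 \<Longrightarrow> dist (?J r y) p0 < e"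
      using continuous_near[OF contJ t e, of x] unfolding p0_def by blast
    have cont': "continuous_on ({0..<T} \<times> UNIV) (\<lambda>(t, x). u t x)"
      by (rule continuous_on_subset[OF cont]) auto
    obtain \<rho>2 where \<rho>2: "0 < \<rho>2" "\<And>r y. t \<le> r \<Longrightarrow> r < T \<Longrightarrow> r \<le> t + \<rho>2 \<Longrightarrow> dist y x \<le> \<rho>2 \<Longrightarrow> dist (u r y) y0 < e"
      using continuous_near[OF cont' t e, of x] unfolding y0_def by blast
    define \<rho> where "\<rho> = min \<rho>1 \<rho>2"
    have \<rho>: "0 < \<rho>" using \<rho>1 \<rho>2 by (simp add: \<rho>_def)
    define \<beta> where "\<beta> = 2 * \<epsilon> * Kb + n * (norm y0 * (m * (2 + norm y0 + norm p0)))"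
    have near: "y0 \<bullet> f r y (u r y) (?J r y) \<le> \<beta>" if h: "t \<le> r" "r < T" "r \<le> t + \<rho>" "norm (y - x) \<le> \<rho>" for r y
    proof -
      have r0: "0 \<le> r" using h t by simp
      have d: "norm (?J r y - p0) \<le> e" "norm (u r y - y0) \<le> e"
      proof -
        have "r \<le> t + \<rho>1" "r \<le> t + \<rho>2" "dist y x \<le> \<rho>1" "dist y x \<le> \<rho>2"
          using h(3,4) by (auto simp: \<rho>_def dist_norm)
        then show "norm (?J r y - p0) \<le> e" "norm (u r y - y0) \<le> e"
          using \<rho>1(2)[of r y] \<rho>2(2)[of r y] h(1,2) by (simp_all add: dist_norm less_imp_le)
      qed
      have "norm y0 * norm (?J r y - p0) \<le> norm y0 * e" using d by (intro mult_left_mono) auto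
      then have "norm (y0 v* ?J r y) \<le> 2 * \<epsilon>"
        using norm_vector_matrix_mult_near[of y0 "?J r y" p0] grad ye by simp
      from af[OF r0 h(2) this]
      have "y0 \<bullet> f r y (u r y) (?J r y) \<le> 2 * \<epsilon> * Kb + n * (norm y0 * (m * (1 + norm (u r y) + norm (?J r y))))" .
      also have "\<dots> \<le> \<beta>"
      proof -
        have "norm (u r y) \<le> norm y0 + 1 / 2" "norm (?J r y) \<le> norm p0 + 1 / 2"
          using d e2 norm_triangle_sub[of "u r y" y0] norm_triangle_sub[of "?J r y" p0] by auto
        then show ?thesis unfolding \<beta>_def using m n1 by (intro add_left_mono mult_left_mono) auto
      qed
      finally show ?thesis .
    qed
    have fG': "norm (f r y (u r y) (?J r y)) \<le> K * Kb + n * (m * (1 + N + K))" if "t \<le> r" "r < T" for r y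
      using fG[of r y] that t by simp
    have glob: "y0 \<bullet> f r y (u r y) (?J r y) \<le> norm y0 * (K * Kb + n * (m * (1 + N + K)))" if "t \<le> r" "r < T" for r y
      using norm_cauchy_schwarz[of y0 "f r y (u r y) (?J r y)"] mult_left_mono[OF fG'[OF that, of y], of "norm y0"] by simp
    obtain X I where ls: "local_solution \<sigma> f u C\<^sub>\<sigma> t x X I" using ex_local_solution[OF dec sig t] by blast
    \<comment> \<open>three errors of this size add up to half of the slack 1/4 left to \<open>\<delta>\<close>\<close>
    have \<eta>: "0 < (1/24 :: real)" by simp
    obtain h1 where h1: "0 < h1" "t + h1 < T" and low1: "\<And>h. 0 < h \<and> h \<le> h1 \<Longrightarrow>
        y0 \<bullet> u t x - h * (\<beta> + 1 / 24) \<le> expectation (\<lambda>\<omega>. y0 \<bullet> u (t + h) (X (t + h) \<omega>))"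
      using drift_estimate[OF ls t N cont glob \<rho>(1) near \<eta>] by blast
    obtain h2 where h2: "0 < h2" "t + h2 < T" and low2: "\<And>h. 0 < h \<and> h \<le> h2 \<Longrightarrow>
        h * ((norm p0)\<^sup>2 / (2 * C\<^sub>\<sigma>) - 1 / 24) \<le> expectation (\<lambda>\<omega>. (norm (u (t + h) (X (t + h) \<omega>) - u t x))\<^sup>2)"
      using energy_estimate[OF ls t C N cont contJ fG' \<eta>] unfolding p0_def by blast
    \<comment> \<open>the last bound makes the terms of second order in h harmless\<close>
    define h where "h = min (min h1 h2) (1 / (4 * \<gamma>\<^sup>2))"
    have "0 < 1 / (4 * \<gamma>\<^sup>2)" using \<gamma>1 by simp
    then have h: "0 < h" "h \<le> h1" "h \<le> h2" "h \<le> 1 / (4 * \<gamma>\<^sup>2)" "t + h < T"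
      using h1 h2 by (auto simp: h_def)
    have h\<gamma>: "\<gamma> * (\<gamma> * h) \<le> 1 / 4"
    proof -
      have "\<gamma>\<^sup>2 * h \<le> \<gamma>\<^sup>2 * (1 / (4 * \<gamma>\<^sup>2))" using h(4) by (intro mult_left_mono) auto
      also have "\<dots> = 1 / 4" using \<gamma>1 by simp
      finally show ?thesis by (simp add: power2_eq_square mult.assoc)
    qed
    let ?Y = "\<lambda>\<omega>. u (t + h) (X (t + h) \<omega>)"
    have int: "integrable M (\<lambda>\<omega>. \<phi> (?Y \<omega>))" if "continuous_on UNIV \<phi>" for \<phi> :: "real^'n \<Rightarrow> real"
      by (rule local_solution_integrable_u[OF ls t(1) _ _ N cont that]) (use h in auto)
    have i1: "integrable M (\<lambda>\<omega>. y0 \<bullet> ?Y \<omega>)" by (rule int) (intro continuous_intros)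
    have i2: "integrable M (\<lambda>\<omega>. (norm (?Y \<omega> - y0))\<^sup>2)" by (rule int) (intro continuous_intros)
    have i3: "integrable M (\<lambda>\<omega>. (norm (?Y \<omega>))\<^sup>2)" by (rule int) (intro continuous_intros)
    define q where "q = (norm y0)\<^sup>2 + 1"
    define EY where "EY = expectation (\<lambda>\<omega>. (norm (?Y \<omega>))\<^sup>2) + 1"
    define \<delta> where "\<delta> = 4 * \<epsilon> * Kb + 1 / 8"
    have "\<delta> = \<epsilon> * (32 * Kb) / 8 + 1 / 8" by (simp add: \<delta>_def)
    then have \<delta>: "\<delta> \<le> 1 / 4" "0 \<le> \<delta>" using \<epsilon>' pos \<epsilon> by linarith+
    have q1: "1 \<le> q" by (simp add: q_def)
    have sq: "(norm (?Y \<omega>))\<^sup>2 = 2 * (y0 \<bullet> ?Y \<omega>) - (norm y0)\<^sup>2 + (norm (?Y \<omega> - y0))\<^sup>2" for \<omega>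
      by (simp add: power2_norm_eq_inner inner_diff_left inner_diff_right inner_commute)
    have "EY = 2 * expectation (\<lambda>\<omega>. y0 \<bullet> ?Y \<omega>) - (norm y0)\<^sup>2 + expectation (\<lambda>\<omega>. (norm (?Y \<omega> - y0))\<^sup>2) + 1"
      unfolding EY_def sq using i1 i2 by (simp add: P.prob_space)
    moreover have "(norm y0)\<^sup>2 - h * (\<beta> + 1 / 24) \<le> expectation (\<lambda>\<omega>. y0 \<bullet> ?Y \<omega>)"
      using low1[of h] h by (simp add: y0_def power2_norm_eq_inner)
    moreover have "h * ((norm p0)\<^sup>2 / (2 * C\<^sub>\<sigma>) - 1 / 24) \<le> expectation (\<lambda>\<omega>. (norm (?Y \<omega> - y0))\<^sup>2)"
      using low2[of h] h by (simp add: y0_def)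
    ultimately have EY1: "q - h * (2 * \<beta> + 1 / 8 - (norm p0)\<^sup>2 / (2 * C\<^sub>\<sigma>)) \<le> EY"
      unfolding q_def by (simp add: algebra_simps)
    have young: "2 * \<beta> - (norm p0)\<^sup>2 / (2 * C\<^sub>\<sigma>) \<le> 4 * \<epsilon> * Kb + c * q"
    proof -
      have "0 \<le> (norm p0 - 2 * C\<^sub>\<sigma> * n * m * norm y0)\<^sup>2 / (2 * C\<^sub>\<sigma>)" using C by simp
      also have "\<dots> = (norm p0)\<^sup>2 / (2 * C\<^sub>\<sigma>) - 2 * n * m * norm y0 * norm p0 + 2 * n\<^sup>2 * m\<^sup>2 * C\<^sub>\<sigma> * (norm y0)\<^sup>2"
        using C by (simp add: field_simps power2_eq_square)
      finally have 1: "2 * n * m * norm y0 * norm p0 \<le> (norm p0)\<^sup>2 / (2 * C\<^sub>\<sigma>) + 2 * n\<^sup>2 * m\<^sup>2 * C\<^sub>\<sigma> * (norm y0)\<^sup>2" by simp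
      have "0 \<le> (norm y0 - 1)\<^sup>2" by simp
      then have "2 * norm y0 \<le> q" by (simp add: q_def power2_eq_square algebra_simps)
      then have 2: "n * m * (4 * norm y0 + 2 * (norm y0)\<^sup>2) \<le> n * m * (4 * q)"
        using n1 m by (intro mult_left_mono) (auto simp: q_def)
      have 3: "2 * n\<^sup>2 * m\<^sup>2 * C\<^sub>\<sigma> * (norm y0)\<^sup>2 \<le> 2 * n\<^sup>2 * m\<^sup>2 * C\<^sub>\<sigma> * q"
        using C by (intro mult_left_mono) (auto simp: q_def)
      have "2 * \<beta> = 4 * \<epsilon> * Kb + n * m * (4 * norm y0 + 2 * (norm y0)\<^sup>2) + 2 * n * m * norm y0 * norm p0"
        by (simp add: \<beta>_def algebra_simps power2_eq_square)
      then show ?thesis using 1 2 3 by (simp add: c_def algebra_simps)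
    qed
    have "h * (2 * \<beta> + 1 / 8 - (norm p0)\<^sup>2 / (2 * C\<^sub>\<sigma>)) \<le> h * (c * q + \<delta>)"
      using young h by (intro mult_left_mono) (auto simp: \<delta>_def)
    then have EY2: "q - h * (c * q + \<delta>) \<le> EY" using EY1 by linarith
    have EY0: "0 \<le> EY" unfolding EY_def by (intro add_nonneg_nonneg Bochner_Integration.integral_nonneg) auto
    have "(1 + \<gamma> * h) * (q - h * (c * q + \<delta>)) \<le> (1 + \<gamma> * h) * EY"
      using EY2 \<gamma>1 h by (intro mult_left_mono) auto
    also have "\<dots> \<le> exp (\<gamma> * h) * EY"
      using EY0 by (intro mult_right_mono exp_ge_add_one_self) auto
    finally have EY3: "(1 + \<gamma> * h) * (q - h * (c * q + \<delta>)) \<le> exp (\<gamma> * h) * EY" .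
    have gain: "q + h / 2 \<le> (1 + \<gamma> * h) * (q - h * (c * q + \<delta>))"
    proof -
      have "(1 + \<gamma> * h) * (q - h * (c * q + \<delta>)) = q + h * (q - \<delta>) - h * (\<gamma> * h * (c * q + \<delta>))"
        by (simp add: \<gamma>_def algebra_simps)
      moreover have "\<gamma> * h * (c * q + \<delta>) \<le> \<gamma> * h * (\<gamma> * q)"
        using \<delta> q1 \<gamma>1 h by (intro mult_left_mono) (auto simp: \<gamma>_def algebra_simps)
      moreover have "\<gamma> * h * (\<gamma> * q) \<le> q / 4"
        using mult_right_mono[OF h\<gamma>, of q] q1 by (simp add: algebra_simps)
      ultimately have "q + h * (q - \<delta>) - h * (q / 4) \<le> (1 + \<gamma> * h) * (q - h * (c * q + \<delta>))"
        using h by (smt (verit) mult_left_mono)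
      moreover have "h * (1 / 2) \<le> h * (q - \<delta> - q / 4)" using q1 \<delta> h by (intro mult_left_mono) auto
      ultimately show ?thesis by (simp add: algebra_simps)
    qed
    have "E * (q + h / 2) \<le> exp (\<gamma> * (t + h)) * EY"
    proof -
      have "E * (q + h / 2) \<le> E * (exp (\<gamma> * h) * EY)" using gain EY3 E1 by (intro mult_left_mono) auto
      then show ?thesis by (simp add: E_def distrib_left exp_add)
    qed
    also have "\<dots> = expectation (\<lambda>\<omega>. \<Psi> (t + h) (X (t + h) \<omega>))"
      unfolding \<Psi>_def EY_def using i3 by (simp add: P.prob_space)
    also have "\<dots> \<le> \<Psi> t x + \<epsilon> * (real CARD('d) * C\<^sub>\<sigma> * ((t + h) - t)) / 2"
    proof (rule expectation_contact_le[OF ls _ h(5), where w=w])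
      show "integrable M (\<lambda>\<omega>. \<Psi> (t + h) (X (t + h) \<omega>))" unfolding \<Psi>_def using i3 by simp
      fix \<omega>
      show "\<Psi> (t + h) (X (t + h) \<omega>) \<le> \<Psi> t x + \<epsilon> * (w \<bullet> (X (t + h) \<omega> - x) + (norm (X (t + h) \<omega> - x))\<^sup>2 / 2)"
        using max[of "t + h" "X (t + h) \<omega>"] h t by simp
    qed (use h \<epsilon> in auto)
    also have "\<Psi> t x = E * q" by (simp add: \<Psi>_def E_def q_def y0_def)
    finally have "h * E \<le> h * (\<epsilon> * (real CARD('d) * C\<^sub>\<sigma>))" by (simp add: algebra_simps)
    then have "E \<le> \<epsilon> * (real CARD('d) * C\<^sub>\<sigma>)" using h(1) by simp
    then show False using \<epsilon>' pos \<epsilon> E1 by linarith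
  qed
  moreover have "(norm (u t0 x0))\<^sup>2 \<le> \<Psi> t0 x0"
  proof -
    have "1 * ((norm (u t0 x0))\<^sup>2 + 1) \<le> exp (\<gamma> * t0) * ((norm (u t0 x0))\<^sup>2 + 1)"
      using t0 \<gamma>1 by (intro mult_right_mono) auto
    then show ?thesis by (simp add: \<Psi>_def)
  qed
  ultimately show ?thesis by (simp add: \<gamma>_def c_def n_def)
qed

end

section \<open>Passage to the supremum norm\<close>

text \<open>
  Writing plus and minus the coordinate vectors as nonnegative combinations of A turns one-sided
  bounds in the directions of A into bounds of every coordinate.
\<close>

lemma positively_spans_norm_bound:
  fixes A :: "(real^'n) set"
  assumes "positively_spans A"
  shows "\<exists>k\<ge>0. \<forall>v r. 0 \<le> r \<longrightarrow> (\<forall>a\<in>A. a \<bullet> v \<le> r) \<longrightarrow> norm v \<le> k * r"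
proof -
  have fin: "finite A" and ex: "\<And>v. \<exists>c. (\<forall>a\<in>A. 0 \<le> c a) \<and> v = (\<Sum>a\<in>A. c a *\<^sub>R a)"
    using assms by (auto simp: positively_spans_def)
  then obtain c where c: "\<And>v a. a \<in> A \<Longrightarrow> 0 \<le> c v a" "\<And>v. v = (\<Sum>a\<in>A. c v a *\<^sub>R a)" by metis
  have one: "z \<bullet> v \<le> (\<Sum>a\<in>A. c z a) * r" if r: "\<forall>a\<in>A. a \<bullet> v \<le> r" for z v r
  proof -
    have "z \<bullet> v = (\<Sum>a\<in>A. c z a * (a \<bullet> v))" by (subst c(2)[of z]) (simp add: inner_sum_left)
    also have "\<dots> \<le> (\<Sum>a\<in>A. c z a * r)" using c(1) r by (intro sum_mono mult_left_mono) auto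
    finally show ?thesis by (simp add: sum_distrib_right)
  qed
  define S where "S = (\<lambda>i. (\<Sum>a\<in>A. c (axis i 1) a) + (\<Sum>a\<in>A. c (- axis i 1) a))"
  have S: "0 \<le> S i" for i unfolding S_def by (intro add_nonneg_nonneg sum_nonneg c(1))
  show ?thesis
  proof (intro exI[of _ "\<Sum>i\<in>UNIV. S i"] conjI allI impI)
    show "0 \<le> (\<Sum>i\<in>UNIV. S i)" by (intro sum_nonneg S)
    fix v r assume r0: "0 \<le> r" and r: "\<forall>a\<in>A. a \<bullet> v \<le> r"
    have "\<bar>v $ i\<bar> \<le> S i * r" for i
    proof -
      have "0 \<le> (\<Sum>a\<in>A. c (axis i 1) a) * r" "0 \<le> (\<Sum>a\<in>A. c (- axis i 1) a) * r"
        using r0 c(1) by (auto intro!: mult_nonneg_nonneg sum_nonneg)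
      then show ?thesis
        using one[OF r, of "axis i 1"] one[OF r, of "- axis i 1"]
        by (simp add: S_def inner_axis' distrib_right)
    qed
    then have "(\<Sum>i\<in>UNIV. \<bar>v $ i\<bar>) \<le> (\<Sum>i\<in>UNIV. S i * r)" by (intro sum_mono)
    then show "norm v \<le> (\<Sum>i\<in>UNIV. S i) * r"
      using norm_le_l1_cart[of v] by (simp add: sum_distrib_right)
  qed
qed

text \<open>
  Nonempty open sets are not negligible, so a continuous function cannot exceed its essential
  supremum anywhere.
\<close>

lemma Linf_norm_continuous_bound:
  fixes g :: "'a::euclidean_space \<Rightarrow> 'b::real_normed_vector"
  assumes cont: "continuous_on UNIV g" and bdd: "bounded (range g)"
  shows "norm (g x) \<le> real_of_ereal (Linf_norm UNIV g)"
proof -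
  let ?c = "Linf_norm UNIV g"
  let ?h = "\<lambda>z. ereal (norm (g z))"
  have ae: "AE z in lebesgue. ?h z \<le> ?c"
    unfolding Linf_norm_def lebesgue_on_UNIV_eq by (rule esssup_AE)
  have ch: "continuous_on UNIV ?h" by (intro continuous_on_ereal continuous_on_norm cont)
  have le: "?h x \<le> ?c" for x
  proof (rule ccontr)
    assume "\<not> ?h x \<le> ?c"
    then have x: "x \<in> {z. ?c < ?h z}" by simp
    have op: "open {z. ?c < ?h z}"
      using open_Collect_less[OF continuous_on_const ch] .
    have "{z. ?c < ?h z} \<in> null_sets lebesgue"
      by (subst AE_iff_null_sets) (use ae op in \<open>auto simp: not_less\<close>)
    then have "negligible {z. ?c < ?h z}" by (simp add: negligible_iff_null_sets)
    then show False using open_not_negligible[OF op] x by blast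
  qed
  obtain k where k: "\<And>z. norm (g z) \<le> k" using bdd by (auto simp: bounded_iff)
  have hm: "?h \<in> borel_measurable (lebesgue_on UNIV)"
    using borel_measurable_continuous_onI[OF ch] by (simp add: lebesgue_on_UNIV_eq measurable_completion)
  have "?c \<le> ereal k" unfolding Linf_norm_def
    by (rule esssup_I[OF hm]) (use k in auto)
  then show ?thesis using le[of x] by (cases ?c) auto
qed

lemma Linf_norm_le:
  fixes u :: "real \<Rightarrow> 'a::euclidean_space \<Rightarrow> 'b::euclidean_space"
  assumes cont: "continuous_on ({0..T} \<times> UNIV) (\<lambda>(t, x). u t x)"
    and le: "\<And>t x. t \<in> {0..T} \<Longrightarrow> norm (u t x) \<le> k"
  shows "Linf_norm ({0..T} \<times> UNIV) (\<lambda>(t, x). u t x) \<le> ereal k"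
  unfolding Linf_norm_def
proof (rule esssup_I)
  let ?S = "{0..T} \<times> (UNIV :: 'a set)"
  have "closed ?S" by (intro closed_Times) auto
  then have S: "?S \<in> sets lebesgue" by (intro sets_completionI_sets) (simp add: borel_closed)
  have "continuous_on ?S (\<lambda>z. norm (case z of (t, x) \<Rightarrow> u t x))"
    by (intro continuous_on_norm cont)
  then have "(\<lambda>z. norm (case z of (t, x) \<Rightarrow> u t x)) \<in> borel_measurable (lebesgue_on ?S)"
    by (rule continuous_imp_measurable_on_sets_lebesgue[OF _ S])
  then show "(\<lambda>z. ereal (norm (case z of (t, x) \<Rightarrow> u t x))) \<in> borel_measurable (lebesgue_on ?S)"
    by (rule borel_measurable_ereal)
  show "AE z in lebesgue_on ?S. ereal (norm (case z of (t, x) \<Rightarrow> u t x)) \<le> ereal k"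
    by (rule AE_I2) (use le in \<open>auto simp: space_restrict_space\<close>)
qed

theorem lemma2p5:
  fixes T :: real
  assumes "0 < T"
  shows "\<exists>(C1 :: ereal \<Rightarrow> real \<Rightarrow> (real^'n) set \<Rightarrow> real \<Rightarrow> real) (C2 :: ereal \<Rightarrow> real \<Rightarrow> real \<Rightarrow> real).
    \<forall>(P :: 'w measure) (B :: real \<Rightarrow> 'w \<Rightarrow> real^'d)
      (\<sigma> :: real \<Rightarrow> real^'d \<Rightarrow> real^'n \<Rightarrow> real^'d^'d)
      (f :: real \<Rightarrow> real^'d \<Rightarrow> real^'n \<Rightarrow> real^'d^'n \<Rightarrow> real^'n)
      (g :: real^'d \<Rightarrow> real^'n) (u :: real \<Rightarrow> real^'d \<Rightarrow> real^'n) (L\<^sub>\<sigma> :: real) (C\<^sub>\<sigma> :: real).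
      brownian_motion P T B \<and> sigma_condition T \<sigma> L\<^sub>\<sigma> C\<^sub>\<sigma> \<and> bounded (range g) \<and>
      decoupling_solution P B T \<sigma> f g u \<longrightarrow>
        (\<forall>A M. AB1 T f A M \<longrightarrow>
          Linf_norm ({0..T} \<times> UNIV) (\<lambda>(t, x). u t x) \<le> ereal (C1 (Linf_norm UNIV g) C\<^sub>\<sigma> A M)) \<and>
        (\<forall>M. AB2 T f M \<longrightarrow>
          Linf_norm ({0..T} \<times> UNIV) (\<lambda>(t, x). u t x) \<le> ereal (C2 (Linf_norm UNIV g) C\<^sub>\<sigma> M))"
proof -
  define k where "k = (\<lambda>A :: (real^'n) set. SOME k. 0 \<le> k \<and>
    (\<forall>v r. 0 \<le> r \<longrightarrow> (\<forall>a\<in>A. a \<bullet> v \<le> r) \<longrightarrow> norm v \<le> k * r))"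
  have k: "norm v \<le> k A * r" if "positively_spans A" "0 \<le> r" "\<And>a. a \<in> A \<Longrightarrow> a \<bullet> v \<le> r" for A v r
  proof -
    have "\<exists>k. 0 \<le> k \<and> (\<forall>v r. 0 \<le> r \<longrightarrow> (\<forall>a\<in>A. a \<bullet> v \<le> r) \<longrightarrow> norm v \<le> k * r)"
      using positively_spans_norm_bound[OF that(1)] by blast
    from someI_ex[OF this] show ?thesis using that unfolding k_def by blast
  qed
  define C1 where "C1 = (\<lambda>(G::ereal) (C::real) (A::(real^'n) set) (M::real).
    k A * ((\<Sum>a\<in>A. norm a) * real_of_ereal G + (M + 1) * T))"
  define C2 where "C2 = (\<lambda>(G::ereal) (C::real) (M::real).
    sqrt (exp ((4 * real CARD('n) * M + 2 * (real CARD('n))\<^sup>2 * M\<^sup>2 * C + 1) * T) * ((real_of_ereal G)\<^sup>2 + 1)))"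
  have "(\<forall>A M. AB1 T f A M \<longrightarrow>
          Linf_norm ({0..T} \<times> UNIV) (\<lambda>(t, x). u t x) \<le> ereal (C1 (Linf_norm UNIV g) C\<^sub>\<sigma> A M)) \<and>
        (\<forall>M. AB2 T f M \<longrightarrow>
          Linf_norm ({0..T} \<times> UNIV) (\<lambda>(t, x). u t x) \<le> ereal (C2 (Linf_norm UNIV g) C\<^sub>\<sigma> M))"
    if h: "brownian_motion P T B" "sigma_condition T \<sigma> L\<^sub>\<sigma> C\<^sub>\<sigma>" "bounded (range g)" "decoupling_solution P B T \<sigma> f g u"
    for P :: "'w measure" and B :: "real \<Rightarrow> 'w \<Rightarrow> real^'d" and \<sigma> :: "real \<Rightarrow> real^'d \<Rightarrow> real^'n \<Rightarrow> real^'d^'d"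
      and f :: "real \<Rightarrow> real^'d \<Rightarrow> real^'n \<Rightarrow> real^'d^'n \<Rightarrow> real^'n" and g u L\<^sub>\<sigma> C\<^sub>\<sigma>
  proof -
    interpret brownian P T B by unfold_locales (rule h(1))
    have cont: "continuous_on ({0..T} \<times> UNIV) (\<lambda>(t, x). u t x)" using h(4) by (simp add: decoupling_solution_def)
    have "continuous_on UNIV (\<lambda>x. (\<lambda>(t, x). u t x) (T, x))"
      by (rule continuous_on_compose2[OF cont]) (use assms in \<open>auto intro!: continuous_intros\<close>)
    then have "continuous_on UNIV g" by (simp add: decoupling_terminal[OF h(4) assms])
    from Linf_norm_continuous_bound[OF this h(3)]
    have g: "norm (g x) \<le> real_of_ereal (Linf_norm UNIV g)" for x .
    define G where "G = real_of_ereal (Linf_norm UNIV g)"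
    have G0: "0 \<le> G" using g[of 0] unfolding G_def by (rule order_trans[OF norm_ge_zero])
    show ?thesis
    proof (intro conjI allI impI)
      fix A m assume AB1: "AB1 T f A m"
      have A: "positively_spans A" "finite A" and m: "0 < m" using AB1 by (auto simp: AB1_def positively_spans_def)
      show "Linf_norm ({0..T} \<times> UNIV) (\<lambda>(t, x). u t x) \<le> ereal (C1 (Linf_norm UNIV g) C\<^sub>\<sigma> A m)"
      proof (rule Linf_norm_le[OF cont])
        fix t x assume t: "t \<in> {0..T}"
        show "norm (u t x) \<le> C1 (Linf_norm UNIV g) C\<^sub>\<sigma> A m"
          unfolding C1_def G_def[symmetric]
        proof (rule k[OF A(1)])
          show "0 \<le> (\<Sum>a\<in>A. norm a) * G + (m + 1) * T"
            using G0 m assms by (intro add_nonneg_nonneg mult_nonneg_nonneg sum_nonneg) auto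
          fix a assume a: "a \<in> A"
          show "a \<bullet> u t x \<le> (\<Sum>a\<in>A. norm a) * G + (m + 1) * T"
          proof (rule AB1_direction_bound[OF h(4,2) assms AB1 a _ t])
            fix x
            have "a \<bullet> g x \<le> norm a * norm (g x)" by (rule norm_cauchy_schwarz)
            also have "\<dots> \<le> (\<Sum>a\<in>A. norm a) * G"
              using g[of x] a A(2) by (intro mult_mono member_le_sum) (auto simp: G_def intro: sum_nonneg)
            finally show "a \<bullet> g x \<le> (\<Sum>a\<in>A. norm a) * G" .
          qed
        qed
      qed
    next
      fix m assume AB2: "AB2 T f m"
      show "Linf_norm ({0..T} \<times> UNIV) (\<lambda>(t, x). u t x) \<le> ereal (C2 (Linf_norm UNIV g) C\<^sub>\<sigma> m)"
      proof (rule Linf_norm_le[OF cont])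
        fix t x assume t: "t \<in> {0..T}"
        show "norm (u t x) \<le> C2 (Linf_norm UNIV g) C\<^sub>\<sigma> m"
          unfolding C2_def by (rule real_le_rsqrt) (rule AB2_norm_bound[OF h(4,2) assms AB2 g t])
      qed
    qed
  qed
  then show ?thesis by blast
qed

end
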